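(* Let $n\ge 2$, $1<p<+\infty$, let $\Omega\subset\mathbb{R}^n$ be a $C^1$ domain (bounded or unbounded), let $f\in C^1(\mathbb{R})$ and let $\kappa> 0$ be a constant (i.e. $\kappa\ge 0$ and $\kappa\neq 0$). Let $u$ be a bounded $C^3$ solution of \[ \begin{cases} \mathrm{div}\left(|\nabla u|^{p-2}\nabla u\right)+f(u)=0 & \text{in } \Omega,\\ u>0 & \text{in } \Omega,\\ u=0 & \text{on } \partial\Omega,\\ \partial_\nu u=-\kappa & \text{on } \partial\Omega, \end{cases} \] where $\nu$ is the exterior unit normal to $\partial\Omega$. Suppose there exists a primitive $F\in C^2(\mathbb{R})$ of $f$ (i.e. $F'=f$) with $F\le 0$ on $\mathbb{R}$ and \[ F(0)\ge -\frac{p-1}{p}\kappa^p . \] If $p>2$, assume in addition that for every $u_0\in\mathbb{R}$ with $F(u_0)=0$ one has $F(s)=O(|s-u_0|^p)$ as $s\to u_0$. Then either $\Omega$ is a half-space and $u$ is parallel, or $H(q)<0$ for every $q\in\partial\Omega$, where $H(q)$ denotes the mean curvature of $\partial\Omega$ at $q$.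
   Context: A solution $u$ is called parallel (one-dimensional) if there exist $x_0,a\in\mathbb{R}^n$ and a function $g:[0,+\infty)\to\mathbb{R}$ such that $\Omega=\{x\in\mathbb{R}^n: a\cdot(x-x_0)>0\}$ and $u(x)=g(a\cdot(x-x_0))$ for all $x$ in this half-space. The mean curvature $H$ of $\partial\Omega$ is taken with the sign convention for which, with $\nu$ the exterior unit normal, $\partial^2_{\nu\nu}u=\Delta u-(n-1)H\,\partial_\nu u$ on $\partial\Omega$ for functions vanishing on $\partial\Omega$ (so that the boundary sphere of a ball has positive mean curvature). *)

theory Defs
  imports "HOL-Analysis.Analysis" "HOL-Library.Landau_Symbols"
begin

definition partial :: "'n::finite \<Rightarrow> (real^'n \<Rightarrow> real) \<Rightarrow> real^'n \<Rightarrow> real" where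
  "partial i f x = deriv (\<lambda>t. f (x + t *\<^sub>R axis i 1)) 0"

primrec Dp :: "'n::finite list \<Rightarrow> (real^'n \<Rightarrow> real) \<Rightarrow> real^'n \<Rightarrow> real" where
  "Dp [] f = f"
| "Dp (i # is) f = partial i (Dp is f)"

definition grad :: "(real^'n::finite \<Rightarrow> real) \<Rightarrow> real^'n \<Rightarrow> real^'n" where
  "grad f x = (\<chi> i. partial i f x)"

definition divg :: "(real^'n::finite \<Rightarrow> real^'n) \<Rightarrow> real^'n \<Rightarrow> real" where
  "divg V x = (\<Sum>i\<in>UNIV. partial i (\<lambda>y. V y $ i) x)"

definition Ck_on :: "nat \<Rightarrow> (real^'n::finite \<Rightarrow> real) \<Rightarrow> (real^'n) set \<Rightarrow> bool" where
  "Ck_on k f S \<longleftrightarrow>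
     (\<forall>is::'n list. length is \<le> k \<longrightarrow> continuous_on S (Dp is f)) \<and>
     (\<forall>(is::'n list) i x. length is < k \<and> x \<in> S \<longrightarrow>
         (\<lambda>t. Dp is f (x + t *\<^sub>R axis i 1)) differentiable (at 0))"

definition Ck_closure :: "nat \<Rightarrow> (real^'n::finite \<Rightarrow> real) \<Rightarrow> (real^'n) set \<Rightarrow> bool" where
  "Ck_closure k f \<Omega> \<longleftrightarrow> Ck_on k f \<Omega> \<and> continuous_on (closure \<Omega>) f \<and>
     (\<forall>is::'n list. length is \<le> k \<longrightarrow>
        (\<exists>g. continuous_on (closure \<Omega>) g \<and> (\<forall>x\<in>\<Omega>. g x = Dp is f x)))"

definition bgrad :: "(real^'n::finite \<Rightarrow> real) \<Rightarrow> (real^'n) set \<Rightarrow> real^'n \<Rightarrow> real^'n" where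
  "bgrad u \<Omega> q = (\<chi> i. Lim (at q within \<Omega>) (partial i u))"

definition local_defining ::
    "nat \<Rightarrow> (real^'n::finite) set \<Rightarrow> real^'n \<Rightarrow> real \<Rightarrow> (real^'n \<Rightarrow> real) \<Rightarrow> bool" where
  "local_defining k \<Omega> q r \<phi> \<longleftrightarrow> r > 0 \<and> Ck_on k \<phi> (ball q r) \<and>
     (\<forall>x\<in>ball q r. grad \<phi> x \<noteq> 0) \<and>
     \<Omega> \<inter> ball q r = {x \<in> ball q r. \<phi> x < 0}"

definition C1_domain :: "(real^'n::finite) set \<Rightarrow> bool" where
  "C1_domain \<Omega> \<longleftrightarrow> open \<Omega> \<and> connected \<Omega> \<and> \<Omega> \<noteq> {} \<and>
     (\<forall>q\<in>frontier \<Omega>. \<exists>r \<phi>. local_defining 1 \<Omega> q r \<phi>)"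

definition ext_normal :: "(real^'n::finite) set \<Rightarrow> real^'n \<Rightarrow> real^'n \<Rightarrow> bool" where
  "ext_normal \<Omega> q \<nu> \<longleftrightarrow> (\<exists>r \<phi>. local_defining 1 \<Omega> q r \<phi> \<and>
     \<nu> = (1 / norm (grad \<phi> q)) *\<^sub>R grad \<phi> q)"

text \<open>H is the mean curvature of the boundary at q: (n-1) H = div of the exterior unit
  normal field (positive for spheres bounding balls).\<close>
definition mean_curv :: "(real^'n::finite) set \<Rightarrow> real^'n \<Rightarrow> real \<Rightarrow> bool" where
  "mean_curv \<Omega> q H \<longleftrightarrow> (\<exists>r \<phi>. local_defining 2 \<Omega> q r \<phi> \<and>
     H = divg (\<lambda>x. (1 / norm (grad \<phi> x)) *\<^sub>R grad \<phi> x) q / (real CARD('n) - 1))"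

definition test_fn :: "(real^'n::finite \<Rightarrow> real) \<Rightarrow> (real^'n) set \<Rightarrow> bool" where
  "test_fn \<psi> \<Omega> \<longleftrightarrow> (\<forall>k. Ck_on k \<psi> UNIV) \<and> compact (closure {x. \<psi> x \<noteq> 0}) \<and>
     closure {x. \<psi> x \<noteq> 0} \<subseteq> \<Omega>"

text \<open>div(|grad u|^(p-2) grad u) + f(u) = 0 in Omega, in the (standard) weak sense.\<close>
definition p_laplace_eq :: "real \<Rightarrow> (real \<Rightarrow> real) \<Rightarrow> (real^'n::finite \<Rightarrow> real) \<Rightarrow> (real^'n) set \<Rightarrow> bool" where
  "p_laplace_eq p f u \<Omega> \<longleftrightarrow> (\<forall>\<psi>. test_fn \<psi> \<Omega> \<longrightarrow>
     integral \<Omega> (\<lambda>x. norm (grad u x) powr (p - 2) * (grad u x \<bullet> grad \<psi> x))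
       = integral \<Omega> (\<lambda>x. f (u x) * \<psi> x))"

definition parallel_sol :: "(real^'n::finite) set \<Rightarrow> (real^'n \<Rightarrow> real) \<Rightarrow> bool" where
  "parallel_sol \<Omega> u \<longleftrightarrow> (\<exists>x0 a (g::real \<Rightarrow> real).
     \<Omega> = {x. a \<bullet> (x - x0) > 0} \<and> (\<forall>x\<in>\<Omega>. u x = g (a \<bullet> (x - x0))))"

end

theory Submission
  imports Defs
begin

text \<open>Let \<open>P = (p - 1) / p \<bar>\<nabla>u\<bar>\<^sup>p + F(u)\<close>. Where \<open>\<nabla>u \<noteq> 0\<close> the equation holds pointwise and \<open>P\<close> is a subsolution of a
  linear elliptic equation. On the boundary \<open>P\<close> is the constant \<open>c = (p - 1) / p \<kappa>\<^sup>p + F(0) \<ge> 0\<close>. If \<open>P\<close> exceeded \<open>c\<close>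
  somewhere then \<open>P > 0\<close> there, hence \<open>\<nabla>u \<noteq> 0\<close> (as \<open>F \<le> 0\<close>), and a cutoff argument with the strict perturbation
  \<open>ln P + \<eta> exp (K u)\<close> gives a contradiction as the cutoff radius grows; so \<open>P \<le> c\<close>. By the strong maximum principle
  either \<open>P = c\<close> everywhere, and then the Hessian of \<open>u\<close> is a multiple of \<open>\<nabla>u \<otimes> \<nabla>u\<close>, the direction of \<open>\<nabla>u\<close> is
  constant and \<open>u\<close> is parallel; or \<open>P < c\<close> inside, and then the boundary point lemma gives \<open>\<partial>P/\<partial>\<nu> > 0\<close>, which is
  \<open>- (n - 1) H \<kappa>\<^sup>p > 0\<close>. That the boundary is of class \<open>C\<^sup>2\<close> follows from \<open>\<nabla>u = - \<kappa> \<nu>\<close> on it: the time after which a line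
  transversal to the boundary leaves the domain has a gradient proportional to \<open>\<nabla>u\<close> at the exit point.\<close>

section \<open>Derivatives along lines\<close>

lemma has_real_derivative_line_shift:
  fixes f :: "'a::real_vector \<Rightarrow> real"
  assumes "((\<lambda>r. f (x + t *\<^sub>R v + r *\<^sub>R v)) has_real_derivative D) (at 0)"
  shows "((\<lambda>r. f (x + r *\<^sub>R v)) has_real_derivative D) (at t)"
proof -
  have "((\<lambda>r. f (x + (r + t) *\<^sub>R v)) has_real_derivative D) (at 0)"
    using assms by (simp add: algebra_simps)
  then show ?thesis
    using DERIV_shift[of "\<lambda>r. f (x + r *\<^sub>R v)" D 0 t] by simp
qed

lemma has_derivative_along_line:
  fixes f :: "'a::real_normed_vector \<Rightarrow> real"
  assumes "(f has_derivative f') (at (x + t *\<^sub>R v))"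
  shows "((\<lambda>r. f (x + r *\<^sub>R v)) has_real_derivative f' v) (at t)"
proof -
  interpret bounded_linear f' using assms by (rule has_derivative_bounded_linear)
  have "((\<lambda>r. x + r *\<^sub>R v) has_derivative (\<lambda>r. r *\<^sub>R v)) (at t)"
    by (auto intro!: derivative_eq_intros)
  from has_derivative_compose[OF this assms] show ?thesis
    by (simp add: has_field_derivative_def scaleR mult_commute_abs)
qed

lemma has_derivative_direction:
  fixes f :: "'a::real_normed_vector \<Rightarrow> real"
  assumes "(f has_derivative f') (at x)"
  shows "((\<lambda>r. f (x + r *\<^sub>R v)) has_real_derivative f' v) (at 0)"
  using has_derivative_along_line[of f f' x 0 v] assms by simp

lemma eventually_line_in_open:
  fixes x :: "'a::real_normed_vector"
  assumes "open S" "x \<in> S"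
  shows "\<forall>\<^sub>F t in nhds (0::real). x + t *\<^sub>R v \<in> S"
proof -
  have "((\<lambda>t. x + t *\<^sub>R v) \<longlongrightarrow> x + 0 *\<^sub>R v) (nhds (0::real))"
    by (intro tendsto_intros filterlim_ident)
  then show ?thesis using assms by (auto simp: tendsto_def)
qed

lemma mvt_along_line:
  fixes f :: "'a::real_vector \<Rightarrow> real"
  assumes "s > 0"
    and "\<And>t. 0 \<le> t \<Longrightarrow> t \<le> s \<Longrightarrow> ((\<lambda>r. f (x + t *\<^sub>R v + r *\<^sub>R v)) has_real_derivative D (x + t *\<^sub>R v)) (at 0)"
  obtains t where "0 < t" "t < s" "f (x + s *\<^sub>R v) - f x = s * D (x + t *\<^sub>R v)"
proof -
  have "\<exists>t>0. t < s \<and> f (x + s *\<^sub>R v) - f (x + 0 *\<^sub>R v) = (s - 0) * D (x + t *\<^sub>R v)"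
    by (rule MVT2[OF assms(1)], rule has_real_derivative_line_shift[where f=f], rule assms(2))
  then show thesis using that by auto
qed

lemma has_derivative_inner_iff_caratheodory:
  fixes f :: "'a::real_inner \<Rightarrow> real"
  shows "(f has_derivative (\<lambda>h. G \<bullet> h)) (at x) \<longleftrightarrow>
    (\<exists>\<psi>. isCont \<psi> x \<and> \<psi> x = G \<and> (\<forall>y. f y - f x = \<psi> y \<bullet> (y - x)))"
proof
  assume der: "(f has_derivative (\<lambda>h. G \<bullet> h)) (at x)"
  define err where "err y = f y - f x - G \<bullet> (y - x)" for y
  define \<psi> where "\<psi> y = G + (err y / (norm (y - x))\<^sup>2) *\<^sub>R (y - x)" for y
  have "((\<lambda>y. norm (err y) / norm (y - x)) \<longlongrightarrow> 0) (at x)"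
    using der tendsto_norm_zero by (fastforce simp: has_derivative_iff_norm err_def)
  moreover have "norm (\<psi> y - G) = norm (err y) / norm (y - x)" for y
    by (cases "y = x") (auto simp: \<psi>_def power2_eq_square)
  ultimately have "((\<lambda>y. \<psi> y - G) \<longlongrightarrow> 0) (at x)"
    by (intro tendsto_norm_zero_cancel[of "\<lambda>y. \<psi> y - G"]) (simp only:)
  then have "isCont \<psi> x"
    unfolding isCont_def by (subst LIM_zero_iff[symmetric]) (simp add: \<psi>_def)
  moreover have "f y - f x = \<psi> y \<bullet> (y - x)" for y
    by (cases "y = x") (auto simp: \<psi>_def err_def inner_add_left power2_norm_eq_inner)
  ultimately show "\<exists>\<psi>. isCont \<psi> x \<and> \<psi> x = G \<and> (\<forall>y. f y - f x = \<psi> y \<bullet> (y - x))"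
    by (intro exI[of _ \<psi>]) (simp add: \<psi>_def)
next
  assume "\<exists>\<psi>. isCont \<psi> x \<and> \<psi> x = G \<and> (\<forall>y. f y - f x = \<psi> y \<bullet> (y - x))"
  then obtain \<psi> where \<psi>: "isCont \<psi> x" "\<psi> x = G" "\<And>y. f y - f x = \<psi> y \<bullet> (y - x)" by blast
  show "(f has_derivative (\<lambda>h. G \<bullet> h)) (at x)"
    unfolding has_derivative_iff_norm
  proof (intro conjI bounded_linear_inner_right)
    have lim: "((\<lambda>y. norm (\<psi> y - G)) \<longlongrightarrow> 0) (at x)"
      using \<psi>(1,2) unfolding isCont_def by (intro tendsto_norm_zero) (simp add: LIM_zero_iff)
    have "norm (norm (f y - f x - G \<bullet> (y - x)) / norm (y - x)) \<le> norm (\<psi> y - G)" for y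
    proof (cases "y = x")
      case False
      have "norm (f y - f x - G \<bullet> (y - x)) = norm ((\<psi> y - G) \<bullet> (y - x))"
        by (simp add: \<psi>(3) inner_diff_left)
      also have "\<dots> \<le> norm (\<psi> y - G) * norm (y - x)"
        using Cauchy_Schwarz_ineq2 by simp
      finally show ?thesis using False by (simp add: divide_le_eq)
    qed simp
    then show "((\<lambda>y. norm (f y - f x - G \<bullet> (y - x)) / norm (y - x)) \<longlongrightarrow> 0) (at x)"
      by (intro Lim_null_comparison[OF always_eventually lim] allI)
  qed
qed

lemma has_derivative_norm_powr:
  fixes v :: "'a::real_inner"
  assumes "v \<noteq> 0"
  shows "((\<lambda>v. norm v powr r) has_derivative (\<lambda>h. r * norm v powr (r - 2) * (v \<bullet> h))) (at v)"
proof -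
  have "((\<lambda>s. s powr r) has_derivative (\<lambda>h. r * norm v powr (r - 1) * h)) (at (norm v))"
    using has_real_derivative_powr[of "norm v" r] assms by (simp add: has_field_derivative_def)
  from has_derivative_compose[OF has_derivative_norm[OF assms] this]
  have "((\<lambda>v. norm v powr r) has_derivative (\<lambda>h. r * norm v powr (r - 1) * (h \<bullet> sgn v))) (at v)" .
  moreover have "norm v powr (r - 1) * (h \<bullet> sgn v) = norm v powr (r - 2) * (v \<bullet> h)" for h
  proof -
    have "norm v powr (r - 1) = norm v powr (r - 2) * norm v"
      using assms powr_add[of "norm v" "r - 2" 1] by simp
    then show ?thesis using assms by (simp add: sgn_div_norm inner_commute)
  qed
  ultimately show ?thesis by (simp add: mult.assoc)
qed

lemma has_derivative_sgn:
  fixes v :: "'a::real_inner"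
  assumes "v \<noteq> 0"
  shows "(sgn has_derivative (\<lambda>h. (1 / norm v) *\<^sub>R (h - ((v \<bullet> h) / (v \<bullet> v)) *\<^sub>R v))) (at v)"
proof -
  have "norm v powr (- 1 - 2) = 1 / norm v / (v \<bullet> v)"
    using assms by (subst powr_diff) (simp add: powr_minus_divide power2_norm_eq_inner)
  then have "((\<lambda>v. norm v powr - 1 *\<^sub>R v) has_derivative
      (\<lambda>h. norm v powr - 1 *\<^sub>R h + (- 1 * (1 / norm v / (v \<bullet> v)) * (v \<bullet> h)) *\<^sub>R v)) (at v)"
    using has_derivative_scaleR[OF has_derivative_norm_powr[OF assms, of "- 1"] has_derivative_ident] by simp
  then have "((\<lambda>v. norm v powr - 1 *\<^sub>R v) has_derivative
      (\<lambda>h. (1 / norm v) *\<^sub>R (h - ((v \<bullet> h) / (v \<bullet> v)) *\<^sub>R v))) (at v)"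
    using assms by (simp add: powr_minus_divide algebra_simps)
  moreover have "norm w powr - 1 *\<^sub>R w = sgn w" for w :: 'a
    by (cases "w = 0") (simp_all add: powr_minus sgn_div_norm)
  ultimately show ?thesis by simp
qed

section \<open>Partial derivatives\<close>

text \<open>Changing the coordinates one at a time and applying the mean value theorem each time.\<close>
lemma coordinatewise_mean_value:
  fixes f :: "real^'n \<Rightarrow> real" and D :: "'n \<Rightarrow> real^'n \<Rightarrow> real"
  assumes "finite I"
    and deriv: "\<And>i y. norm (y - x) \<le> norm h \<Longrightarrow>
      ((\<lambda>t. f (y + t *\<^sub>R axis i 1)) has_real_derivative D i y) (at 0)"
  shows "\<exists>\<xi>. (\<forall>i. norm (\<xi> i - x) \<le> norm h) \<and>
    f (x + (\<chi> i. if i \<in> I then h $ i else 0)) - f x = (\<Sum>i\<in>I. D i (\<xi> i) * h $ i)"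
  using assms(1)
proof (induction I rule: finite_induct)
  case empty
  have "(\<chi> i. if i \<in> {} then h $ i else 0) = 0" by (simp add: vec_eq_iff)
  then show ?case by (intro exI[of _ "\<lambda>_. x"]) simp
next
  case (insert i I)
  define y where "y = x + (\<chi> i. if i \<in> I then h $ i else 0)"
  obtain \<xi> where \<xi>: "\<And>i. norm (\<xi> i - x) \<le> norm h" "f y - f x = (\<Sum>i\<in>I. D i (\<xi> i) * h $ i)"
    using insert.IH unfolding y_def by blast
  have close: "norm (y + t *\<^sub>R h $ i *\<^sub>R axis i 1 - x) \<le> norm h" if "0 \<le> t" "t \<le> 1" for t
    using that insert.hyps
    by (intro norm_le_componentwise_cart) (auto simp: y_def axis_def abs_mult mult_left_le_one_le)
  obtain t where t: "0 < t" "t < 1"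
    "f (y + 1 *\<^sub>R h $ i *\<^sub>R axis i 1) - f y = 1 * (D i (y + t *\<^sub>R h $ i *\<^sub>R axis i 1) * h $ i)"
  proof (rule mvt_along_line[of 1 f y "h $ i *\<^sub>R axis i 1" "\<lambda>y. D i y * h $ i"])
    fix t :: real assume "0 \<le> t" "t \<le> 1"
    let ?z = "y + t *\<^sub>R h $ i *\<^sub>R axis i 1"
    have "((\<lambda>r. r * h $ i) has_real_derivative h $ i) (at 0)"
      by (auto intro!: derivative_eq_intros)
    then show "((\<lambda>r. f (?z + r *\<^sub>R h $ i *\<^sub>R axis i 1)) has_real_derivative D i ?z * h $ i) (at 0)"
      using DERIV_chain2[where f="\<lambda>t. f (?z + t *\<^sub>R axis i 1)" and g="\<lambda>r. r * h $ i"]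
        deriv[OF close[OF \<open>0 \<le> t\<close> \<open>t \<le> 1\<close>]] by simp
  qed auto
  define \<xi>' where "\<xi>' = \<xi>(i := y + t *\<^sub>R h $ i *\<^sub>R axis i 1)"
  have "y + h $ i *\<^sub>R axis i 1 = x + (\<chi> j. if j \<in> insert i I then h $ j else 0)"
    using insert.hyps by (auto simp: y_def vec_eq_iff axis_def)
  moreover have "(\<Sum>j\<in>insert i I. D j (\<xi>' j) * h $ j)
      = D i (y + t *\<^sub>R h $ i *\<^sub>R axis i 1) * h $ i + (\<Sum>j\<in>I. D j (\<xi> j) * h $ j)"
    unfolding sum.insert[OF insert.hyps] using insert.hyps
    by (intro arg_cong2[where f="(+)"] sum.cong) (auto simp: \<xi>'_def)
  moreover have "\<forall>j. norm (\<xi>' j - x) \<le> norm h"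
    using \<xi>(1) close[of t] t by (simp add: \<xi>'_def)
  ultimately show ?case
    using \<xi>(2) t(3) by (intro exI[of _ \<xi>']) simp
qed

lemma has_derivative_continuous_partials:
  fixes f :: "real^'n \<Rightarrow> real" and D :: "'n \<Rightarrow> real^'n \<Rightarrow> real"
  assumes "open S" "x \<in> S"
    and deriv: "\<And>i y. y \<in> S \<Longrightarrow> ((\<lambda>t. f (y + t *\<^sub>R axis i 1)) has_real_derivative D i y) (at 0)"
    and cont: "\<And>i. continuous (at x) (D i)"
  shows "(f has_derivative (\<lambda>h. \<Sum>i\<in>UNIV. D i x * h $ i)) (at x)"
  unfolding has_derivative_at_alt
proof (intro conjI allI impI)
  show "bounded_linear (\<lambda>h::real^'n. \<Sum>i\<in>UNIV. D i x * h $ i)"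
    by (intro bounded_linear_sum bounded_linear_compose[OF bounded_linear_mult_right bounded_linear_vec_nth])
next
  fix e :: real assume "e > 0"
  define e' where "e' = e / CARD('n)"
  have "e' > 0" using \<open>e > 0\<close> by (simp add: e'_def)
  then have "\<forall>i. \<forall>\<^sub>F y in nhds x. \<bar>D i y - D i x\<bar> < e'"
    using cont by (auto simp: continuous_at_eps_delta eventually_nhds_metric dist_real_def)
  then have "\<forall>\<^sub>F y in nhds x. \<forall>i. \<bar>D i y - D i x\<bar> < e'"
    by (simp add: eventually_all_finite)
  moreover have "\<forall>\<^sub>F y in nhds x. y \<in> S"
    using assms(1,2) by (rule eventually_nhds_in_open)
  ultimately have "\<forall>\<^sub>F y in nhds x. y \<in> S \<and> (\<forall>i. \<bar>D i y - D i x\<bar> < e')"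
    by eventually_elim auto
  then obtain d where d: "d > 0" "\<And>y. dist y x < d \<Longrightarrow> y \<in> S \<and> (\<forall>i. \<bar>D i y - D i x\<bar> < e')"
    unfolding eventually_nhds_metric by blast
  show "\<exists>d>0. \<forall>y. norm (y - x) < d \<longrightarrow>
      norm (f y - f x - (\<Sum>i\<in>UNIV. D i x * (y - x) $ i)) \<le> e * norm (y - x)"
  proof (intro exI[of _ d] conjI allI impI d(1))
    fix y assume y: "norm (y - x) < d"
    have "((\<lambda>t. f (z + t *\<^sub>R axis i 1)) has_real_derivative D i z) (at 0)"
      if "norm (z - x) \<le> norm (y - x)" for i z
      using d(2)[of z] that y by (intro deriv) (simp add: dist_norm)
    moreover have "x + (\<chi> i. if i \<in> UNIV then (y - x) $ i else 0) = y" by (simp add: vec_eq_iff)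
    ultimately obtain \<xi> where \<xi>: "\<And>i. norm (\<xi> i - x) \<le> norm (y - x)"
      "f y - f x = (\<Sum>i\<in>UNIV. D i (\<xi> i) * (y - x) $ i)"
      using coordinatewise_mean_value[where I=UNIV and f=f and D=D and h="y - x" and x=x] by force
    have "norm (f y - f x - (\<Sum>i\<in>UNIV. D i x * (y - x) $ i))
        = \<bar>\<Sum>i\<in>UNIV. (D i (\<xi> i) - D i x) * (y - x) $ i\<bar>"
      by (simp add: \<xi>(2) sum_subtractf left_diff_distrib)
    also have "\<dots> \<le> (\<Sum>i\<in>(UNIV::'n set). e' * norm (y - x))"
    proof (rule order_trans[OF sum_abs], rule sum_mono)
      fix i
      have "\<bar>D i (\<xi> i) - D i x\<bar> \<le> e'"
        using d(2)[of "\<xi> i"] \<xi>(1)[of i] y by (simp add: dist_norm less_imp_le)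
      then show "\<bar>(D i (\<xi> i) - D i x) * (y - x) $ i\<bar> \<le> e' * norm (y - x)"
        unfolding abs_mult by (intro mult_mono component_le_norm_cart) (use \<open>e' > 0\<close> in auto)
    qed
    also have "\<dots> = e * norm (y - x)" by (simp add: e'_def)
    finally show "norm (f y - f x - (\<Sum>i\<in>UNIV. D i x * (y - x) $ i)) \<le> e * norm (y - x)" .
  qed
qed

lemma partial_has_real_derivative:
  assumes "(\<lambda>t. f (x + t *\<^sub>R axis i 1)) differentiable (at 0)"
  shows "((\<lambda>t. f (x + t *\<^sub>R axis i 1)) has_real_derivative partial i f x) (at 0)"
  unfolding partial_def
  using assms by (metis DERIV_imp_deriv real_differentiable_def)

lemma partial_eqI:
  assumes "(f has_derivative f') (at x)"
  shows "partial i f x = f' (axis i 1)"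
  unfolding partial_def by (rule DERIV_imp_deriv[OF has_derivative_direction[OF assms]])

lemma second_difference_mean_value:
  fixes f :: "'a::real_vector \<Rightarrow> real"
  assumes "s > 0"
    and square: "\<And>a b. 0 \<le> a \<Longrightarrow> a \<le> s \<Longrightarrow> 0 \<le> b \<Longrightarrow> b \<le> s \<Longrightarrow> x + a *\<^sub>R v + b *\<^sub>R w \<in> S"
    and D: "\<And>y. y \<in> S \<Longrightarrow> ((\<lambda>t. f (y + t *\<^sub>R v)) has_real_derivative D y) (at 0)"
    and E: "\<And>y. y \<in> S \<Longrightarrow> ((\<lambda>t. D (y + t *\<^sub>R w)) has_real_derivative E y) (at 0)"
  obtains a b where "0 < a" "a < s" "0 < b" "b < s"
    "f (x + s *\<^sub>R v + s *\<^sub>R w) - f (x + s *\<^sub>R v) - f (x + s *\<^sub>R w) + f x = s\<^sup>2 * E (x + a *\<^sub>R v + b *\<^sub>R w)"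
proof -
  let ?\<Delta> = "\<lambda>y. f (y + s *\<^sub>R w) - f y"
  obtain a where a: "0 < a" "a < s"
    "?\<Delta> (x + s *\<^sub>R v) - ?\<Delta> x = s * (D (x + a *\<^sub>R v + s *\<^sub>R w) - D (x + a *\<^sub>R v))"
  proof (rule mvt_along_line[OF \<open>s > 0\<close>, of ?\<Delta> x v "\<lambda>y. D (y + s *\<^sub>R w) - D y"])
    fix t assume t: "0 \<le> t" "t \<le> s"
    let ?y = "x + t *\<^sub>R v"
    have "?y \<in> S" "?y + s *\<^sub>R w \<in> S" using square[OF t, of 0] square[OF t, of s] \<open>s > 0\<close> by auto
    from DERIV_diff[OF D[OF this(2)] D[OF this(1)]]
    show "((\<lambda>r. ?\<Delta> (?y + r *\<^sub>R v)) has_real_derivative D (?y + s *\<^sub>R w) - D ?y) (at 0)"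
      by (simp add: algebra_simps)
  qed
  obtain b where b: "0 < b" "b < s"
    "D (x + a *\<^sub>R v + s *\<^sub>R w) - D (x + a *\<^sub>R v) = s * E (x + a *\<^sub>R v + b *\<^sub>R w)"
    by (rule mvt_along_line[OF \<open>s > 0\<close>, of D "x + a *\<^sub>R v" w E]) (use square a in \<open>auto intro: E\<close>)
  show thesis
    by (rule that[OF a(1,2) b(1,2)]) (use a(3) b(3) in \<open>simp add: power2_eq_square\<close>)
qed

lemma second_difference_quotient_tendsto:
  fixes f :: "'a::real_normed_vector \<Rightarrow> real"
  assumes "open S" "x \<in> S"
    and D: "\<And>y. y \<in> S \<Longrightarrow> ((\<lambda>t. f (y + t *\<^sub>R v)) has_real_derivative D y) (at 0)"
    and E: "\<And>y. y \<in> S \<Longrightarrow> ((\<lambda>t. D (y + t *\<^sub>R w)) has_real_derivative E y) (at 0)"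
    and cont: "continuous (at x) E"
  shows "((\<lambda>s. (f (x + s *\<^sub>R v + s *\<^sub>R w) - f (x + s *\<^sub>R v) - f (x + s *\<^sub>R w) + f x) / s\<^sup>2) \<longlongrightarrow> E x) (at_right 0)"
    (is "((\<lambda>s. ?\<Delta> s / s\<^sup>2) \<longlongrightarrow> E x) (at_right 0)")
proof (rule tendstoI)
  fix e :: real assume "e > 0"
  have "\<forall>\<^sub>F y in nhds x. dist (E y) (E x) < e"
    using cont \<open>e > 0\<close> by (auto simp: continuous_at_eps_delta eventually_nhds_metric)
  moreover have "\<forall>\<^sub>F y in nhds x. y \<in> S"
    using assms(1,2) by (rule eventually_nhds_in_open)
  ultimately have "\<forall>\<^sub>F y in nhds x. y \<in> S \<and> dist (E y) (E x) < e" by eventually_elim auto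
  then obtain d where d: "d > 0" "\<And>y. dist y x < d \<Longrightarrow> y \<in> S \<and> dist (E y) (E x) < e"
    unfolding eventually_nhds_metric by blast
  define d' where "d' = d / (norm v + norm w + 1)"
  have d': "d' > 0" using d(1) norm_ge_zero[of v] norm_ge_zero[of w] by (simp add: d'_def add_nonneg_pos)
  have near: "dist (x + a *\<^sub>R v + b *\<^sub>R w) x < d"
    if "0 \<le> a" "a \<le> s" "0 \<le> b" "b \<le> s" "0 < s" "s < d'" for a b s
  proof -
    have "norm (a *\<^sub>R v + b *\<^sub>R w) \<le> s * norm v + s * norm w"
      using that by (intro norm_triangle_le add_mono) (auto intro: mult_right_mono)
    also have "\<dots> < d' * (norm v + norm w + 1)"
      using that unfolding distrib_left[symmetric] by (intro mult_le_less_imp_less) (auto simp: add_nonneg_pos)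
    also have "\<dots> = d"
      using add_nonneg_pos[OF add_nonneg_nonneg[OF norm_ge_zero[of v] norm_ge_zero[of w]] zero_less_one]
      by (simp add: d'_def)
    finally show ?thesis by (simp add: dist_norm add.assoc)
  qed
  have "dist (?\<Delta> s / s\<^sup>2) (E x) < e" if s: "0 < s" "s < d'" for s
  proof -
    obtain a b where ab: "0 < a" "a < s" "0 < b" "b < s" "?\<Delta> s = s\<^sup>2 * E (x + a *\<^sub>R v + b *\<^sub>R w)"
    proof (rule second_difference_mean_value[OF s(1) _ D E])
      show "x + a *\<^sub>R v + b *\<^sub>R w \<in> S" if "0 \<le> a" "a \<le> s" "0 \<le> b" "b \<le> s" for a b
        using d(2)[OF near[OF that s]] by blast
    qed
    moreover have "dist (E (x + a *\<^sub>R v + b *\<^sub>R w)) (E x) < e"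
      using d(2)[OF near[OF _ _ _ _ s], of a b] ab by simp
    ultimately show ?thesis using s by simp
  qed
  then show "\<forall>\<^sub>F s in at_right 0. dist (?\<Delta> s / s\<^sup>2) (E x) < e"
    using d' unfolding eventually_at_right_field by blast
qed

lemma mixed_directional_derivatives_eq:
  fixes f :: "'a::real_normed_vector \<Rightarrow> real"
  assumes "open S" "x \<in> S"
    and "\<And>y. y \<in> S \<Longrightarrow> ((\<lambda>t. f (y + t *\<^sub>R v)) has_real_derivative Dv y) (at 0)"
    and "\<And>y. y \<in> S \<Longrightarrow> ((\<lambda>t. f (y + t *\<^sub>R w)) has_real_derivative Dw y) (at 0)"
    and "\<And>y. y \<in> S \<Longrightarrow> ((\<lambda>t. Dv (y + t *\<^sub>R w)) has_real_derivative Dwv y) (at 0)"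
    and "\<And>y. y \<in> S \<Longrightarrow> ((\<lambda>t. Dw (y + t *\<^sub>R v)) has_real_derivative Dvw y) (at 0)"
    and "continuous (at x) Dwv" "continuous (at x) Dvw"
  shows "Dwv x = Dvw x"
proof (rule tendsto_unique[OF trivial_limit_at_right_real])
  show "((\<lambda>s. (f (x + s *\<^sub>R v + s *\<^sub>R w) - f (x + s *\<^sub>R v) - f (x + s *\<^sub>R w) + f x) / s\<^sup>2) \<longlongrightarrow> Dwv x) (at_right 0)"
    by (rule second_difference_quotient_tendsto[OF assms(1,2,3,5,7)])
  show "((\<lambda>s. (f (x + s *\<^sub>R v + s *\<^sub>R w) - f (x + s *\<^sub>R v) - f (x + s *\<^sub>R w) + f x) / s\<^sup>2) \<longlongrightarrow> Dvw x) (at_right 0)"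
    using second_difference_quotient_tendsto[OF assms(1,2,4,6,8)] by (simp add: algebra_simps)
qed

section \<open>Functions of class \<open>C\<^sup>k\<close>\<close>

lemma Ck_on_mono: "Ck_on k f S \<Longrightarrow> j \<le> k \<Longrightarrow> Ck_on j f S"
  unfolding Ck_on_def by auto

lemma Ck_on_subset: "Ck_on k f S \<Longrightarrow> T \<subseteq> S \<Longrightarrow> Ck_on k f T"
  unfolding Ck_on_def by (blast intro: continuous_on_subset)

lemma Ck_on_continuous: "Ck_on k f S \<Longrightarrow> length is \<le> k \<Longrightarrow> continuous_on S (Dp is f)"
  unfolding Ck_on_def by blast

lemma Ck_on_partial_derivative:
  assumes "Ck_on k f S" "length is < k" "x \<in> S"
  shows "((\<lambda>t. Dp is f (x + t *\<^sub>R axis i 1)) has_real_derivative Dp (i # is) f x) (at 0)"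
  using assms by (auto simp: Ck_on_def intro!: partial_has_real_derivative)

lemma Ck_on_continuous_at:
  assumes "Ck_on k f S" "open S" "length is \<le> k" "x \<in> S"
  shows "continuous (at x) (Dp is f)"
  using assms by (auto simp: Ck_on_def continuous_on_eq_continuous_at)

lemma Ck_on_has_derivative:
  fixes f :: "real^'n \<Rightarrow> real"
  assumes "Ck_on k f S" "open S" "length is < k" "x \<in> S"
  shows "(Dp is f has_derivative (\<lambda>h. \<Sum>i\<in>UNIV. Dp (i # is) f x * h $ i)) (at x)"
  using assms
  by (intro has_derivative_continuous_partials[of S] Ck_on_partial_derivative Ck_on_continuous_at) auto

lemma Ck_on_Dp_swap:
  fixes f :: "real^'n \<Rightarrow> real"
  assumes "Ck_on k f S" "open S" "length is + 2 \<le> k" "x \<in> S"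
  shows "Dp (i # j # is) f x = Dp (j # i # is) f x"
  using assms
  by (intro mixed_directional_derivatives_eq[OF assms(2,4), where f="Dp is f" and v="axis j 1" and w="axis i 1"
        and Dv="Dp (j # is) f" and Dw="Dp (i # is) f"] Ck_on_partial_derivative Ck_on_continuous_at) auto

definition hess :: "(real^'n::finite \<Rightarrow> real) \<Rightarrow> real^'n \<Rightarrow> real^'n^'n" where
  "hess f x = (\<chi> i j. Dp [j, i] f x)"

definition third_deriv :: "(real^'n::finite \<Rightarrow> real) \<Rightarrow> real^'n \<Rightarrow> real^'n \<Rightarrow> real^'n^'n" where
  "third_deriv f x h = (\<chi> i j. \<Sum>k\<in>UNIV. Dp [k, j, i] f x * h $ k)"

lemma Ck_on_has_derivative_grad:
  fixes f :: "real^'n \<Rightarrow> real"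
  assumes "Ck_on k f S" "open S" "1 \<le> k" "x \<in> S"
  shows "(f has_derivative (\<lambda>h. grad f x \<bullet> h)) (at x)"
  using Ck_on_has_derivative[OF assms(1,2), of "[]" x] assms
  by (simp add: inner_vec_def grad_def)

lemma Ck_on_grad_has_derivative:
  fixes f :: "real^'n \<Rightarrow> real"
  assumes "Ck_on k f S" "open S" "2 \<le> k" "x \<in> S"
  shows "(grad f has_derivative (\<lambda>h. hess f x *v h)) (at x)"
proof -
  have "((\<lambda>y. grad f y $ i) has_derivative (\<lambda>h. (hess f x *v h) $ i)) (at x)" for i
    using Ck_on_has_derivative[OF assms(1,2), of "[i]" x] assms
    by (simp add: grad_def hess_def matrix_vector_mult_def)
  then show ?thesis
    by (subst has_derivative_componentwise_within) (auto simp: Basis_vec_def inner_axis)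
qed

lemma Ck_on_hess_has_derivative:
  fixes f :: "real^'n \<Rightarrow> real"
  assumes "Ck_on k f S" "open S" "3 \<le> k" "x \<in> S"
  shows "(hess f has_derivative (\<lambda>h. third_deriv f x h)) (at x)"
proof -
  have "((\<lambda>y. hess f y $ i $ j) has_derivative (\<lambda>h. third_deriv f x h $ i $ j)) (at x)" for i j
    using Ck_on_has_derivative[OF assms(1,2), of "[j,i]" x] assms
    by (simp add: third_deriv_def hess_def)
  then show ?thesis
    by (subst has_derivative_componentwise_within) (auto simp: Basis_vec_def inner_axis)
qed

lemma Ck_on_grad_continuous:
  assumes "Ck_on k f S" "1 \<le> k"
  shows "continuous_on S (grad f)"
  using Ck_on_continuous[OF assms(1), of "[_]"] assms(2)
  by (auto simp: grad_def [abs_def] intro!: continuous_on_vec_lambda)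

lemma Ck_on_hess_continuous:
  assumes "Ck_on k f S" "2 \<le> k"
  shows "continuous_on S (hess f)"
  unfolding hess_def [abs_def] using assms
  by (intro continuous_on_vec_lambda Ck_on_continuous) auto

lemma transpose_hess:
  assumes "Ck_on k f S" "open S" "2 \<le> k" "x \<in> S"
  shows "transpose (hess f x) = hess f x"
  using Ck_on_Dp_swap[OF assms(1,2), of "[]" x] assms by (simp add: hess_def transpose_def vec_eq_iff)

lemma third_deriv_commute:
  fixes f :: "real^'n \<Rightarrow> real"
  assumes "Ck_on k f S" "open S" "3 \<le> k" "x \<in> S"
  shows "third_deriv f x h *v v = third_deriv f x v *v h"
proof -
  have swap: "Dp [k, j, i] f x = Dp [j, k, i] f x" for i j k
    using Ck_on_Dp_swap[OF assms(1,2), of "[i]" x] assms by simp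
  have "(third_deriv f x h *v v) $ i = (\<Sum>j\<in>UNIV. \<Sum>k\<in>UNIV. Dp [k, j, i] f x * h $ k * v $ j)" for i
    by (simp add: third_deriv_def matrix_vector_mult_def sum_distrib_right)
  also have "\<dots> i = (\<Sum>k\<in>UNIV. \<Sum>j\<in>UNIV. Dp [j, k, i] f x * v $ j * h $ k)" for i
    by (subst sum.swap, simp only: swap[of _ _ i] mult_ac)
  also have "\<dots> i = (third_deriv f x v *v h) $ i" for i
    by (simp add: third_deriv_def matrix_vector_mult_def sum_distrib_right)
  finally show ?thesis by (simp add: vec_eq_iff)
qed

lemma Dp_append: "Dp (is @ js) f = Dp is (Dp js f)"
  by (induction "is") auto

lemma Ck_on_SucI:
  assumes "continuous_on S f" and "\<And>i x. x \<in> S \<Longrightarrow> (\<lambda>t. f (x + t *\<^sub>R axis i 1)) differentiable (at 0)"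
    and partial: "\<And>i. Ck_on k (partial i f) S"
  shows "Ck_on (Suc k) f S"
  unfolding Ck_on_def
proof (intro conjI allI impI)
  fix "is" :: "'a list" assume "length is \<le> Suc k"
  then show "continuous_on S (Dp is f)"
    using assms(1) Ck_on_continuous[OF partial] by (cases "is" rule: rev_cases) (simp_all add: Dp_append)
next
  fix "is" :: "'a list" and i x assume "length is < Suc k \<and> x \<in> S"
  then show "(\<lambda>t. Dp is f (x + t *\<^sub>R axis i 1)) differentiable (at 0)"
    using assms(2) partial unfolding Ck_on_def by (cases "is" rule: rev_cases) (simp_all add: Dp_append)
qed

lemma has_derivative_line_differentiable:
  fixes f :: "'a::real_normed_vector \<Rightarrow> real"
  assumes "(f has_derivative f') (at x)"
  shows "(\<lambda>t. f (x + t *\<^sub>R v)) differentiable (at 0)"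
  using has_derivative_direction[OF assms] real_differentiable_def by blast

lemma Ck_on_1I:
  fixes f :: "real^'n \<Rightarrow> real"
  assumes der: "\<And>x. x \<in> S \<Longrightarrow> (f has_derivative D x) (at x)" and cont: "\<And>v. continuous_on S (\<lambda>x. D x v)"
  shows "Ck_on 1 f S"
  unfolding One_nat_def
proof (rule Ck_on_SucI)
  show "continuous_on S f"
    using der has_derivative_continuous by (blast intro: continuous_at_imp_continuous_on)
  show "(\<lambda>t. f (x + t *\<^sub>R axis i 1)) differentiable (at 0)" if "x \<in> S" for i x
    by (rule has_derivative_line_differentiable[OF der[OF that]])
  have "continuous_on S (partial i f)" for i
    by (rule continuous_on_eq[OF cont[of "axis i 1"]]) (rule partial_eqI[OF der, symmetric])
  then show "Ck_on 0 (partial i f) S" for i by (simp add: Ck_on_def)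
qed

lemma Ck_on_2I:
  fixes f :: "real^'n \<Rightarrow> real"
  assumes "open S" and f: "\<And>x. x \<in> S \<Longrightarrow> (f has_derivative (\<lambda>h. G x \<bullet> h)) (at x)"
    and G: "\<And>x. x \<in> S \<Longrightarrow> (G has_derivative H x) (at x)" and cont: "\<And>v. continuous_on S (\<lambda>x. H x v)"
  shows "Ck_on 2 f S"
  unfolding numeral_2_eq_2
proof (rule Ck_on_SucI)
  show "continuous_on S f"
    using f has_derivative_continuous by (blast intro: continuous_at_imp_continuous_on)
  show "(\<lambda>t. f (x + t *\<^sub>R axis i 1)) differentiable (at 0)" if "x \<in> S" for i x
    by (rule has_derivative_line_differentiable[OF f[OF that]])
  have "(partial i f has_derivative (\<lambda>h. H x h $ i)) (at x)" if "x \<in> S" for i x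
    by (rule has_derivative_transform_within_open[OF bounded_linear.has_derivative[OF bounded_linear_vec_nth G[OF that]]
        \<open>open S\<close> that])
       (simp add: partial_eqI[OF f] inner_axis)
  then show "Ck_on (Suc 0) (partial i f) S" for i
    unfolding One_nat_def[symmetric] by (rule Ck_on_1I) (auto intro!: continuous_intros cont)
qed

lemma grad_eqI: "(f has_derivative (\<lambda>h. G \<bullet> h)) (at x) \<Longrightarrow> grad f x = G"
  by (simp add: grad_def vec_eq_iff partial_eqI inner_axis)

section \<open>Outer products and traces\<close>

definition outer :: "real^'m \<Rightarrow> real^'n \<Rightarrow> real^'n^'m" where
  "outer v w = (\<chi> i j. v $ i * w $ j)"

lemma inner_outer: "M \<bullet> outer v w = v \<bullet> (M *v w)"
  by (simp add: outer_def inner_vec_def matrix_vector_mult_def sum_distrib_left mult_ac)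

lemma outer_vector_mult: "outer v w *v h = (w \<bullet> h) *\<^sub>R v"
  by (simp add: outer_def vec_eq_iff inner_vec_def matrix_vector_mult_def sum_distrib_left mult_ac)

lemma inner_matrix_vector_mult_commute:
  fixes M :: "real^'n^'n"
  assumes "transpose M = M"
  shows "v \<bullet> (M *v w) = (M *v v) \<bullet> w"
  using assms by (metis dot_lmul_matrix inner_commute transpose_matrix_vector)

lemma bounded_bilinear_matrix_vector_mult:
  "bounded_bilinear ((*v) :: real^'n^'m \<Rightarrow> real^'n \<Rightarrow> real^'m)"
  unfolding bilinear_conv_bounded_bilinear[symmetric] bilinear_def
  by (auto intro!: linearI simp: matrix_vector_mult_add_rdistrib matrix_vector_right_distrib
      scaleR_matrix_vector_assoc matrix_vector_mult_scaleR)

definition op_trace :: "('a::euclidean_space \<Rightarrow> 'a) \<Rightarrow> real" where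
  "op_trace H = (\<Sum>b\<in>Basis. b \<bullet> H b)"

lemma op_trace_add: "op_trace (\<lambda>h. H h + K h) = op_trace H + op_trace K"
  by (simp add: op_trace_def inner_add_right sum.distrib)

lemma op_trace_scaleR: "op_trace (\<lambda>h. c *\<^sub>R H h) = c * op_trace H"
  by (simp add: op_trace_def sum_distrib_left)

lemma op_trace_rank_one: "op_trace (\<lambda>h. (v \<bullet> h) *\<^sub>R w) = v \<bullet> w"
  by (simp add: op_trace_def euclidean_inner[of v w] inner_commute[of w])

lemma op_trace_cart: "op_trace H = (\<Sum>i\<in>UNIV. H (axis i 1) $ i)" for H :: "real^'n \<Rightarrow> real^'n"
proof -
  have Basis: "(Basis :: (real^'n) set) = range (\<lambda>i. axis i 1)" by (auto simp: Basis_vec_def)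
  show ?thesis
    unfolding op_trace_def Basis
    by (subst sum.reindex) (auto simp: inj_on_def axis_eq_axis inner_axis')
qed

lemma op_trace_matrix: "op_trace ((*v) M) = trace M" for M :: "real^'n^'n"
  by (simp add: op_trace_cart trace_def matrix_vector_mult_basis column_def)

lemma op_trace_symmetric_square:
  fixes M :: "real^'n^'n"
  assumes "transpose M = M"
  shows "op_trace (\<lambda>h. M *v (M *v h)) = M \<bullet> M"
proof -
  have "(M *v (M *v axis i 1)) $ i = M $ i \<bullet> M $ i" for i
  proof -
    have "M $ j $ i = M $ i $ j" for j
      using arg_cong[OF assms, of "\<lambda>N. N $ i $ j"] by (simp add: transpose_def)
    then have "M *v axis i 1 = M $ i"
      by (simp add: matrix_vector_mult_basis column_def vec_eq_iff)
    then show ?thesis by (simp only: matrix_vector_mul_component)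
  qed
  then show ?thesis by (simp only: op_trace_cart inner_vec_def[of M])
qed

definition tangential_trace :: "'a::euclidean_space \<Rightarrow> ('a \<Rightarrow> 'a) \<Rightarrow> real" where
  "tangential_trace g H = op_trace H - (g \<bullet> H g) / (g \<bullet> g)"

text \<open>The vectors \<open>b - ((b \<bullet> g) / (g \<bullet> g)) g\<close> are the projections of the basis to \<open>g\<^sup>\<bottom>\<close>.\<close>
lemma tangential_trace_eq_sum:
  fixes H :: "'a::euclidean_space \<Rightarrow> 'a"
  assumes "linear H" "g \<noteq> 0"
  defines "e \<equiv> \<lambda>b. b - ((b \<bullet> g) / (g \<bullet> g)) *\<^sub>R g"
  shows "tangential_trace g H = (\<Sum>b\<in>Basis. e b \<bullet> H (e b))"
proof -
  interpret linear H by fact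
  define r where "r b = (b \<bullet> g) / (g \<bullet> g)" for b
  have "(\<Sum>b\<in>Basis. r b *\<^sub>R b) = (\<Sum>b\<in>Basis. (1 / (g \<bullet> g)) *\<^sub>R ((g \<bullet> b) *\<^sub>R b))"
    by (simp add: r_def inner_commute)
  then have g: "(\<Sum>b\<in>Basis. r b *\<^sub>R b) = (1 / (g \<bullet> g)) *\<^sub>R g"
    by (simp only: euclidean_representation flip: scaleR_sum_right)
  have "(\<Sum>b\<in>Basis. r b * (b \<bullet> H g)) = (g \<bullet> H g) / (g \<bullet> g)"
    using arg_cong[OF g, of "\<lambda>v. v \<bullet> H g"] by (simp add: inner_sum_left)
  moreover have "(\<Sum>b\<in>Basis. r b * (g \<bullet> H b)) = (g \<bullet> H g) / (g \<bullet> g)"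
    using arg_cong[OF g, of "\<lambda>v. g \<bullet> H v"] by (simp add: sum scaleR inner_sum_right)
  moreover have "(\<Sum>b\<in>Basis. r b * r b) = 1 / (g \<bullet> g)"
    using arg_cong[OF g, of "\<lambda>v. v \<bullet> g"] \<open>g \<noteq> 0\<close>
    by (simp add: inner_sum_left r_def flip: sum_divide_distrib)
  moreover have "e b \<bullet> H (e b) = b \<bullet> H b - r b * (b \<bullet> H g) - r b * (g \<bullet> H b) + (r b * r b) * (g \<bullet> H g)" for b
    unfolding e_def r_def[symmetric] by (simp add: diff scaleR inner_diff_left inner_diff_right algebra_simps)
  ultimately have "(\<Sum>b\<in>Basis. e b \<bullet> H (e b)) = op_trace H - (g \<bullet> H g) / (g \<bullet> g)"
    by (simp add: op_trace_def sum.distrib sum_subtractf flip: sum_distrib_right)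
  then show ?thesis by (simp add: tangential_trace_def)
qed

definition tangential_matrix :: "real^'n \<Rightarrow> real^'n^'n \<Rightarrow> real^'n^'n" where
  "tangential_matrix g M = M - (1 / (g \<bullet> g)) *\<^sub>R (outer g (M *v g) + outer (M *v g) g)
     + ((M *v g) \<bullet> g / (g \<bullet> g)\<^sup>2) *\<^sub>R outer g g"

lemma norm_tangential_matrix:
  fixes M :: "real^'n^'n"
  assumes "transpose M = M" "g \<noteq> 0"
  defines "s \<equiv> M *v g"
  shows "(norm (tangential_matrix g M))\<^sup>2 = M \<bullet> M - 2 * (s \<bullet> s) / (g \<bullet> g) + (s \<bullet> g)\<^sup>2 / (g \<bullet> g)\<^sup>2"
proof -
  define q where "q = 1 / (g \<bullet> g)"
  have q: "q * (g \<bullet> g) = 1" using assms(2) by (simp add: q_def)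
  define X where "X = outer g s + outer s g"
  have "g \<bullet> (M *v s) = s \<bullet> s"
    using inner_matrix_vector_mult_commute[OF assms(1)] by (simp add: s_def)
  then have inner_MX: "M \<bullet> X = 2 * (s \<bullet> s)" and inner_MY: "M \<bullet> outer g g = s \<bullet> g"
    by (simp_all add: X_def inner_add_right inner_outer inner_commute[of g s] flip: s_def)
  have inner_XX: "X \<bullet> X = 2 * (g \<bullet> g) * (s \<bullet> s) + 2 * (s \<bullet> g)\<^sup>2" and inner_XY: "X \<bullet> outer g g = 2 * (s \<bullet> g) * (g \<bullet> g)"
    and inner_YY: "outer g g \<bullet> outer g g = (g \<bullet> g)\<^sup>2"
    by (simp_all add: X_def inner_add_right inner_add_left inner_outer outer_vector_mult matrix_vector_mult_add_rdistrib
        inner_commute[of g s] power2_eq_square)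
  have "tangential_matrix g M = M - q *\<^sub>R X + ((s \<bullet> g) * q\<^sup>2) *\<^sub>R outer g g"
    by (simp add: tangential_matrix_def q_def s_def X_def power_divide)
  then have "(norm (tangential_matrix g M))\<^sup>2 = M \<bullet> M + q\<^sup>2 * (X \<bullet> X)
      + ((s \<bullet> g) * q\<^sup>2)\<^sup>2 * (outer g g \<bullet> outer g g) - 2 * q * (M \<bullet> X)
      + 2 * ((s \<bullet> g) * q\<^sup>2) * (M \<bullet> outer g g) - 2 * q * ((s \<bullet> g) * q\<^sup>2) * (X \<bullet> outer g g)"
    by (simp add: power2_norm_eq_inner inner_add_left inner_add_right inner_diff_left inner_diff_right
        inner_commute[of X M] inner_commute[of "outer g g" M] inner_commute[of "outer g g" X])
       (simp add: power2_eq_square algebra_simps)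
  also have "\<dots> = M \<bullet> M - 2 * q * (s \<bullet> s) + (s \<bullet> g)\<^sup>2 * q\<^sup>2"
    unfolding inner_MX inner_MY inner_XX inner_XY inner_YY using q by algebra
  finally show ?thesis by (simp add: q_def power_divide)
qed

definition p_trace :: "real \<Rightarrow> 'a::euclidean_space \<Rightarrow> ('a \<Rightarrow> 'a) \<Rightarrow> real" where
  "p_trace p g H = op_trace H + (p - 2) * (g \<bullet> H g) / (g \<bullet> g)"

lemma p_trace_add: "p_trace p g (\<lambda>h. H h + K h) = p_trace p g H + p_trace p g K"
  by (simp add: p_trace_def op_trace_add inner_add_right distrib_left add_divide_distrib)

lemma p_trace_scaleR: "p_trace p g (\<lambda>h. c *\<^sub>R H h) = c * p_trace p g H"
  by (simp add: p_trace_def op_trace_scaleR distrib_left)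

lemma p_trace_ident: "g \<noteq> 0 \<Longrightarrow> p_trace p g (\<lambda>h. h) = real DIM('a) + p - 2" for g :: "'a::euclidean_space"
  by (simp add: p_trace_def op_trace_def)

lemma p_trace_rank_one:
  "p_trace p g (\<lambda>h. (v \<bullet> h) *\<^sub>R v) = v \<bullet> v + (p - 2) * (v \<bullet> g)\<^sup>2 / (g \<bullet> g)"
  by (simp add: p_trace_def op_trace_rank_one power2_eq_square inner_commute[of g v])

lemma p_trace_rank_one_ge:
  assumes "g \<noteq> 0"
  shows "min 1 (p - 1) * (v \<bullet> v) \<le> p_trace p g (\<lambda>h. (v \<bullet> h) *\<^sub>R v)"
proof -
  define r where "r = (v \<bullet> g)\<^sup>2 / (g \<bullet> g)"
  have r: "0 \<le> r" "r \<le> v \<bullet> v"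
    using assms Cauchy_Schwarz_ineq[of v g] by (auto simp: r_def divide_le_eq)
  have "min 1 (p - 1) * (v \<bullet> v) \<le> v \<bullet> v + (p - 2) * r"
  proof (cases "p \<ge> 2")
    case True
    then have "(p - 2) * r \<ge> 0" using r by simp
    then show ?thesis using True by simp
  next
    case False
    then have "(2 - p) * r \<le> (2 - p) * (v \<bullet> v)" using r by (intro mult_left_mono) auto
    then show ?thesis using False by (simp add: algebra_simps)
  qed
  then show ?thesis by (simp add: p_trace_rank_one r_def)
qed

lemma p_trace_nonpos:
  assumes "linear H" "g \<noteq> 0" "p > 1" and H: "\<And>v. v \<bullet> H v \<le> 0"
  shows "p_trace p g H \<le> 0"
proof -
  have "p_trace p g H = tangential_trace g H + (p - 1) * (g \<bullet> H g) / (g \<bullet> g)"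
    by (simp add: p_trace_def tangential_trace_def left_diff_distrib diff_divide_distrib)
  moreover have "tangential_trace g H \<le> 0"
    unfolding tangential_trace_eq_sum[OF assms(1,2)] by (intro sum_nonpos H)
  moreover have "(p - 1) * (g \<bullet> H g) / (g \<bullet> g) \<le> 0"
    using assms(3) H by (intro divide_nonpos_nonneg mult_nonneg_nonpos) auto
  ultimately show ?thesis by linarith
qed

section \<open>Bump functions\<close>

definition flat :: "real poly \<Rightarrow> real \<Rightarrow> real" where
  "flat q t = (if t > 0 then poly q (1 / t) * exp (- 1 / t) else 0)"

lemma tendsto_poly_div_exp_0: "((\<lambda>x. poly q x / exp x) \<longlongrightarrow> (0::real)) at_top"
proof -
  have "((\<lambda>x. \<Sum>i\<le>degree q. coeff q i * (x ^ i / exp x)) \<longlongrightarrow> (\<Sum>i\<le>degree q. coeff q i * 0)) at_top"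
    by (intro tendsto_intros tendsto_power_div_exp_0)
  then show ?thesis by (simp add: poly_altdef sum_divide_distrib)
qed

lemma flat_div_tendsto_0: "((\<lambda>h. flat q h / h) \<longlongrightarrow> 0) (at 0)"
proof -
  have "((\<lambda>h. poly (monom 1 1 * q) (inverse h) / exp (inverse h)) \<longlongrightarrow> 0) (at_right 0)"
    by (rule filterlim_compose[OF tendsto_poly_div_exp_0 filterlim_inverse_at_top_right])
  moreover have "\<forall>\<^sub>F h in at_right 0. poly (monom 1 1 * q) (inverse h) / exp (inverse h) = flat q h / h"
    unfolding eventually_at_right_field
    by (intro exI[of _ 1]) (auto simp: flat_def poly_monom field_simps exp_minus)
  ultimately have "((\<lambda>h. flat q h / h) \<longlongrightarrow> 0) (at_right 0)"
    by (rule Lim_transform_eventually)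
  moreover have "((\<lambda>h. flat q h / h) \<longlongrightarrow> 0) (at_left 0)"
    by (rule Lim_transform_eventually[where f="\<lambda>_. 0"])
       (auto simp: flat_def eventually_at_left_field intro!: exI[of _ "-1"])
  ultimately show ?thesis by (simp add: filterlim_at_split)
qed

lemma flat_has_derivative:
  "(flat q has_real_derivative flat (monom 1 2 * (q - pderiv q)) t) (at t)"
proof -
  consider "t > 0" | "t < 0" | "t = 0" by linarith
  then show ?thesis
  proof cases
    assume t: "t > 0"
    have "((\<lambda>t. poly q (1 / t) * exp (- 1 / t)) has_real_derivative flat (monom 1 2 * (q - pderiv q)) t) (at t)"
      using t
      by (auto intro!: derivative_eq_intros poly_DERIV simp: flat_def poly_monom power2_eq_square field_simps)
    moreover have "\<forall>\<^sub>F s in nhds t. poly q (1 / s) * exp (- 1 / s) = flat q s"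
      using eventually_nhds_in_open[of "{0<..}" t] t by (auto simp: flat_def elim: eventually_mono)
    ultimately show ?thesis by (subst DERIV_cong_ev[symmetric]) auto
  next
    assume t: "t < 0"
    have "\<forall>\<^sub>F s in nhds t. 0 = flat q s"
      using eventually_nhds_in_open[of "{..<0}" t] t by (auto simp: flat_def elim: eventually_mono)
    moreover have "((\<lambda>s. 0) has_real_derivative flat (monom 1 2 * (q - pderiv q)) t) (at t)"
      using t by (simp add: flat_def)
    ultimately show ?thesis by (subst DERIV_cong_ev[symmetric]) auto
  next
    assume "t = 0"
    then show ?thesis using flat_div_tendsto_0 by (simp add: has_field_derivative_iff flat_def)
  qed
qed

inductive_set bumps :: "real \<Rightarrow> real \<Rightarrow> (real \<Rightarrow> real) set" for a b where
  base: "(\<lambda>t. flat q (t - a) * flat r (b - t)) \<in> bumps a b"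
| add: "\<phi> \<in> bumps a b \<Longrightarrow> \<psi> \<in> bumps a b \<Longrightarrow> (\<lambda>t. \<phi> t + \<psi> t) \<in> bumps a b"

lemma bumps_derivative:
  assumes "\<phi> \<in> bumps a b"
  shows "\<exists>\<phi>'\<in>bumps a b. \<forall>t. (\<phi> has_real_derivative \<phi>' t) (at t)"
  using assms
proof induction
  case (base q r)
  define D where "D q = monom 1 2 * (q - pderiv q)" for q :: "real poly"
  have flat_uminus: "flat (- q) t = - flat q t" for q t by (simp add: flat_def)
  have left: "((\<lambda>t. flat q (t - a)) has_real_derivative flat (D q) (t - a)) (at t)" for t
  proof -
    have "((\<lambda>t. t - a) has_real_derivative 1) (at t)" by (auto intro!: derivative_eq_intros)
    from DERIV_chain2[where f="flat q", OF flat_has_derivative this] show ?thesis by (simp add: D_def)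
  qed
  have right: "((\<lambda>t. flat r (b - t)) has_real_derivative flat (- D r) (b - t)) (at t)" for t
  proof -
    have "((\<lambda>t. b - t) has_real_derivative -1) (at t)" by (auto intro!: derivative_eq_intros)
    from DERIV_chain2[where f="flat r", OF flat_has_derivative this] show ?thesis by (simp add: D_def flat_uminus)
  qed
  show ?case
    by (rule bexI[of _ "\<lambda>t. flat (D q) (t - a) * flat r (b - t) + flat q (t - a) * flat (- D r) (b - t)"])
       (auto intro!: derivative_eq_intros left right bumps.intros)
next
  case (add \<phi> \<psi>)
  then obtain \<phi>' \<psi>' where "\<phi>' \<in> bumps a b" "\<psi>' \<in> bumps a b"
    "\<forall>t. (\<phi> has_real_derivative \<phi>' t) (at t)" "\<forall>t. (\<psi> has_real_derivative \<psi>' t) (at t)" by blast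
  then show ?case
    by (intro bexI[of _ "\<lambda>t. \<phi>' t + \<psi>' t"]) (auto intro!: derivative_eq_intros bumps.intros)
qed

lemma bumps_eq_0: "\<phi> \<in> bumps a b \<Longrightarrow> \<not> (a < t \<and> t < b) \<Longrightarrow> \<phi> t = 0"
  by (induction rule: bumps.induct) (auto simp: flat_def)

definition tensor_bumps :: "real^'n \<Rightarrow> real^'n \<Rightarrow> (real^'n::finite \<Rightarrow> real) set" where
  "tensor_bumps a b = {\<psi>. \<exists>\<phi>. (\<forall>i. \<phi> i \<in> bumps (a $ i) (b $ i)) \<and> \<psi> = (\<lambda>x. \<Prod>i\<in>UNIV. \<phi> i (x $ i))}"

lemma tensor_bumps_partial:
  assumes "\<psi> \<in> tensor_bumps a b"
  shows "partial i \<psi> \<in> tensor_bumps a b"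
    "((\<lambda>t. \<psi> (x + t *\<^sub>R axis i 1)) has_real_derivative partial i \<psi> x) (at 0)"
proof -
  obtain \<phi> where \<phi>: "\<And>i. \<phi> i \<in> bumps (a $ i) (b $ i)" and \<psi>: "\<psi> = (\<lambda>x. \<Prod>i\<in>UNIV. \<phi> i (x $ i))"
    using assms by (auto simp: tensor_bumps_def)
  obtain \<phi>' where \<phi>': "\<phi>' \<in> bumps (a $ i) (b $ i)" "\<And>t. (\<phi> i has_real_derivative \<phi>' t) (at t)"
    using bumps_derivative[OF \<phi>] by blast
  let ?D = "\<lambda>x. \<Prod>j\<in>UNIV. (\<phi>(i := \<phi>')) j (x $ j)"
  have \<psi>_line: "(\<lambda>t. \<psi> (x + t *\<^sub>R axis i 1)) = (\<lambda>t. \<phi> i (x $ i + t) * (\<Prod>j\<in>UNIV-{i}. \<phi> j (x $ j)))" for x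
    unfolding \<psi> by (subst prod.remove[of _ i]) (auto simp: axis_def intro!: ext prod.cong)
  have D_eq: "?D x = \<phi>' (x $ i) * (\<Prod>j\<in>UNIV-{i}. \<phi> j (x $ j))" for x
    by (subst prod.remove[of _ i]) (auto intro!: prod.cong)
  have "((\<lambda>t. \<phi> i (x $ i + t)) has_real_derivative \<phi>' (x $ i)) (at 0)" for x
    using \<phi>'(2)[of "x $ i + 0"] DERIV_shift[of "\<phi> i" _ 0 "x $ i"] by (simp add: add.commute)
  then have der: "((\<lambda>t. \<psi> (x + t *\<^sub>R axis i 1)) has_real_derivative ?D x) (at 0)" for x
    unfolding \<psi>_line D_eq by (rule DERIV_cmult_right)
  have partial_\<psi>: "partial i \<psi> = ?D"
    by (rule ext) (simp only: partial_def DERIV_imp_deriv[OF der])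
  with der show "((\<lambda>t. \<psi> (x + t *\<^sub>R axis i 1)) has_real_derivative partial i \<psi> x) (at 0)"
    by simp
  show "partial i \<psi> \<in> tensor_bumps a b"
    unfolding partial_\<psi> tensor_bumps_def using \<phi> \<phi>' by (auto intro!: exI[of _ "\<phi>(i := \<phi>')"])
qed

lemma tensor_bumps_continuous:
  assumes "\<psi> \<in> tensor_bumps a b"
  shows "continuous_on S \<psi>"
proof -
  obtain \<phi> where \<phi>: "\<And>i. \<phi> i \<in> bumps (a $ i) (b $ i)" and \<psi>: "\<psi> = (\<lambda>x. \<Prod>i\<in>UNIV. \<phi> i (x $ i))"
    using assms by (auto simp: tensor_bumps_def)
  have "continuous_on UNIV (\<phi> i)" for i
    using bumps_derivative[OF \<phi>, of i] DERIV_isCont by (metis continuous_at_imp_continuous_on)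
  then have "continuous_on S (\<lambda>x. \<phi> i (x $ i))" for i
    by (rule continuous_on_compose2) (auto intro!: continuous_intros)
  then show ?thesis unfolding \<psi> by (intro continuous_on_prod)
qed

lemma tensor_bumps_eq_0:
  assumes "\<psi> \<in> tensor_bumps a b" "x \<notin> cbox a b"
  shows "\<psi> x = 0"
proof -
  obtain \<phi> where \<phi>: "\<And>i. \<phi> i \<in> bumps (a $ i) (b $ i)" and \<psi>: "\<psi> = (\<lambda>x. \<Prod>i\<in>UNIV. \<phi> i (x $ i))"
    using assms(1) by (auto simp: tensor_bumps_def)
  obtain i where "\<not> (a $ i \<le> x $ i \<and> x $ i \<le> b $ i)"
    using assms(2) by (auto simp: mem_box_cart)
  then have "\<phi> i (x $ i) = 0" by (intro bumps_eq_0[OF \<phi>[of i]]) auto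
  then show ?thesis unfolding \<psi> by (auto intro: prod_zero)
qed

lemma Dp_tensor_bumps: "\<psi> \<in> tensor_bumps a b \<Longrightarrow> Dp is \<psi> \<in> tensor_bumps a b"
  by (induction "is") (auto simp: tensor_bumps_partial)

lemma tensor_bumps_test_fn:
  assumes "\<psi> \<in> tensor_bumps a b" "cbox a b \<subseteq> \<Omega>"
  shows "test_fn \<psi> \<Omega>"
proof -
  have support: "{x. \<psi> x \<noteq> 0} \<subseteq> cbox a b"
    using tensor_bumps_eq_0[OF assms(1)] by blast
  then have "closure {x. \<psi> x \<noteq> 0} \<subseteq> cbox a b" by (intro closure_minimal) auto
  moreover have "bounded {x. \<psi> x \<noteq> 0}" by (rule bounded_subset[OF bounded_cbox support])
  moreover have "Ck_on k \<psi> UNIV" for k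
    unfolding Ck_on_def
    using Dp_tensor_bumps[OF assms(1)] tensor_bumps_continuous tensor_bumps_partial(2)
    by (auto simp: real_differentiable_def) blast+
  ultimately show ?thesis unfolding test_fn_def
    using assms(2) by auto
qed

lemma ex_positive_tensor_bump:
  obtains \<psi> where "\<psi> \<in> tensor_bumps a b" "\<And>x. x \<in> box a b \<Longrightarrow> \<psi> x > 0"
proof
  let ?\<psi> = "\<lambda>x. \<Prod>i\<in>UNIV. flat 1 (x $ i - a $ i) * flat 1 (b $ i - x $ i)"
  show "?\<psi> \<in> tensor_bumps a b"
    unfolding tensor_bumps_def
    by (auto intro!: exI[of _ "\<lambda>i t. flat 1 (t - a $ i) * flat 1 (b $ i - t)"] bumps.base)
  show "?\<psi> x > 0" if "x \<in> box a b" for x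
    using that by (auto simp: flat_def mem_box_cart intro!: prod_pos)
qed

section \<open>From the weak to the pointwise equation\<close>

lemma continuous_on_UNIV_if_supported:
  fixes k :: "'a::t2_space \<Rightarrow> 'b::real_normed_vector"
  assumes "open S" "closed K" "K \<subseteq> S" "continuous_on S k" "\<And>x. x \<notin> K \<Longrightarrow> k x = 0"
  shows "continuous_on UNIV k"
proof -
  have "continuous_on (- K) k"
    by (rule continuous_on_eq[of _ "\<lambda>_. 0"]) (use assms in auto)
  moreover have "S \<union> - K = UNIV" using assms by auto
  ultimately show ?thesis
    using continuous_on_open_Un[OF \<open>open S\<close> _ \<open>continuous_on S k\<close>] \<open>closed K\<close> by fastforce
qed

lemma integral_translate_supported:
  fixes h :: "'a::euclidean_space \<Rightarrow> real"
  assumes "continuous_on UNIV h" "\<And>x. x \<notin> cbox a b \<Longrightarrow> h x = 0" "cbox (a - e) (b - e) \<subseteq> C"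
  shows "integral C (\<lambda>x. h (x + e)) = integral (cbox a b) h"
proof -
  have "(h has_integral integral (cbox a b) h) (cbox a b)"
    using assms(1) by (intro integrable_integral integrable_continuous) (auto intro: continuous_on_subset)
  from has_integral_affinity'[OF this, of 1 e]
  have "((\<lambda>x. h (x + e)) has_integral integral (cbox a b) h) (cbox (a - e) (b - e))"
    by simp
  moreover have "h (x + e) = 0" if "x \<notin> cbox (a - e) (b - e)" for x
    using that by (intro assms(2)) (auto simp: mem_box inner_diff_left inner_add_left algebra_simps)
  ultimately have "((\<lambda>x. h (x + e)) has_integral integral (cbox a b) h) C"
    by (rule has_integral_on_superset) (use assms(3) in auto)
  then show ?thesis by (rule integral_unique)
qed

lemma cbox_translate_subset:
  fixes e :: "'a::euclidean_space"
  assumes "\<bar>t\<bar> \<le> 1"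
  shows "cbox (a - t *\<^sub>R e) (b - t *\<^sub>R e) \<subseteq> cbox (a - norm e *\<^sub>R One) (b + norm e *\<^sub>R One)"
proof -
  have "\<bar>t * (e \<bullet> i)\<bar> \<le> norm e" if "i \<in> Basis" for i
    using mult_mono[OF assms Basis_le_norm[OF that, of e]] by (simp add: abs_mult)
  then show ?thesis
    unfolding subset_box by (auto simp: inner_diff_left inner_add_left abs_le_iff)
qed

text \<open>The integral of \<open>h(x + t e)\<close> over a large box does not depend on \<open>t\<close>.\<close>
lemma integral_directional_derivative_eq_0:
  fixes h D :: "'a::euclidean_space \<Rightarrow> real"
  assumes der: "\<And>x. ((\<lambda>t. h (x + t *\<^sub>R e)) has_real_derivative D x) (at 0)"
    and h: "continuous_on UNIV h" and D: "continuous_on UNIV D"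
    and supp: "\<And>x. x \<notin> cbox a b \<Longrightarrow> h x = 0" "\<And>x. x \<notin> cbox a b \<Longrightarrow> D x = 0"
  shows "integral (cbox a b) D = 0"
proof -
  define c where "c = a - norm e *\<^sub>R One"
  define d where "d = b + norm e *\<^sub>R One"
  define I where "I t = integral (cbox c d) (\<lambda>x. h (x + t *\<^sub>R e))" for t
  have "(I has_real_derivative integral (cbox c d) (\<lambda>x. D (x + 0 *\<^sub>R e))) (at 0 within {-1..1})"
    unfolding I_def
  proof (rule leibniz_rule_field_derivative)
    show "((\<lambda>t. h (x + t *\<^sub>R e)) has_real_derivative D (x + t *\<^sub>R e)) (at t within {-1..1})" for x t
      by (rule has_field_derivative_at_within[OF has_real_derivative_line_shift[where f=h, OF der]])
    show "(\<lambda>x. h (x + t *\<^sub>R e)) integrable_on cbox c d" for t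
      by (intro integrable_continuous continuous_on_compose2[OF h]) (auto intro!: continuous_intros)
    show "continuous_on ({-1..1} \<times> cbox c d) (\<lambda>(t, x). D (x + t *\<^sub>R e))"
      unfolding split_beta by (intro continuous_on_compose2[OF D]) (auto intro!: continuous_intros)
  qed auto
  moreover have "(I has_real_derivative 0) (at 0 within {-1..1})"
  proof -
    have "I t = integral (cbox a b) h" if "\<bar>t\<bar> \<le> 1" for t
      unfolding I_def c_def d_def
      by (rule integral_translate_supported[OF h supp(1) cbox_translate_subset[OF that]])
    then have "\<forall>\<^sub>F t in nhds 0. I t = integral (cbox a b) h"
      by (auto simp: eventually_nhds_metric dist_real_def intro!: exI[of _ 1])
    then have "(I has_real_derivative 0) (at 0)"
      by (subst DERIV_cong_ev[OF refl _ refl]) auto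
    then show ?thesis by (rule has_field_derivative_at_within)
  qed
  ultimately have "integral (cbox c d) D = 0"
    using has_field_derivative_unique[of I _ 0 "{-1..1}" 0] by (auto simp: trivial_limit_within islimpt_Icc)
  moreover have "integral (cbox c d) D = integral (cbox a b) D"
    using integral_translate_supported[OF D supp(2), of a b 0 "cbox c d"] cbox_translate_subset[of 0 a e b]
    by (simp add: c_def d_def)
  ultimately show ?thesis by simp
qed

lemma integration_by_parts_directional:
  fixes V dV \<psi> d\<psi> :: "'a::euclidean_space \<Rightarrow> real"
  assumes S: "open S" "cbox a b \<subseteq> S"
    and V: "continuous_on S V" "continuous_on S dV"
    and V_der: "\<And>x. x \<in> S \<Longrightarrow> ((\<lambda>t. V (x + t *\<^sub>R e)) has_real_derivative dV x) (at 0)"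
    and \<psi>: "continuous_on UNIV \<psi>" "continuous_on UNIV d\<psi>"
    and \<psi>_der: "\<And>x. ((\<lambda>t. \<psi> (x + t *\<^sub>R e)) has_real_derivative d\<psi> x) (at 0)"
    and supp: "\<And>x. x \<notin> cbox a b \<Longrightarrow> \<psi> x = 0" "\<And>x. x \<notin> cbox a b \<Longrightarrow> d\<psi> x = 0"
  shows "integral (cbox a b) (\<lambda>x. V x * d\<psi> x) = - integral (cbox a b) (\<lambda>x. dV x * \<psi> x)"
proof -
  note \<psi>_S = continuous_on_subset[OF \<psi>(1)] continuous_on_subset[OF \<psi>(2)]
  have "integral (cbox a b) (\<lambda>x. V x * d\<psi> x + dV x * \<psi> x) = 0"
  proof (rule integral_directional_derivative_eq_0[where h="\<lambda>x. V x * \<psi> x"])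
    show "continuous_on UNIV (\<lambda>x. V x * \<psi> x)" "continuous_on UNIV (\<lambda>x. V x * d\<psi> x + dV x * \<psi> x)"
      by (rule continuous_on_UNIV_if_supported[OF S(1) closed_cbox S(2)];
          use V supp in \<open>auto intro!: continuous_intros \<psi>_S\<close>)+
    show "((\<lambda>t. V (x + t *\<^sub>R e) * \<psi> (x + t *\<^sub>R e)) has_real_derivative V x * d\<psi> x + dV x * \<psi> x) (at 0)" for x
    proof (cases "x \<in> S")
      case True
      then show ?thesis using DERIV_mult[OF V_der[OF True] \<psi>_der[of x]] by (simp add: algebra_simps)
    next
      case False
      then have x: "x \<in> - cbox a b" using S by auto
      then have "\<forall>\<^sub>F t in nhds 0. x + t *\<^sub>R e \<in> - cbox a b"
        by (intro eventually_line_in_open) auto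
      then have "\<forall>\<^sub>F t in nhds 0. V (x + t *\<^sub>R e) * \<psi> (x + t *\<^sub>R e) = 0"
        by eventually_elim (simp add: supp)
      from DERIV_cong_ev[OF refl this refl] show ?thesis
        using x supp by simp
    qed
  qed (use supp in auto)
  moreover have "integral (cbox a b) (\<lambda>x. V x * d\<psi> x + dV x * \<psi> x)
      = integral (cbox a b) (\<lambda>x. V x * d\<psi> x) + integral (cbox a b) (\<lambda>x. dV x * \<psi> x)"
    by (intro integral_add integrable_continuous continuous_intros \<psi>_S
        continuous_on_subset[OF V(1) S(2)] continuous_on_subset[OF V(2) S(2)]) auto
  ultimately show ?thesis by simp
qed

lemma du_Bois_Reymond:
  fixes h :: "real^'n \<Rightarrow> real"
  assumes S: "open S" "x0 \<in> S" and h: "continuous_on S h"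
    and int: "\<And>a b \<psi>. cbox a b \<subseteq> S \<Longrightarrow> \<psi> \<in> tensor_bumps a b \<Longrightarrow> integral (cbox a b) (\<lambda>x. h x * \<psi> x) = 0"
  shows "h x0 = 0"
proof -
  have False if "s * h x0 > 0" for s :: real
  proof -
    have "open {x\<in>S. s * h x > 0}"
      using continuous_open_preimage[OF continuous_on_mult[OF continuous_on_const h] S(1), of "{0<..}" s]
      by (simp add: vimage_def Int_def)
    moreover have "x0 \<in> {x\<in>S. s * h x > 0}" using that S by auto
    ultimately obtain a b where ab: "cbox a b \<subseteq> {x\<in>S. s * h x > 0}" "x0 \<in> box a b" "\<forall>i\<in>Basis. a \<bullet> i < b \<bullet> i"
      by (rule open_contains_cbox)
    obtain \<psi> where \<psi>: "\<psi> \<in> tensor_bumps a b" "\<And>x. x \<in> box a b \<Longrightarrow> \<psi> x > 0"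
      using ex_positive_tensor_bump[of a b] by blast
    have "integral (cbox a b) (\<lambda>x. 0) < integral (cbox a b) (\<lambda>x. s * (h x * \<psi> x))"
    proof (rule integral_less)
      show "continuous_on (cbox a b) (\<lambda>x. s * (h x * \<psi> x))"
        using ab by (intro continuous_intros tensor_bumps_continuous[OF \<psi>(1)] continuous_on_subset[OF h]) auto
      fix x assume x: "x \<in> box a b"
      then have "s * h x > 0" using ab box_subset_cbox by blast
      then show "0 < s * (h x * \<psi> x)" using \<psi>(2)[OF x] by (simp flip: mult.assoc)
    qed (use ab in auto)
    moreover have "integral (cbox a b) (\<lambda>x. s * (h x * \<psi> x)) = 0"
      using int[of a b \<psi>] ab \<psi>(1) by auto
    ultimately show False by auto
  qed
  from this[of 1] this[of "-1"] show ?thesis by (cases "h x0" "0::real" rule: linorder_cases) auto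
qed

lemma integral_supported_cbox:
  fixes h :: "'a::euclidean_space \<Rightarrow> real"
  assumes "cbox a b \<subseteq> \<Omega>" "\<And>x. x \<notin> cbox a b \<Longrightarrow> h x = 0"
  shows "integral \<Omega> h = integral (cbox a b) h"
proof -
  have "(\<lambda>x. if x \<in> cbox a b then h x else 0) = h" using assms(2) by auto
  then show ?thesis
    using integral_restrict_Int[of \<Omega> "cbox a b" h] assms(1) by (simp add: Int_absorb1 Int_absorb2)
qed

lemma integral_tensor_bump_divergence:
  fixes V :: "real^'n \<Rightarrow> real^'n" and dV :: "'n \<Rightarrow> real^'n \<Rightarrow> real"
  assumes \<psi>: "\<psi> \<in> tensor_bumps a b" and S: "open S" "cbox a b \<subseteq> S"
    and V: "\<And>i. continuous_on S (\<lambda>x. V x $ i)" "\<And>i. continuous_on S (dV i)"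
    and der: "\<And>i x. x \<in> S \<Longrightarrow> ((\<lambda>t. V (x + t *\<^sub>R axis i 1) $ i) has_real_derivative dV i x) (at 0)"
  shows "integral (cbox a b) (\<lambda>x. V x \<bullet> grad \<psi> x) = - integral (cbox a b) (\<lambda>x. (\<Sum>i\<in>UNIV. dV i x) * \<psi> x)"
proof -
  have d\<psi>: "partial i \<psi> \<in> tensor_bumps a b" for i by (rule tensor_bumps_partial(1)[OF \<psi>])
  note cont = continuous_on_subset[OF V(1) S(2)] continuous_on_subset[OF V(2) S(2)]
    tensor_bumps_continuous[OF \<psi>] tensor_bumps_continuous[OF d\<psi>]
  have "integral (cbox a b) (\<lambda>x. V x \<bullet> grad \<psi> x)
      = (\<Sum>i\<in>UNIV. integral (cbox a b) (\<lambda>x. V x $ i * partial i \<psi> x))"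
    by (simp add: inner_vec_def grad_def) (intro integral_sum integrable_continuous continuous_intros cont; simp)
  also have "\<dots> = (\<Sum>i\<in>UNIV. - integral (cbox a b) (\<lambda>x. dV i x * \<psi> x))"
    by (intro sum.cong refl integration_by_parts_directional[OF S V(1) V(2) der] tensor_bumps_continuous[OF \<psi>]
        tensor_bumps_continuous[OF d\<psi>] tensor_bumps_partial(2)[OF \<psi>] tensor_bumps_eq_0[OF \<psi>] tensor_bumps_eq_0[OF d\<psi>])
  also have "\<dots> = - integral (cbox a b) (\<lambda>x. \<Sum>i\<in>UNIV. dV i x * \<psi> x)"
    by (subst integral_sum) (auto intro!: integrable_continuous continuous_intros cont simp: sum_negf)
  finally show ?thesis by (simp add: sum_distrib_right)
qed

lemma weak_divergence_pointwise:
  fixes V :: "real^'n \<Rightarrow> real^'n" and dV :: "'n \<Rightarrow> real^'n \<Rightarrow> real" and k :: "real^'n \<Rightarrow> real"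
  assumes S: "open S" "S \<subseteq> \<Omega>" "x0 \<in> S"
    and V: "\<And>i. continuous_on S (\<lambda>x. V x $ i)" "\<And>i. continuous_on S (dV i)"
    and der: "\<And>i x. x \<in> S \<Longrightarrow> ((\<lambda>t. V (x + t *\<^sub>R axis i 1) $ i) has_real_derivative dV i x) (at 0)"
    and k: "continuous_on S k"
    and weak: "\<And>\<psi>. test_fn \<psi> \<Omega> \<Longrightarrow> integral \<Omega> (\<lambda>x. V x \<bullet> grad \<psi> x) = integral \<Omega> (\<lambda>x. k x * \<psi> x)"
  shows "(\<Sum>i\<in>UNIV. dV i x0) + k x0 = 0"
proof (rule du_Bois_Reymond[OF S(1,3)])
  show "continuous_on S (\<lambda>x. (\<Sum>i\<in>UNIV. dV i x) + k x)"
    by (intro continuous_intros V k)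
  fix a b \<psi> assume ab: "cbox a b \<subseteq> S" and \<psi>: "\<psi> \<in> tensor_bumps a b"
  have "\<psi> x = 0" "grad \<psi> x = 0" if "x \<notin> cbox a b" for x
    using that tensor_bumps_eq_0[OF \<psi>] tensor_bumps_eq_0[OF tensor_bumps_partial(1)[OF \<psi>]]
    by (auto simp: grad_def vec_eq_iff)
  moreover have ab\<Omega>: "cbox a b \<subseteq> \<Omega>" using ab S(2) by auto
  ultimately have "integral (cbox a b) (\<lambda>x. V x \<bullet> grad \<psi> x) = integral (cbox a b) (\<lambda>x. k x * \<psi> x)"
    using weak[OF tensor_bumps_test_fn[OF \<psi> ab\<Omega>]]
      integral_supported_cbox[OF ab\<Omega>, of "\<lambda>x. V x \<bullet> grad \<psi> x"] integral_supported_cbox[OF ab\<Omega>, of "\<lambda>x. k x * \<psi> x"]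
    by auto
  with integral_tensor_bump_divergence[OF \<psi> S(1) ab V der]
  have "integral (cbox a b) (\<lambda>x. (\<Sum>i\<in>UNIV. dV i x) * \<psi> x) + integral (cbox a b) (\<lambda>x. k x * \<psi> x) = 0"
    by simp
  moreover have "integral (cbox a b) (\<lambda>x. (\<Sum>i\<in>UNIV. dV i x) * \<psi> x + k x * \<psi> x)
      = integral (cbox a b) (\<lambda>x. (\<Sum>i\<in>UNIV. dV i x) * \<psi> x) + integral (cbox a b) (\<lambda>x. k x * \<psi> x)"
    by (intro integral_add integrable_continuous continuous_intros continuous_on_subset[OF V(2) ab]
        continuous_on_subset[OF k ab] tensor_bumps_continuous[OF \<psi>])
  ultimately show "integral (cbox a b) (\<lambda>x. ((\<Sum>i\<in>UNIV. dV i x) + k x) * \<psi> x) = 0"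
    by (simp add: distrib_right)
qed

lemma p_laplace_flux_has_derivative:
  fixes u :: "real^'n \<Rightarrow> real"
  assumes "Ck_on k u \<Omega>" "2 \<le> k" "open \<Omega>" "x \<in> \<Omega>" "grad u x \<noteq> 0"
  shows "((\<lambda>y. norm (grad u y) powr (p - 2) *\<^sub>R grad u y) has_derivative
    (\<lambda>h. norm (grad u x) powr (p - 2) *\<^sub>R (hess u x *v h)
      + ((p - 2) * norm (grad u x) powr (p - 4) * (grad u x \<bullet> (hess u x *v h))) *\<^sub>R grad u x)) (at x)"
proof -
  have grad: "(grad u has_derivative (\<lambda>h. hess u x *v h)) (at x)"
    by (rule Ck_on_grad_has_derivative[OF assms(1,3,2,4)])
  from has_derivative_compose[OF grad has_derivative_norm_powr[OF assms(5), of "p - 2"]]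
  have "((\<lambda>y. norm (grad u y) powr (p - 2)) has_derivative
      (\<lambda>h. (p - 2) * norm (grad u x) powr (p - 4) * (grad u x \<bullet> (hess u x *v h)))) (at x)"
    by simp
  from has_derivative_scaleR[OF this grad] show ?thesis .
qed

lemma p_laplace_pointwise:
  fixes u :: "real^'n \<Rightarrow> real"
  assumes \<Omega>: "open \<Omega>" and u: "Ck_on k u \<Omega>" "2 \<le> k" and eq: "p_laplace_eq p f u \<Omega>"
    and f: "continuous_on UNIV f" and x: "x \<in> \<Omega>" "grad u x \<noteq> 0"
  shows "norm (grad u x) powr (p - 2) * p_trace p (grad u x) ((*v) (hess u x)) + f (u x) = 0"
proof -
  have grad: "continuous_on \<Omega> (grad u)" by (rule Ck_on_grad_continuous[OF u(1)]) (use u in simp)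
  define S where "S = {y\<in>\<Omega>. grad u y \<noteq> 0}"
  have S: "open S" "S \<subseteq> \<Omega>" "x \<in> S"
    using continuous_open_preimage[OF grad \<Omega>, of "- {0}"] x by (auto simp: S_def vimage_def Int_def)
  have cont: "continuous_on S (hess u)" "continuous_on S (grad u)" "continuous_on S u"
    using grad Ck_on_hess_continuous[OF u] Ck_on_continuous[OF u(1), of "[]"] S(2) continuous_on_subset by auto
  define V where "V y = norm (grad u y) powr (p - 2) *\<^sub>R grad u y" for y
  define dV where "dV i y = norm (grad u y) powr (p - 2) * hess u y $ i $ i
     + (p - 2) * norm (grad u y) powr (p - 4) * (hess u y *v grad u y) $ i * grad u y $ i" for i y
  have "(\<Sum>i\<in>UNIV. dV i x) + f (u x) = 0"
  proof (rule weak_divergence_pointwise[where V=V and k="\<lambda>x. f (u x)", OF S])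
    show "continuous_on S (\<lambda>x. V x $ i)" for i
      unfolding V_def by (intro continuous_intros cont) (auto simp: S_def)
    show "continuous_on S (dV i)" for i
      unfolding dV_def
      by (intro continuous_intros cont bounded_bilinear.continuous_on[OF bounded_bilinear_matrix_vector_mult])
         (auto simp: S_def)
    show "continuous_on S (\<lambda>x. f (u x))"
      by (rule continuous_on_compose2[OF f cont(3)]) auto
    show "integral \<Omega> (\<lambda>x. V x \<bullet> grad \<psi> x) = integral \<Omega> (\<lambda>x. f (u x) * \<psi> x)" if "test_fn \<psi> \<Omega>" for \<psi>
      using eq that by (simp add: p_laplace_eq_def V_def)
    show "((\<lambda>t. V (y + t *\<^sub>R axis i 1) $ i) has_real_derivative dV i y) (at 0)" if "y \<in> S" for i y
    proof -
      have y: "y \<in> \<Omega>" "grad u y \<noteq> 0" using that by (auto simp: S_def)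
      have "grad u y \<bullet> (hess u y *v axis i 1) = (hess u y *v grad u y) $ i"
        using inner_matrix_vector_mult_commute[OF transpose_hess[OF u(1) \<Omega> u(2) y(1)]] by (simp add: inner_axis)
      then show ?thesis
        using has_derivative_direction[OF bounded_linear.has_derivative[OF bounded_linear_vec_nth[of i]
              p_laplace_flux_has_derivative[OF u \<Omega> y, of p]], of "axis i 1"]
        by (simp add: V_def dV_def matrix_vector_mult_basis column_def mult.assoc)
    qed
  qed
  moreover have "(\<Sum>i\<in>UNIV. dV i x) = norm (grad u x) powr (p - 2) * trace (hess u x)
      + (p - 2) * norm (grad u x) powr (p - 4) * (grad u x \<bullet> (hess u x *v grad u x))"
    by (simp add: dV_def sum.distrib trace_def inner_vec_def mult.assoc mult.commute[of "grad u x $ _"]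
        flip: sum_distrib_left)
  moreover have "norm (grad u x) powr (p - 4) = norm (grad u x) powr (p - 2) / (grad u x \<bullet> grad u x)"
    using powr_diff[of "norm (grad u x)" "p - 2" 2] x(2) by (simp add: power2_norm_eq_inner)
  ultimately show ?thesis
    by (simp add: p_trace_def op_trace_matrix distrib_left mult_ac)
qed

section \<open>Second-order differentiability at a point\<close>

definition has_gradient_hessian ::
    "('a::real_inner \<Rightarrow> real) \<Rightarrow> 'a \<Rightarrow> 'a \<Rightarrow> ('a \<Rightarrow> 'a) \<Rightarrow> bool" where
  "has_gradient_hessian \<phi> x G H \<longleftrightarrow> (\<exists>D S. open S \<and> x \<in> S \<and>
     (\<forall>y\<in>S. (\<phi> has_derivative (\<lambda>h. D y \<bullet> h)) (at y)) \<and> D x = G \<and> (D has_derivative H) (at x))"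

lemma has_gradient_hessianI:
  assumes "open S" "x \<in> S" "\<And>y. y \<in> S \<Longrightarrow> (\<phi> has_derivative (\<lambda>h. D y \<bullet> h)) (at y)"
    "(D has_derivative H) (at x)"
  shows "has_gradient_hessian \<phi> x (D x) H"
  unfolding has_gradient_hessian_def using assms by blast

lemma has_gradient_hessianE:
  assumes "has_gradient_hessian \<phi> x G H"
  obtains D S where "open S" "x \<in> S" "\<And>y. y \<in> S \<Longrightarrow> (\<phi> has_derivative (\<lambda>h. D y \<bullet> h)) (at y)"
    "D x = G" "(D has_derivative H) (at x)"
  using assms unfolding has_gradient_hessian_def by blast

lemma has_gradient_hessian_linear: "has_gradient_hessian \<phi> x G H \<Longrightarrow> linear H"
  unfolding has_gradient_hessian_def by (blast dest: has_derivative_linear)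

lemma has_gradient_hessian_has_derivative:
  "has_gradient_hessian \<phi> x G H \<Longrightarrow> (\<phi> has_derivative (\<lambda>h. G \<bullet> h)) (at x)"
  unfolding has_gradient_hessian_def by blast

lemma has_gradient_hessian_local_max:
  fixes \<phi> :: "'a::euclidean_space \<Rightarrow> real"
  assumes hess: "has_gradient_hessian \<phi> x G H" and max: "\<forall>\<^sub>F y in nhds x. \<phi> y \<le> \<phi> x"
  shows "G = 0" "v \<bullet> H v \<le> 0"
proof -
  obtain D S where S: "open S" "x \<in> S" "\<And>y. y \<in> S \<Longrightarrow> (\<phi> has_derivative (\<lambda>h. D y \<bullet> h)) (at y)"
    "D x = G" "(D has_derivative H) (at x)"
    using hess by (rule has_gradient_hessianE) blast
  have "(\<lambda>h. G \<bullet> h) = (\<lambda>h. 0)"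
    by (rule has_derivative_local_max[OF has_gradient_hessian_has_derivative[OF hess]])
       (use max in \<open>auto simp: eventually_at_filter elim: eventually_mono\<close>)
  then have "G \<bullet> G = 0" by meson
  then show G: "G = 0" by simp
  show "v \<bullet> H v \<le> 0"
  proof (rule ccontr)
    assume "\<not> v \<bullet> H v \<le> 0"
    moreover have "((\<lambda>t. D (x + t *\<^sub>R v) \<bullet> v) has_real_derivative v \<bullet> H v) (at 0)"
      using has_derivative_direction[OF has_derivative_inner_left[OF S(5)], of v v] by (simp add: inner_commute)
    ultimately obtain d where d: "d > 0" "\<And>h. 0 < h \<Longrightarrow> h < d \<Longrightarrow> D (x + h *\<^sub>R v) \<bullet> v > 0"
      using DERIV_pos_inc_right[of "\<lambda>t. D (x + t *\<^sub>R v) \<bullet> v" "v \<bullet> H v" 0] S(4) G by auto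
    have "\<forall>\<^sub>F t in nhds 0. x + t *\<^sub>R v \<in> S"
      using S(1,2) by (rule eventually_line_in_open)
    moreover have "\<forall>\<^sub>F t in nhds 0. \<phi> (x + t *\<^sub>R v) \<le> \<phi> x"
    proof (rule eventually_compose_filterlim[OF max])
      have "((\<lambda>t. x + t *\<^sub>R v) \<longlongrightarrow> x + 0 *\<^sub>R v) (nhds (0::real))"
        by (intro tendsto_intros filterlim_ident)
      then show "filterlim (\<lambda>t. x + t *\<^sub>R v) (nhds x) (nhds (0::real))" by simp
    qed
    ultimately have "\<forall>\<^sub>F t in nhds 0. x + t *\<^sub>R v \<in> S \<and> \<phi> (x + t *\<^sub>R v) \<le> \<phi> x" by eventually_elim auto
    then obtain d' where d': "d' > 0" "\<And>t. \<bar>t\<bar> < d' \<Longrightarrow> x + t *\<^sub>R v \<in> S \<and> \<phi> (x + t *\<^sub>R v) \<le> \<phi> x"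
      by (auto simp: eventually_nhds_metric)
    define s where "s = min d d' / 2"
    have s: "0 < s" "s < d" "s < d'" using d(1) d'(1) by (auto simp: s_def)
    obtain t where t: "0 < t" "t < s" "\<phi> (x + s *\<^sub>R v) - \<phi> x = s * (D (x + t *\<^sub>R v) \<bullet> v)"
    proof (rule mvt_along_line[OF s(1), of \<phi> x v "\<lambda>y. D y \<bullet> v"])
      show "((\<lambda>r. \<phi> (x + t *\<^sub>R v + r *\<^sub>R v)) has_real_derivative D (x + t *\<^sub>R v) \<bullet> v) (at 0)"
        if "0 \<le> t" "t \<le> s" for t
        by (rule has_derivative_direction[OF S(3)]) (use d'(2)[of t] that s in auto)
    qed
    moreover have "s * (D (x + t *\<^sub>R v) \<bullet> v) > 0" using d(2)[of t] t s by simp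
    ultimately show False using d'(2)[of s] s by auto
  qed
qed

lemma has_gradient_hessian_transform_open:
  assumes "has_gradient_hessian \<phi> x G H" "open S" "x \<in> S" "\<And>y. y \<in> S \<Longrightarrow> \<phi> y = \<psi> y"
  shows "has_gradient_hessian \<psi> x G H"
proof -
  obtain D T where T: "open T" "x \<in> T" "\<And>y. y \<in> T \<Longrightarrow> (\<phi> has_derivative (\<lambda>h. D y \<bullet> h)) (at y)"
    "D x = G" "(D has_derivative H) (at x)"
    using assms(1) by (rule has_gradient_hessianE) blast
  have "(\<psi> has_derivative (\<lambda>h. D y \<bullet> h)) (at y)" if "y \<in> T \<inter> S" for y
    using has_derivative_transform_within_open[OF T(3) assms(2), of y \<psi>] that assms(4) by auto
  then show ?thesis
    using has_gradient_hessianI[of "T \<inter> S" x \<psi> D H] T assms(2,3) by auto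
qed

lemma has_gradient_hessian_add:
  assumes "has_gradient_hessian \<phi> x G H" "has_gradient_hessian \<psi> x G' H'"
  shows "has_gradient_hessian (\<lambda>y. \<phi> y + \<psi> y) x (G + G') (\<lambda>h. H h + H' h)"
proof -
  obtain D S where S: "open S" "x \<in> S" "\<And>y. y \<in> S \<Longrightarrow> (\<phi> has_derivative (\<lambda>h. D y \<bullet> h)) (at y)"
    "D x = G" "(D has_derivative H) (at x)"
    using assms(1) by (rule has_gradient_hessianE) blast
  obtain D' S' where S': "open S'" "x \<in> S'" "\<And>y. y \<in> S' \<Longrightarrow> (\<psi> has_derivative (\<lambda>h. D' y \<bullet> h)) (at y)"
    "D' x = G'" "(D' has_derivative H') (at x)"
    using assms(2) by (rule has_gradient_hessianE) blast
  have "((\<lambda>y. \<phi> y + \<psi> y) has_derivative (\<lambda>h. (D y + D' y) \<bullet> h)) (at y)" if "y \<in> S \<inter> S'" for y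
    using has_derivative_add[OF S(3)[of y] S'(3)[of y]] that by (simp add: inner_add_left)
  then have "has_gradient_hessian (\<lambda>y. \<phi> y + \<psi> y) x (D x + D' x) (\<lambda>h. H h + H' h)"
    using S S' by (intro has_gradient_hessianI[of "S \<inter> S'"] has_derivative_add) auto
  then show ?thesis using S(4) S'(4) by simp
qed

lemma has_gradient_hessian_compose:
  assumes "has_gradient_hessian \<phi> x G H"
    and T: "open T" "\<phi> x \<in> T" "\<And>s. s \<in> T \<Longrightarrow> (k has_real_derivative k' s) (at s)"
    and k2: "(k' has_real_derivative k2) (at (\<phi> x))"
  shows "has_gradient_hessian (\<lambda>y. k (\<phi> y)) x (k' (\<phi> x) *\<^sub>R G) (\<lambda>h. k2 *\<^sub>R ((G \<bullet> h) *\<^sub>R G) + k' (\<phi> x) *\<^sub>R H h)"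
proof -
  obtain D S where S: "open S" "x \<in> S" "\<And>y. y \<in> S \<Longrightarrow> (\<phi> has_derivative (\<lambda>h. D y \<bullet> h)) (at y)"
    "D x = G" "(D has_derivative H) (at x)"
    using assms(1) by (rule has_gradient_hessianE) blast
  have "continuous_on S \<phi>"
    using S(3) by (intro continuous_at_imp_continuous_on) (blast intro: has_derivative_continuous)
  then have "open (S \<inter> \<phi> -` T)" using S(1) T(1) by (intro continuous_open_preimage)
  moreover have "((\<lambda>y. k (\<phi> y)) has_derivative (\<lambda>h. (k' (\<phi> y) *\<^sub>R D y) \<bullet> h)) (at y)" if "y \<in> S \<inter> \<phi> -` T" for y
    using has_derivative_compose[OF S(3)[of y], of k "\<lambda>h. k' (\<phi> y) * h"] T(3)[of "\<phi> y"] that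
    by (simp add: has_field_derivative_def)
  moreover have "((\<lambda>y. k' (\<phi> y) *\<^sub>R D y) has_derivative
      (\<lambda>h. k2 *\<^sub>R ((G \<bullet> h) *\<^sub>R G) + k' (\<phi> x) *\<^sub>R H h)) (at x)"
  proof -
    have "((\<lambda>y. k' (\<phi> y)) has_derivative (\<lambda>h. k2 * (G \<bullet> h))) (at x)"
      using has_derivative_compose[OF S(3)[OF S(2)], of k' "\<lambda>h. k2 * h"] k2 S(4)
      by (simp add: has_field_derivative_def)
    from has_derivative_scaleR[OF this S(5)] S(4) show ?thesis by (simp add: add.commute)
  qed
  ultimately have "has_gradient_hessian (\<lambda>y. k (\<phi> y)) x (k' (\<phi> x) *\<^sub>R D x)
      (\<lambda>h. k2 *\<^sub>R ((G \<bullet> h) *\<^sub>R G) + k' (\<phi> x) *\<^sub>R H h)"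
    using S T by (intro has_gradient_hessianI[of "S \<inter> \<phi> -` T"]) auto
  then show ?thesis using S(4) by simp
qed

lemma has_gradient_hessian_sqdist:
  "has_gradient_hessian (\<lambda>y. (y - a) \<bullet> (y - a)) x (2 *\<^sub>R (x - a)) (\<lambda>h. 2 *\<^sub>R h)"
  by (rule has_gradient_hessianI[of UNIV _ _ "\<lambda>y. 2 *\<^sub>R (y - a)"])
     (auto intro!: derivative_eq_intros simp: inner_diff_left inner_diff_right inner_commute algebra_simps)

section \<open>Linear elliptic operators\<close>

text \<open>The operator is \<open>L \<phi> = Q(D\<^sup>2\<phi>) + b \<bullet> \<nabla>\<phi>\<close>. Its second-order coefficients enter only through the
  functional \<open>Q x\<close>, which is \<open>H \<mapsto> tr (A(x) H)\<close> for a coefficient matrix \<open>A(x) \<ge> m\<close> of trace at most \<open>\<Lambda>\<close>.\<close>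
locale elliptic_operator =
  fixes S :: "'a::euclidean_space set" and Q :: "'a \<Rightarrow> ('a \<Rightarrow> 'a) \<Rightarrow> real" and b :: "'a \<Rightarrow> 'a"
    and m \<Lambda> :: real
  assumes Q_add: "\<And>x H K. Q x (\<lambda>h. H h + K h) = Q x H + Q x K"
    and Q_scaleR: "\<And>x r H. Q x (\<lambda>h. r *\<^sub>R H h) = r * Q x H"
    and Q_nonpos: "\<And>x H. x \<in> S \<Longrightarrow> linear H \<Longrightarrow> (\<And>v. v \<bullet> H v \<le> 0) \<Longrightarrow> Q x H \<le> 0"
    and m_pos: "m > 0"
    and Q_rank_one_ge: "\<And>x v. x \<in> S \<Longrightarrow> m * (v \<bullet> v) \<le> Q x (\<lambda>h. (v \<bullet> h) *\<^sub>R v)"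
    and Q_ident_le: "\<And>x. x \<in> S \<Longrightarrow> Q x (\<lambda>h. h) \<le> \<Lambda>"
begin

definition operator_at :: "('a \<Rightarrow> real) \<Rightarrow> 'a \<Rightarrow> 'a \<Rightarrow> real \<Rightarrow> bool" where
  "operator_at \<phi> x G l \<longleftrightarrow> (\<exists>H. has_gradient_hessian \<phi> x G H \<and> l = Q x H + b x \<bullet> G)"

definition subsolution_at :: "('a \<Rightarrow> real) \<Rightarrow> 'a \<Rightarrow> bool" where
  "subsolution_at v x \<longleftrightarrow> (\<exists>G l. operator_at v x G l \<and> l \<ge> 0)"

lemma operator_atI: "has_gradient_hessian \<phi> x G H \<Longrightarrow> operator_at \<phi> x G (Q x H + b x \<bullet> G)"
  unfolding operator_at_def by blast

lemma operator_at_add: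
  assumes "operator_at \<phi> x G l" "operator_at \<psi> x G' l'"
  shows "operator_at (\<lambda>y. \<phi> y + \<psi> y) x (G + G') (l + l')"
proof -
  obtain H H' where "has_gradient_hessian \<phi> x G H" "l = Q x H + b x \<bullet> G"
    "has_gradient_hessian \<psi> x G' H'" "l' = Q x H' + b x \<bullet> G'"
    using assms unfolding operator_at_def by blast
  then show ?thesis
    unfolding operator_at_def
    by (intro exI[of _ "\<lambda>h. H h + H' h"]) (simp add: has_gradient_hessian_add Q_add inner_add_right)
qed

lemma operator_at_compose:
  assumes "operator_at \<phi> x G l"
    and T: "open T" "\<phi> x \<in> T" "\<And>s. s \<in> T \<Longrightarrow> (k has_real_derivative k' s) (at s)"
    and k2: "(k' has_real_derivative k2) (at (\<phi> x))"
  shows "operator_at (\<lambda>y. k (\<phi> y)) x (k' (\<phi> x) *\<^sub>R G) (k2 * Q x (\<lambda>h. (G \<bullet> h) *\<^sub>R G) + k' (\<phi> x) * l)"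
proof -
  obtain H where H: "has_gradient_hessian \<phi> x G H" "l = Q x H + b x \<bullet> G"
    using assms(1) unfolding operator_at_def by blast
  from operator_atI[OF has_gradient_hessian_compose[OF H(1) T k2]] show ?thesis
    unfolding Q_add Q_scaleR by (simp add: H(2) distrib_left add.assoc)
qed

lemma operator_at_cmult:
  assumes "operator_at \<phi> x G l"
  shows "operator_at (\<lambda>y. c * \<phi> y) x (c *\<^sub>R G) (c * l)"
  using operator_at_compose[OF assms, of UNIV "\<lambda>s. c * s" "\<lambda>s. c" 0]
  by (auto intro!: derivative_eq_intros)

lemma operator_at_sqdist:
  "operator_at (\<lambda>y. (y - a) \<bullet> (y - a)) x (2 *\<^sub>R (x - a)) (2 * Q x (\<lambda>h. h) + 2 * (b x \<bullet> (x - a)))"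
  using operator_atI[OF has_gradient_hessian_sqdist, of a x] by (simp add: Q_scaleR)

lemma operator_at_has_derivative: "operator_at \<phi> x G l \<Longrightarrow> (\<phi> has_derivative (\<lambda>h. G \<bullet> h)) (at x)"
  unfolding operator_at_def using has_gradient_hessian_has_derivative by blast

lemma operator_at_local_max:
  assumes "operator_at \<phi> x G l" "\<forall>\<^sub>F y in nhds x. \<phi> y \<le> \<phi> x" "x \<in> S"
  shows "G = 0" "l \<le> 0"
proof -
  obtain H where H: "has_gradient_hessian \<phi> x G H" "l = Q x H + b x \<bullet> G"
    using assms(1) unfolding operator_at_def by blast
  note max = has_gradient_hessian_local_max[OF H(1) assms(2)]
  show "G = 0" by (rule max(1))
  then show "l \<le> 0"
    using Q_nonpos[OF assms(3) has_gradient_hessian_linear[OF H(1)] max(2)] H(2) by simp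
qed

lemma Q_rank_one_le:
  assumes "x \<in> S"
  shows "Q x (\<lambda>h. (v \<bullet> h) *\<^sub>R v) \<le> \<Lambda> * (v \<bullet> v)"
proof -
  let ?H = "\<lambda>h. (v \<bullet> h) *\<^sub>R v + (- (v \<bullet> v)) *\<^sub>R h"
  have "linear ?H" by (rule linearI) (simp_all add: inner_add_right algebra_simps)
  moreover have "h \<bullet> ?H h \<le> 0" for h
    using Cauchy_Schwarz_ineq[of h v]
    by (simp add: inner_add_right inner_diff_right power2_eq_square inner_commute[of h v] mult.commute)
  ultimately have "Q x ?H \<le> 0" by (rule Q_nonpos[OF assms])
  then have "Q x (\<lambda>h. (v \<bullet> h) *\<^sub>R v) \<le> (v \<bullet> v) * Q x (\<lambda>h. h)"
    unfolding Q_add Q_scaleR by simp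
  also have "\<dots> \<le> (v \<bullet> v) * \<Lambda>" by (intro mult_left_mono Q_ident_le[OF assms]) auto
  finally show ?thesis by (simp add: mult.commute)
qed

lemma m_le_Lambda: "x \<in> S \<Longrightarrow> m \<le> \<Lambda>"
  using Q_rank_one_ge[of x "SOME i. i \<in> Basis"] Q_rank_one_le[of x "SOME i. i \<in> Basis"]
  by (simp add: SOME_Basis)

lemma operator_exp_ge:
  assumes "x \<in> S" "operator_at u x g l" "c > 0" "K \<ge> 0" "l \<ge> - M"
  shows "\<exists>l'\<ge>c * exp (K * u x) * K * (K * m * (g \<bullet> g) - M).
    operator_at (\<lambda>y. c * exp (K * u y)) x ((c * exp (K * u x) * K) *\<^sub>R g) l'"
proof -
  define t where "t = c * exp (K * u x)"
  have t: "t > 0" using assms(3) by (simp add: t_def)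
  have "operator_at (\<lambda>y. c * exp (K * u y)) x ((t * K) *\<^sub>R g) (t * K\<^sup>2 * Q x (\<lambda>h. (g \<bullet> h) *\<^sub>R g) + t * K * l)"
    unfolding t_def
    by (rule operator_at_compose[OF assms(2), where T=UNIV and k="\<lambda>s. c * exp (K * s)" and k'="\<lambda>s. c * exp (K * s) * K"])
       (auto intro!: derivative_eq_intros simp: power2_eq_square)
  moreover have "t * K\<^sup>2 * Q x (\<lambda>h. (g \<bullet> h) *\<^sub>R g) + t * K * l \<ge> t * K\<^sup>2 * (m * (g \<bullet> g)) + t * K * (- M)"
    using t assms(4,5) Q_rank_one_ge[OF assms(1), of g] by (intro add_mono mult_left_mono) auto
  ultimately show ?thesis
    by (intro exI conjI[rotated]) (auto simp: t_def power2_eq_square algebra_simps)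
qed

lemma operator_gaussian_pos:
  assumes x: "x \<in> S" "norm (b x) \<le> N"
    and d: "d > 0" "d / 2 \<le> norm (x - y)" "norm (x - y) \<le> 3 * d / 2"
    and \<alpha>: "\<alpha> > 0" "\<alpha> * m * d\<^sup>2 > 2 * \<Lambda> + 3 * N * d"
  shows "\<exists>G l. operator_at (\<lambda>z. exp (- \<alpha> * ((z - y) \<bullet> (z - y)))) x G l \<and> l > 0"
proof -
  define z where "z = x - y"
  define E where "E = exp (- \<alpha> * (z \<bullet> z))"
  have "operator_at (\<lambda>z. exp (- \<alpha> * ((z - y) \<bullet> (z - y)))) x ((- \<alpha> * E) *\<^sub>R 2 *\<^sub>R z)
      (\<alpha>\<^sup>2 * E * Q x (\<lambda>h. (2 *\<^sub>R z \<bullet> h) *\<^sub>R 2 *\<^sub>R z) + - \<alpha> * E * (2 * Q x (\<lambda>h. h) + 2 * (b x \<bullet> z)))"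
    unfolding E_def z_def
    by (rule operator_at_compose[OF operator_at_sqdist, where T=UNIV and k="\<lambda>s. exp (- \<alpha> * s)"
          and k'="\<lambda>s. - \<alpha> * exp (- \<alpha> * s)"])
       (auto intro!: derivative_eq_intros simp: power2_eq_square)
  moreover have "\<alpha> * E * (\<alpha> * Q x (\<lambda>h. (2 *\<^sub>R z \<bullet> h) *\<^sub>R 2 *\<^sub>R z) - 2 * Q x (\<lambda>h. h) - 2 * (b x \<bullet> z)) > 0"
  proof -
    have "d\<^sup>2 \<le> (2 * norm z)\<^sup>2" using d by (intro power_mono) (auto simp: z_def)
    also have "\<dots> = 2 *\<^sub>R z \<bullet> 2 *\<^sub>R z" by (simp add: power_mult_distrib power2_norm_eq_inner)
    finally have "m * d\<^sup>2 \<le> m * (2 *\<^sub>R z \<bullet> 2 *\<^sub>R z)" using m_pos by (intro mult_left_mono) auto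
    also have "\<dots> \<le> Q x (\<lambda>h. (2 *\<^sub>R z \<bullet> h) *\<^sub>R 2 *\<^sub>R z)" by (rule Q_rank_one_ge[OF x(1)])
    finally have "\<alpha> * m * d\<^sup>2 \<le> \<alpha> * Q x (\<lambda>h. (2 *\<^sub>R z \<bullet> h) *\<^sub>R 2 *\<^sub>R z)" using \<alpha>(1) by simp
    moreover have "b x \<bullet> z \<le> N * (3 * d / 2)"
      using norm_cauchy_schwarz[of "b x" z] mult_mono[OF x(2) d(3)] order_trans[OF norm_ge_zero x(2)]
      by (simp add: z_def)
    ultimately have "\<alpha> * Q x (\<lambda>h. (2 *\<^sub>R z \<bullet> h) *\<^sub>R 2 *\<^sub>R z) - 2 * Q x (\<lambda>h. h) - 2 * (b x \<bullet> z) > 0"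
      using \<alpha>(2) Q_ident_le[OF x(1)] by linarith
    then show ?thesis using \<alpha>(1) by (simp add: E_def)
  qed
  then have "0 < \<alpha>\<^sup>2 * E * Q x (\<lambda>h. (2 *\<^sub>R z \<bullet> h) *\<^sub>R 2 *\<^sub>R z) + - \<alpha> * E * (2 * Q x (\<lambda>h. h) + 2 * (b x \<bullet> z))"
    by (simp add: power2_eq_square algebra_simps)
  ultimately show ?thesis by blast
qed

end

section \<open>Hopf's maximum principles\<close>

lemma compact_less_uniformly:
  fixes v :: "'a::topological_space \<Rightarrow> real"
  assumes "compact E" "continuous_on E v" "\<And>x. x \<in> E \<Longrightarrow> v x < c"
  obtains \<sigma> where "\<sigma> > 0" "\<And>x. x \<in> E \<Longrightarrow> v x \<le> c - \<sigma>"
proof (cases "E = {}")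
  case True
  then show thesis using that[of 1] by auto
next
  case False
  then obtain x where "x \<in> E" "\<And>y. y \<in> E \<Longrightarrow> v y \<le> v x"
    using continuous_attains_sup[OF assms(1) _ assms(2)] by blast
  then show thesis using that[of "c - v x"] assms(3) by auto
qed

lemma sum_squares_le_if_near_midpoint:
  fixes x p z :: "'a::real_inner"
  assumes "norm (x - midpoint p z) \<le> dist p z / 2"
  shows "(norm (x - p))\<^sup>2 + (norm (x - z))\<^sup>2 \<le> (dist p z)\<^sup>2"
proof -
  have "(norm (x - p))\<^sup>2 + (norm (x - z))\<^sup>2 = 2 * (norm (x - midpoint p z))\<^sup>2 + (dist p z)\<^sup>2 / 2"
    by (simp add: midpoint_def dist_norm power2_norm_eq_inner inner_diff_left inner_diff_right
        inner_add_left inner_add_right inner_commute field_simps)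
  moreover have "(norm (x - midpoint p z))\<^sup>2 \<le> (dist p z / 2)\<^sup>2" using assms by (intro power_mono) auto
  ultimately show ?thesis by (simp add: power_divide)
qed

lemma interior_touching_ball:
  fixes C :: "'a::euclidean_space set"
  assumes "open S" "closedin (top_of_set S) C" "\<not> open C"
  obtains y z d where "d > 0" "z \<in> C" "norm (z - y) = d" "cball z (d / 2) \<subseteq> S"
    "\<And>x. x \<in> C \<Longrightarrow> norm (x - y) \<le> d \<Longrightarrow> x = z"
proof -
  obtain z0 where z0: "z0 \<in> C" and no_ball: "\<And>e. e > 0 \<Longrightarrow> \<not> ball z0 e \<subseteq> C"
    using assms(3) unfolding open_contains_ball by blast
  obtain T where T: "closed T" "C = S \<inter> T" using assms(2) by (auto simp: closedin_closed)
  obtain r0 where r0: "r0 > 0" "cball z0 r0 \<subseteq> S"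
    using \<open>open S\<close> z0 T open_contains_cball by blast
  define r where "r = r0 / 3"
  have "r > 0" using r0 by (simp add: r_def)
  then obtain p where p: "dist z0 p < r" "p \<notin> C" using no_ball[of r] by (meson mem_ball subsetI)
  have "closed (T \<inter> cball z0 r0)" using T by auto
  moreover have "z0 \<in> T \<inter> cball z0 r0" using z0 T r0 by auto
  ultimately obtain z where z: "z \<in> T \<inter> cball z0 r0" "\<And>x. x \<in> T \<inter> cball z0 r0 \<Longrightarrow> dist p z \<le> dist p x"
    using distance_attains_inf[of "T \<inter> cball z0 r0" p] by blast
  have "z \<in> C" using z(1) T r0 by auto
  define e where "e = dist p z"
  have e: "e > 0" "e < r"
    using \<open>z \<in> C\<close> p z(2)[OF \<open>z0 \<in> T \<inter> cball z0 r0\<close>] by (auto simp: e_def dist_commute)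
  define y where "y = midpoint p z"
  have y: "norm (z - y) = e / 2"
    by (simp add: y_def e_def dist_midpoint dist_commute flip: dist_norm)
  have unique: "x = z" if x: "x \<in> C" "norm (x - y) \<le> e / 2" for x
  proof -
    have sum_le: "(norm (x - p))\<^sup>2 + (norm (x - z))\<^sup>2 \<le> e\<^sup>2"
      using sum_squares_le_if_near_midpoint[of x p z] x(2) by (simp add: y_def e_def)
    then have "(norm (x - p))\<^sup>2 \<le> e\<^sup>2" by (smt (verit) zero_le_power2)
    then have "dist x p \<le> e" unfolding dist_norm by (rule power2_le_imp_le) (use e in simp)
    then have "dist z0 x \<le> r0" using dist_triangle[of z0 x p] p e by (simp add: r_def dist_commute)
    then have "e \<le> norm (x - p)" using z(2)[of x] x(1) T by (simp add: e_def dist_norm norm_minus_commute)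
    then have "e\<^sup>2 \<le> (norm (x - p))\<^sup>2" using e by (intro power_mono) auto
    then have "(norm (x - z))\<^sup>2 \<le> 0" using sum_le by linarith
    then show ?thesis by simp
  qed
  have "cball z (e / 2 / 2) \<subseteq> S"
  proof
    fix x assume "x \<in> cball z (e / 2 / 2)"
    then have "dist z0 x \<le> r0"
      using dist_triangle[of z0 x z] dist_triangle[of z0 z p] p e r0(1) by (simp add: e_def r_def dist_commute)
    then show "x \<in> S" using r0 by auto
  qed
  moreover have "e / 2 > 0" using e by simp
  ultimately show thesis using that[OF _ \<open>z \<in> C\<close> y] unique by blast
qed

lemma gaussian_perturbation_less_on_sphere:
  fixes v :: "'a::real_inner \<Rightarrow> real"
  assumes "norm (z - y) = d" "\<alpha> > 0" "\<epsilon> > 0" "v z = c" "v x \<le> c"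
    and "norm (x - y) \<le> d \<Longrightarrow> v x \<le> c - \<epsilon>"
  shows "v x + \<epsilon> * exp (- \<alpha> * ((x - y) \<bullet> (x - y))) < v z + \<epsilon> * exp (- \<alpha> * ((z - y) \<bullet> (z - y)))"
proof (cases "norm (x - y) \<le> d")
  case True
  have "exp (- \<alpha> * ((x - y) \<bullet> (x - y))) \<le> 1" using assms(2) by simp
  then have "\<epsilon> * exp (- \<alpha> * ((x - y) \<bullet> (x - y))) \<le> \<epsilon>" using assms(3) by simp
  moreover have "\<epsilon> * exp (- \<alpha> * ((z - y) \<bullet> (z - y))) > 0" using assms(3) by simp
  ultimately show ?thesis using assms(4) assms(6)[OF True] by linarith
next
  case False
  then have "(norm (z - y))\<^sup>2 < (norm (x - y))\<^sup>2"
    using assms(1) norm_ge_zero[of "z - y"] by (intro power_strict_mono) auto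
  then have "exp (- \<alpha> * ((x - y) \<bullet> (x - y))) < exp (- \<alpha> * ((z - y) \<bullet> (z - y)))"
    using assms(2) by (simp add: power2_norm_eq_inner)
  then show ?thesis using assms(3-5) by (smt (verit) mult_strict_left_mono)
qed

lemma ex_gaussian_perturbation_local_max:
  fixes v :: "'a::euclidean_space \<Rightarrow> real"
  assumes v: "continuous_on (cball z (d / 2)) v" "\<And>x. x \<in> cball z (d / 2) \<Longrightarrow> v x \<le> v z"
    and d: "d > 0" "norm (z - y) = d" and "\<alpha> > 0"
    and unique: "\<And>x. x \<in> cball z (d / 2) \<Longrightarrow> v x = v z \<Longrightarrow> norm (x - y) \<le> d \<Longrightarrow> x = z"
  obtains \<epsilon> x where "\<epsilon> > 0" "x \<in> ball z (d / 2)"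
    "\<forall>\<^sub>F x' in nhds x. v x' + \<epsilon> * exp (- \<alpha> * ((x' - y) \<bullet> (x' - y))) \<le> v x + \<epsilon> * exp (- \<alpha> * ((x - y) \<bullet> (x - y)))"
proof -
  have "v x < v z" if "x \<in> sphere z (d / 2) \<inter> cball y d" for x
    using that v(2)[of x] unique[of x] d(1) by (fastforce simp: dist_norm norm_minus_commute)
  moreover have "compact (sphere z (d / 2) \<inter> cball y d)" by (simp add: compact_Int_closed)
  moreover have "continuous_on (sphere z (d / 2) \<inter> cball y d) v"
    by (rule continuous_on_subset[OF v(1)]) auto
  ultimately obtain \<epsilon> where \<epsilon>: "\<epsilon> > 0" "\<And>x. x \<in> sphere z (d / 2) \<inter> cball y d \<Longrightarrow> v x \<le> v z - \<epsilon>"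
    using compact_less_uniformly by metis
  define \<phi> where "\<phi> x = v x + \<epsilon> * exp (- \<alpha> * ((x - y) \<bullet> (x - y)))" for x
  have "continuous_on (cball z (d / 2)) \<phi>" unfolding \<phi>_def by (intro continuous_intros v)
  then obtain x where x: "x \<in> cball z (d / 2)" "\<And>x'. x' \<in> cball z (d / 2) \<Longrightarrow> \<phi> x' \<le> \<phi> x"
    using continuous_attains_sup[of "cball z (d / 2)" \<phi>] d by auto
  have "x \<notin> sphere z (d / 2)"
  proof
    assume "x \<in> sphere z (d / 2)"
    then have "\<phi> x < \<phi> z" unfolding \<phi>_def using \<epsilon>(2)[of x] v(2)[OF x(1)]
      by (intro gaussian_perturbation_less_on_sphere[where v=v, OF d(2) \<open>\<alpha> > 0\<close> \<epsilon>(1) refl])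
         (auto simp: dist_norm norm_minus_commute)
    then show False using x(2)[of z] d by simp
  qed
  then have ball: "x \<in> ball z (d / 2)" using x(1) by auto
  then have "\<forall>\<^sub>F x' in nhds x. x' \<in> ball z (d / 2)" by (intro eventually_nhds_in_open) auto
  then have "\<forall>\<^sub>F x' in nhds x. \<phi> x' \<le> \<phi> x" by eventually_elim (use x(2) in auto)
  then show thesis using that \<epsilon>(1) ball unfolding \<phi>_def by blast
qed

context elliptic_operator
begin

theorem open_contact_set:
  assumes S: "open S" and b: "continuous_on S b"
    and sub: "\<And>x. x \<in> S \<Longrightarrow> subsolution_at v x" and v_le: "\<And>x. x \<in> S \<Longrightarrow> v x \<le> c"
  shows "open {x\<in>S. v x = c}"
proof (rule ccontr)
  assume not_open: "\<not> open {x\<in>S. v x = c}"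
  have v: "continuous_on S v"
    using sub unfolding subsolution_at_def
    by (intro continuous_at_imp_continuous_on) (blast dest: operator_at_has_derivative has_derivative_continuous)
  obtain y z d where d: "d > 0" and z: "z \<in> S" "v z = c" "norm (z - y) = d" and ball: "cball z (d / 2) \<subseteq> S"
    and unique: "\<And>x. x \<in> S \<Longrightarrow> v x = c \<Longrightarrow> norm (x - y) \<le> d \<Longrightarrow> x = z"
    by (rule interior_touching_ball[OF S continuous_closedin_preimage_constant[OF v] not_open]) blast
  note v_ball = continuous_on_subset[OF v ball]
  obtain N where N: "N \<ge> 0" "\<And>x. x \<in> cball z (d / 2) \<Longrightarrow> norm (b x) \<le> N"
    using continuous_on_compact_bound[OF compact_cball continuous_on_subset[OF b ball]] by blast
  define \<alpha> where "\<alpha> = (2 * \<Lambda> + 3 * N * d) / (m * d\<^sup>2) + 1"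
  have \<alpha>: "\<alpha> > 0" "\<alpha> * m * d\<^sup>2 > 2 * \<Lambda> + 3 * N * d"
  proof -
    have "0 \<le> 2 * \<Lambda> + 3 * N * d" using m_le_Lambda[OF z(1)] m_pos N d by simp
    then show "\<alpha> > 0" unfolding \<alpha>_def using m_pos by (intro add_nonneg_pos) auto
    have "\<alpha> * m * d\<^sup>2 = 2 * \<Lambda> + 3 * N * d + m * d\<^sup>2" using m_pos d by (simp add: \<alpha>_def field_simps)
    then show "\<alpha> * m * d\<^sup>2 > 2 * \<Lambda> + 3 * N * d" using m_pos d by simp
  qed
  obtain \<epsilon> x where \<epsilon>: "\<epsilon> > 0" and x: "x \<in> ball z (d / 2)"
    and max: "\<forall>\<^sub>F x' in nhds x. v x' + \<epsilon> * exp (- \<alpha> * ((x' - y) \<bullet> (x' - y))) \<le> v x + \<epsilon> * exp (- \<alpha> * ((x - y) \<bullet> (x - y)))"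
  proof (rule ex_gaussian_perturbation_local_max[OF v_ball _ d z(3) \<alpha>(1)])
    show "v x \<le> v z" if "x \<in> cball z (d / 2)" for x using v_le[of x] z(2) ball that by auto
    show "x = z" if "x \<in> cball z (d / 2)" "v x = v z" "norm (x - y) \<le> d" for x
      using unique[of x] z(2) ball that by auto
  qed blast
  have x_cball: "x \<in> cball z (d / 2)" using x by auto
  then have "x \<in> S" using ball by auto
  have annulus: "d / 2 \<le> norm (x - y)" "norm (x - y) \<le> 3 * d / 2"
    using norm_triangle_ineq4[of "x - y" "x - z"] norm_triangle_ineq[of "x - z" "z - y"] z(3) x
    by (auto simp: dist_norm norm_minus_commute)
  obtain G l where l: "operator_at v x G l" "l \<ge> 0"
    using sub[OF \<open>x \<in> S\<close>] unfolding subsolution_at_def by blast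
  obtain G' l' where l': "operator_at (\<lambda>z. exp (- \<alpha> * ((z - y) \<bullet> (z - y)))) x G' l'" "l' > 0"
    using operator_gaussian_pos[OF \<open>x \<in> S\<close> N(2)[OF x_cball] d annulus \<alpha>] by blast
  have "l + \<epsilon> * l' \<le> 0"
    using operator_at_local_max(2)[OF operator_at_add[OF l(1) operator_at_cmult[OF l'(1), of \<epsilon>]] max \<open>x \<in> S\<close>] .
  then show False using l(2) mult_pos_pos[OF \<epsilon> l'(2)] by linarith
qed

lemma hopf_barrier_strict:
  assumes "x \<in> S" "operator_at u x g l" "l \<ge> - M" "\<mu> \<le> g \<bullet> g" "u x \<ge> 0"
    and "norm (b x) \<le> N" "norm (x - q) \<le> \<rho>"
    and K: "K \<ge> 1" "K * m * \<mu> - M \<ge> 1" and \<beta>: "\<beta> \<ge> 0" "\<beta> * (2 * \<Lambda> + 2 * N * \<rho>) < 1" and "\<epsilon> > 0"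
  shows "\<exists>G l. operator_at (\<lambda>y. \<epsilon> * (exp (K * u y) - 1 - \<beta> * ((y - q) \<bullet> (y - q)))) x G l \<and> l > 0"
proof -
  obtain l' where l': "operator_at (\<lambda>y. exp (K * u y)) x ((exp (K * u x) * K) *\<^sub>R g) l'"
    "l' \<ge> exp (K * u x) * K * (K * m * (g \<bullet> g) - M)"
    using operator_exp_ge[OF assms(1,2), of 1 K M] K(1) assms(3) by auto
  define l2 where "l2 = 2 * Q x (\<lambda>h. h) + 2 * (b x \<bullet> (x - q))"
  define G where "G = (exp (K * u x) * K) *\<^sub>R g + - \<beta> *\<^sub>R 2 *\<^sub>R (x - q)"
  have "operator_at (\<lambda>y. exp (K * u y) + - \<beta> * ((y - q) \<bullet> (y - q))) x G (l' + - \<beta> * l2)"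
    unfolding l2_def G_def by (intro operator_at_add l'(1) operator_at_cmult operator_at_sqdist)
  then have "operator_at (\<lambda>y. \<epsilon> * (exp (K * u y) + - \<beta> * ((y - q) \<bullet> (y - q)) - 1)) x (\<epsilon> *\<^sub>R G)
      (0 * Q x (\<lambda>h. (G \<bullet> h) *\<^sub>R G) + \<epsilon> * (l' + - \<beta> * l2))"
    by (rule operator_at_compose[where T=UNIV and k="\<lambda>s. \<epsilon> * (s - 1)" and k'="\<lambda>_. \<epsilon>"])
       (auto intro!: derivative_eq_intros)
  moreover have barrier_eq: "exp (K * u y) + - \<beta> * ((y - q) \<bullet> (y - q)) - 1
      = exp (K * u y) - 1 - \<beta> * ((y - q) \<bullet> (y - q))" for y
    by simp
  ultimately have "operator_at (\<lambda>y. \<epsilon> * (exp (K * u y) - 1 - \<beta> * ((y - q) \<bullet> (y - q)))) x (\<epsilon> *\<^sub>R G) (\<epsilon> * (l' - \<beta> * l2))"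
    unfolding barrier_eq by simp
  moreover have "l' \<ge> 1"
  proof -
    have "K * m * \<mu> \<le> K * m * (g \<bullet> g)" using K(1) m_pos assms(4) by (intro mult_left_mono) auto
    then have "K * m * (g \<bullet> g) - M \<ge> 1" using K(2) by linarith
    then have "1 * 1 * 1 \<le> exp (K * u x) * K * (K * m * (g \<bullet> g) - M)"
      using K(1) assms(5) by (intro mult_mono) auto
    then show ?thesis using l'(2) by simp
  qed
  moreover have "\<beta> * l2 \<le> \<beta> * (2 * \<Lambda> + 2 * N * \<rho>)"
  proof (rule mult_left_mono[OF _ \<beta>(1)])
    have "b x \<bullet> (x - q) \<le> N * \<rho>"
      using norm_cauchy_schwarz[of "b x" "x - q"] mult_mono[OF assms(6,7)] order_trans[OF norm_ge_zero assms(6)]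
      by simp
    then show "l2 \<le> 2 * \<Lambda> + 2 * N * \<rho>" using Q_ident_le[OF assms(1)] by (simp add: l2_def)
  qed
  ultimately show ?thesis using \<beta>(2) \<open>\<epsilon> > 0\<close> by (meson diff_gt_0_iff_gt le_less_trans less_le_trans mult_pos_pos)
qed

lemma hopf_barrier_no_local_max:
  assumes "x \<in> S" "operator_at u x g l" "l \<ge> - M" "\<mu> \<le> g \<bullet> g" "u x \<ge> 0"
    and "norm (b x) \<le> N" "norm (x - q) \<le> \<rho>"
    and "K \<ge> 1" "K * m * \<mu> - M \<ge> 1" and "\<beta> \<ge> 0" "\<beta> * (2 * \<Lambda> + 2 * N * \<rho>) < 1" and "\<epsilon> > 0"
    and sub: "subsolution_at v x"
  shows "\<not> (\<forall>\<^sub>F y in nhds x. v y + \<epsilon> * (exp (K * u y) - 1 - \<beta> * ((y - q) \<bullet> (y - q)))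
    \<le> v x + \<epsilon> * (exp (K * u x) - 1 - \<beta> * ((x - q) \<bullet> (x - q))))"
proof
  assume max: "\<forall>\<^sub>F y in nhds x. v y + \<epsilon> * (exp (K * u y) - 1 - \<beta> * ((y - q) \<bullet> (y - q)))
    \<le> v x + \<epsilon> * (exp (K * u x) - 1 - \<beta> * ((x - q) \<bullet> (x - q)))"
  obtain G l where l: "operator_at v x G l" "l \<ge> 0" using sub unfolding subsolution_at_def by blast
  obtain G' l' where l': "operator_at (\<lambda>y. \<epsilon> * (exp (K * u y) - 1 - \<beta> * ((y - q) \<bullet> (y - q)))) x G' l'" "l' > 0"
    using hopf_barrier_strict[OF assms(1-12)] by blast
  have "l + l' \<le> 0" by (rule operator_at_local_max(2)[OF operator_at_add[OF l(1) l'(1)] max assms(1)])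
  then show False using l(2) l'(2) by linarith
qed

lemma ex_hopf_parameters:
  fixes M N \<rho> :: real
  assumes "\<mu> > 0"
  obtains K \<beta> where "K \<ge> 1" "K * m * \<mu> - M \<ge> 1" "\<beta> > 0" "\<beta> * (2 * \<Lambda> + 2 * N * \<rho>) < 1"
proof
  define K where "K = (\<bar>M\<bar> + 1) / (m * \<mu>) + 1"
  define \<beta> where "\<beta> = 1 / (\<bar>2 * \<Lambda> + 2 * N * \<rho>\<bar> + 1)"
  show "K \<ge> 1" using m_pos assms by (simp add: K_def)
  have "K * m * \<mu> = \<bar>M\<bar> + 1 + m * \<mu>" using m_pos assms by (simp add: K_def field_simps)
  moreover have "m * \<mu> > 0" using m_pos assms by simp
  ultimately show "K * m * \<mu> - M \<ge> 1" using abs_ge_self[of M] by linarith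
  show "\<beta> > 0" "\<beta> * (2 * \<Lambda> + 2 * N * \<rho>) < 1"
    by (auto simp: \<beta>_def divide_less_eq add_nonneg_pos intro: le_less_trans[OF abs_ge_self])
qed

end

lemma ex_barrier_scale_on_sphere:
  fixes u v :: "'a::euclidean_space \<Rightarrow> real"
  assumes "compact D" "continuous_on D u" "continuous_on D v" "K > 0" "\<beta> > 0" "\<rho> > 0"
    and v_le: "\<And>x. x \<in> D \<Longrightarrow> v x \<le> c" and v_less: "\<And>x. x \<in> D \<Longrightarrow> u x > 0 \<Longrightarrow> v x < c"
  obtains \<epsilon> where "\<epsilon> > 0"
    "\<And>x. x \<in> D \<Longrightarrow> norm (x - q) = \<rho> \<Longrightarrow> v x + \<epsilon> * (exp (K * u x) - 1 - \<beta> * ((x - q) \<bullet> (x - q))) \<le> c"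
proof -
  define h where "h x = exp (K * u x) - 1 - \<beta> * ((x - q) \<bullet> (x - q))" for x
  have h: "continuous_on D h" unfolding h_def by (intro continuous_intros assms)
  define E where "E = (D \<inter> h -` {0..}) \<inter> sphere q \<rho>"
  have "closed (D \<inter> h -` {0..})"
    by (intro continuous_closed_preimage h compact_imp_closed assms(1) closed_atLeast)
  then have "compact (D \<inter> ((D \<inter> h -` {0..}) \<inter> sphere q \<rho>))"
    by (intro compact_Int_closed[OF assms(1)] closed_Int[OF _ closed_sphere])
  moreover have "D \<inter> ((D \<inter> h -` {0..}) \<inter> sphere q \<rho>) = E" by (auto simp: E_def)
  ultimately have E: "compact E" "E \<subseteq> D" by (auto simp: E_def)
  have "v x < c" if "x \<in> E" for x
  proof (rule v_less)
    have "h x = exp (K * u x) - 1 - \<beta> * \<rho>\<^sup>2"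
      using that by (auto simp: E_def h_def dist_norm norm_minus_commute simp flip: power2_norm_eq_inner)
    moreover have "\<beta> * \<rho>\<^sup>2 > 0" using assms by simp
    moreover have "h x \<ge> 0" using that by (simp add: E_def)
    ultimately have "exp (K * u x) > 1" by linarith
    then show "u x > 0" using \<open>K > 0\<close> by (simp add: zero_less_mult_iff)
  qed (use that E in auto)
  then obtain \<sigma> where \<sigma>: "\<sigma> > 0" "\<And>x. x \<in> E \<Longrightarrow> v x \<le> c - \<sigma>"
    using compact_less_uniformly[OF E(1) continuous_on_subset[OF assms(3) E(2)]] by blast
  obtain B where B: "B \<ge> 0" "\<And>x. x \<in> E \<Longrightarrow> norm (h x) \<le> B"
    using continuous_on_compact_bound[OF E(1) continuous_on_subset[OF h E(2)]] by blast
  show thesis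
  proof (rule that[of "\<sigma> / (B + 1)"])
    fix x assume x: "x \<in> D" "norm (x - q) = \<rho>"
    have "\<sigma> / (B + 1) * h x \<le> c - v x"
    proof (cases "x \<in> E")
      case True
      then have "\<sigma> / (B + 1) * h x \<le> \<sigma> / (B + 1) * (B + 1)"
        using B(2)[OF True] B(1) \<sigma>(1) by (intro mult_left_mono) auto
      then show ?thesis using B(1) \<sigma>(2)[OF True] by simp
    next
      case False
      then have "h x < 0" using x by (auto simp: E_def dist_norm norm_minus_commute)
      then have "\<sigma> / (B + 1) * h x \<le> 0" using B(1) \<sigma>(1) by (intro mult_nonneg_nonpos) auto
      then show ?thesis using v_le[OF x(1)] by linarith
    qed
    then show "v x + \<sigma> / (B + 1) * (exp (K * u x) - 1 - \<beta> * ((x - q) \<bullet> (x - q))) \<le> c"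
      by (simp add: h_def)
  qed (use \<sigma> B in auto)
qed

context elliptic_operator
begin

text \<open>The positive function \<open>u\<close> with non-vanishing gradient takes the place of the distance to the boundary in
  Hopf's lemma, so no interior ball at \<open>q\<close> is needed.\<close>
lemma hopf_barrier:
  fixes q :: 'a
  assumes \<Omega>: "open \<Omega>" and \<rho>: "\<rho> > 0" and in_S: "\<And>x. x \<in> \<Omega> \<Longrightarrow> norm (x - q) \<le> \<rho> \<Longrightarrow> x \<in> S"
    and cont: "continuous_on (closure \<Omega>) u" "continuous_on (closure \<Omega>) v"
    and u: "\<And>x. x \<in> \<Omega> \<Longrightarrow> u x > 0" "\<And>x. x \<in> frontier \<Omega> \<Longrightarrow> u x = 0"
    and v: "\<And>x. x \<in> \<Omega> \<Longrightarrow> v x < c" "\<And>x. x \<in> frontier \<Omega> \<Longrightarrow> v x \<le> c"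
    and sub: "\<And>x. x \<in> \<Omega> \<Longrightarrow> norm (x - q) \<le> \<rho> \<Longrightarrow> subsolution_at v x"
    and Lu: "\<And>x. x \<in> \<Omega> \<Longrightarrow> norm (x - q) \<le> \<rho> \<Longrightarrow> \<exists>l\<ge>- M. operator_at u x (g x) l"
    and \<mu>: "\<mu> > 0" "\<And>x. x \<in> \<Omega> \<Longrightarrow> norm (x - q) \<le> \<rho> \<Longrightarrow> \<mu> \<le> g x \<bullet> g x"
    and b: "\<And>x. x \<in> \<Omega> \<Longrightarrow> norm (x - q) \<le> \<rho> \<Longrightarrow> norm (b x) \<le> N"
  obtains \<epsilon> K \<beta> where "\<epsilon> > 0" "K > 0" "\<beta> > 0"
    "\<And>x. x \<in> \<Omega> \<Longrightarrow> norm (x - q) \<le> \<rho> \<Longrightarrow> v x + \<epsilon> * (exp (K * u x) - 1 - \<beta> * ((x - q) \<bullet> (x - q))) \<le> c"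
proof -
  obtain K \<beta> where K: "K \<ge> 1" "K * m * \<mu> - M \<ge> 1" and \<beta>: "\<beta> > 0" "\<beta> * (2 * \<Lambda> + 2 * N * \<rho>) < 1"
    using ex_hopf_parameters[OF \<mu>(1)] by blast
  define D where "D = closure \<Omega> \<inter> cball q \<rho>"
  have D: "compact D" "x \<in> D \<longleftrightarrow> (x \<in> \<Omega> \<or> x \<in> frontier \<Omega>) \<and> norm (x - q) \<le> \<rho>" for x
    using \<Omega> closure_subset[of \<Omega>]
    by (auto simp: D_def frontier_def interior_open dist_norm norm_minus_commute closed_Int_compact)
  have cont_D: "continuous_on D u" "continuous_on D v"
    using cont by (auto simp: D_def intro: continuous_on_subset)
  have v_le: "v x \<le> c" if "x \<in> D" for x using that v by (auto simp: D(2) less_imp_le)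
  have v_less: "v x < c" if "x \<in> D" "u x > 0" for x using that v(1) u(2) by (force simp: D(2))
  have "K > 0" using K(1) by simp
  then obtain \<epsilon> where \<epsilon>: "\<epsilon> > 0"
    "\<And>x. x \<in> D \<Longrightarrow> norm (x - q) = \<rho> \<Longrightarrow> v x + \<epsilon> * (exp (K * u x) - 1 - \<beta> * ((x - q) \<bullet> (x - q))) \<le> c"
    using ex_barrier_scale_on_sphere[OF D(1) cont_D _ \<beta>(1) \<rho> v_le v_less] by metis
  define \<phi> where "\<phi> x = v x + \<epsilon> * (exp (K * u x) - 1 - \<beta> * ((x - q) \<bullet> (x - q)))" for x
  have "\<phi> x \<le> c" if "x \<in> D" for x
  proof -
    have "continuous_on D \<phi>" unfolding \<phi>_def by (intro continuous_intros cont_D)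
    moreover have "D \<noteq> {}" using that by auto
    ultimately obtain y where y: "y \<in> D" "\<And>z. z \<in> D \<Longrightarrow> \<phi> z \<le> \<phi> y"
      using continuous_attains_sup[OF D(1)] by metis
    have "\<phi> y \<le> c"
    proof (rule ccontr)
      assume "\<not> \<phi> y \<le> c"
      then have large: "\<phi> y > c" by simp
      have "y \<notin> frontier \<Omega>"
      proof
        assume "y \<in> frontier \<Omega>"
        then have "\<epsilon> * (exp (K * u y) - 1 - \<beta> * ((y - q) \<bullet> (y - q))) \<le> 0"
          using \<epsilon>(1) \<beta>(1) u(2) by (simp add: mult_nonneg_nonpos)
        then show False using large v_le[OF y(1)] by (simp add: \<phi>_def)
      qed
      then have y\<Omega>: "y \<in> \<Omega>" "norm (y - q) \<le> \<rho>" using y(1) D(2) by auto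
      moreover have "norm (y - q) \<noteq> \<rho>" using large \<epsilon>(2)[OF y(1)] by (auto simp: \<phi>_def)
      ultimately have "\<forall>\<^sub>F z in nhds y. z \<in> \<Omega> \<inter> ball q \<rho>"
        using \<Omega> by (intro eventually_nhds_in_open) (auto simp: dist_norm norm_minus_commute)
      then have max: "\<forall>\<^sub>F z in nhds y. \<phi> z \<le> \<phi> y"
        by eventually_elim (auto intro!: y(2) simp: D(2) dist_norm norm_minus_commute)
      obtain l where l: "operator_at u y (g y) l" "l \<ge> - M" using Lu[OF y\<Omega>] by blast
      show False
        using hopf_barrier_no_local_max[OF in_S[OF y\<Omega>] l \<mu>(2)[OF y\<Omega>] _ b[OF y\<Omega>] y\<Omega>(2) K _ \<beta>(2) \<epsilon>(1) sub[OF y\<Omega>]]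
          u(1)[OF y\<Omega>(1)] \<beta>(1) max by (simp add: \<phi>_def)
    qed
    then show "\<phi> x \<le> c" using y(2)[OF that] by simp
  qed
  then show thesis
    using that[OF \<epsilon>(1) \<open>K > 0\<close> \<beta>(1)] by (auto simp: \<phi>_def D(2))
qed

section \<open>A cutoff estimate at maximum points\<close>

lemma operator_ln_ge:
  assumes "x \<in> S" "operator_at v x G l" "l \<ge> 0" "v x > 0"
  shows "\<exists>l'\<ge>- \<Lambda> * (norm ((1 / v x) *\<^sub>R G))\<^sup>2. operator_at (\<lambda>y. ln (v y)) x ((1 / v x) *\<^sub>R G) l'"
proof (intro exI conjI)
  show "operator_at (\<lambda>y. ln (v y)) x ((1 / v x) *\<^sub>R G)
      (- (1 / (v x)\<^sup>2) * Q x (\<lambda>h. (G \<bullet> h) *\<^sub>R G) + 1 / v x * l)"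
    by (rule operator_at_compose[OF assms(2), where T="{0<..}" and k'="\<lambda>s. 1 / s"])
       (use assms(4) in \<open>auto intro!: derivative_eq_intros simp: power2_eq_square field_simps\<close>)
  have "1 / (v x)\<^sup>2 * Q x (\<lambda>h. (G \<bullet> h) *\<^sub>R G) \<le> 1 / (v x)\<^sup>2 * (\<Lambda> * (G \<bullet> G))"
    by (intro mult_left_mono Q_rank_one_le[OF assms(1)]) auto
  also have "\<dots> = \<Lambda> * (norm ((1 / v x) *\<^sub>R G))\<^sup>2"
    by (simp add: power_divide power2_norm_eq_inner[of G])
  finally show "- \<Lambda> * (norm ((1 / v x) *\<^sub>R G))\<^sup>2 \<le> - (1 / (v x)\<^sup>2) * Q x (\<lambda>h. (G \<bullet> h) *\<^sub>R G) + 1 / v x * l"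
    using assms(3,4) by (smt (verit) mult_minus_left mult_nonneg_nonneg zero_le_divide_1_iff)
qed

lemma operator_at_log_cutoff:
  assumes "norm (x - a) < R"
  defines "D \<equiv> R\<^sup>2 - (norm (x - a))\<^sup>2"
  shows "operator_at (\<lambda>y. r * ln (1 - (y - a) \<bullet> (y - a) / R\<^sup>2)) x ((- (r / D)) *\<^sub>R 2 *\<^sub>R (x - a))
      (- (r / D\<^sup>2) * Q x (\<lambda>h. (2 *\<^sub>R (x - a) \<bullet> h) *\<^sub>R 2 *\<^sub>R (x - a)) + - (r / D) * (2 * Q x (\<lambda>h. h) + 2 * (b x \<bullet> (x - a))))"
proof -
  let ?z = "x - a"
  have "0 < R" using assms(1) norm_ge_zero[of ?z] by linarith
  have "(norm ?z)\<^sup>2 < R\<^sup>2" using assms(1) by (intro power_strict_mono) auto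
  then have D: "R\<^sup>2 - ?z \<bullet> ?z > 0" by (simp add: power2_norm_eq_inner)
  show ?thesis
    unfolding D_def power2_norm_eq_inner
  proof (rule operator_at_compose[OF operator_at_sqdist, where T="{..<R\<^sup>2}" and k="\<lambda>s. r * ln (1 - s / R\<^sup>2)"
        and k'="\<lambda>s. - (r / (R\<^sup>2 - s))"])
    show "((\<lambda>s. r * ln (1 - s / R\<^sup>2)) has_real_derivative - (r / (R\<^sup>2 - s))) (at s)" if "s \<in> {..<R\<^sup>2}" for s
      using that \<open>0 < R\<close> by (auto intro!: derivative_eq_intros simp: field_simps)
    show "((\<lambda>s. - (r / (R\<^sup>2 - s))) has_real_derivative - (r / (R\<^sup>2 - ?z \<bullet> ?z)\<^sup>2)) (at (?z \<bullet> ?z))"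
      using D by (auto intro!: derivative_eq_intros simp: power2_eq_square field_simps)
  qed (use D in auto)
qed

lemma operator_log_cutoff_ge:
  assumes x: "x \<in> S" "norm (x - a) < R" and r: "r \<ge> 0" and b: "norm (b x) \<le> B"
  defines "D \<equiv> R\<^sup>2 - (norm (x - a))\<^sup>2"
  shows "\<exists>G l. operator_at (\<lambda>y. r * ln (1 - (y - a) \<bullet> (y - a) / R\<^sup>2)) x G l \<and>
    norm G \<le> 2 * r * (R / D) \<and> l \<ge> - 6 * r * \<Lambda> * (R / D)\<^sup>2 - 2 * r * B * (R / D)"
proof (intro exI conjI)
  let ?z = "x - a"
  have "0 < R" using x(2) norm_ge_zero[of ?z] by linarith
  have "(norm ?z)\<^sup>2 < R\<^sup>2" using x(2) by (intro power_strict_mono) auto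
  then have D: "D > 0" "D \<le> R\<^sup>2" by (auto simp: D_def)
  have "\<Lambda> \<ge> 0" using m_le_Lambda[OF x(1)] m_pos by simp
  show "operator_at (\<lambda>y. r * ln (1 - (y - a) \<bullet> (y - a) / R\<^sup>2)) x ((- (r / D)) *\<^sub>R 2 *\<^sub>R ?z)
      (- (r / D\<^sup>2) * Q x (\<lambda>h. (2 *\<^sub>R ?z \<bullet> h) *\<^sub>R 2 *\<^sub>R ?z) + - (r / D) * (2 * Q x (\<lambda>h. h) + 2 * (b x \<bullet> ?z)))"
    unfolding D_def by (rule operator_at_log_cutoff[OF x(2)])
  show "norm ((- (r / D)) *\<^sub>R 2 *\<^sub>R ?z) \<le> 2 * r * (R / D)"
    using x(2) r D mult_left_mono[of "norm ?z" R "2 * r / D"] by (simp add: mult_ac)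
  have "Q x (\<lambda>h. (2 *\<^sub>R ?z \<bullet> h) *\<^sub>R 2 *\<^sub>R ?z) \<le> \<Lambda> * (2 * R)\<^sup>2"
  proof -
    have "2 *\<^sub>R ?z \<bullet> 2 *\<^sub>R ?z \<le> (2 * R)\<^sup>2"
      using \<open>(norm ?z)\<^sup>2 < R\<^sup>2\<close> by (simp add: power2_norm_eq_inner power_mult_distrib)
    then show ?thesis
      using Q_rank_one_le[OF x(1), of "2 *\<^sub>R ?z"] \<open>\<Lambda> \<ge> 0\<close> by (meson mult_left_mono order_trans)
  qed
  then have "r / D\<^sup>2 * Q x (\<lambda>h. (2 *\<^sub>R ?z \<bullet> h) *\<^sub>R 2 *\<^sub>R ?z) \<le> r / D\<^sup>2 * (\<Lambda> * (2 * R)\<^sup>2)"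
    using r by (intro mult_left_mono) auto
  also have "\<dots> = 4 * (r * \<Lambda> * (R / D)\<^sup>2)" by (simp add: power_divide power_mult_distrib)
  finally have second: "r / D\<^sup>2 * Q x (\<lambda>h. (2 *\<^sub>R ?z \<bullet> h) *\<^sub>R 2 *\<^sub>R ?z) \<le> 4 * (r * \<Lambda> * (R / D)\<^sup>2)" .
  have "1 / D \<le> (R / D)\<^sup>2" using D by (simp add: power2_eq_square field_simps)
  then have "r * \<Lambda> * (1 / D) \<le> r * \<Lambda> * (R / D)\<^sup>2" using r \<open>\<Lambda> \<ge> 0\<close> by (intro mult_left_mono) auto
  moreover have "r / D * Q x (\<lambda>h. h) \<le> r / D * \<Lambda>"
    using r D Q_ident_le[OF x(1)] by (intro mult_left_mono) auto
  ultimately have ident: "r / D * Q x (\<lambda>h. h) \<le> r * \<Lambda> * (R / D)\<^sup>2" by simp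
  have "b x \<bullet> ?z \<le> B * R"
    using norm_cauchy_schwarz[of "b x" ?z] mult_mono[OF b less_imp_le[OF x(2)]] order_trans[OF norm_ge_zero b]
    by simp
  then have "r / D * (b x \<bullet> ?z) \<le> r / D * (B * R)" using r D by (intro mult_left_mono) auto
  then have drift: "r / D * (b x \<bullet> ?z) \<le> r * B * (R / D)" by simp
  have "- (r / D\<^sup>2) * Q x (\<lambda>h. (2 *\<^sub>R ?z \<bullet> h) *\<^sub>R 2 *\<^sub>R ?z) + - (r / D) * (2 * Q x (\<lambda>h. h) + 2 * (b x \<bullet> ?z))
      = - (r / D\<^sup>2 * Q x (\<lambda>h. (2 *\<^sub>R ?z \<bullet> h) *\<^sub>R 2 *\<^sub>R ?z)) - 2 * (r / D * Q x (\<lambda>h. h)) - 2 * (r / D * (b x \<bullet> ?z))"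
    by (simp add: algebra_simps)
  also have "\<dots> \<ge> - (4 * (r * \<Lambda> * (R / D)\<^sup>2)) - 2 * (r * \<Lambda> * (R / D)\<^sup>2) - 2 * (r * B * (R / D))"
    by (intro diff_mono mult_left_mono le_imp_neg_le second ident drift) auto
  finally show "- 6 * r * \<Lambda> * (R / D)\<^sup>2 - 2 * r * B * (R / D)
      \<le> - (r / D\<^sup>2) * Q x (\<lambda>h. (2 *\<^sub>R ?z \<bullet> h) *\<^sub>R 2 *\<^sub>R ?z) + - (r / D) * (2 * Q x (\<lambda>h. h) + 2 * (b x \<bullet> ?z))"
    by (simp add: mult.assoc mult.left_commute[of r])
qed

lemma operator_exp_ge_half:
  assumes "x \<in> S" "operator_at u x g l" "l \<ge> - M * (norm g)\<^sup>2" and K: "K \<ge> 1" "K * m \<ge> 2 * M" and "\<eta> > 0"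
  defines "t \<equiv> \<eta> * exp (K * u x)"
  shows "\<exists>l'\<ge>m / 2 * (t * K\<^sup>2 * (norm g)\<^sup>2). operator_at (\<lambda>y. \<eta> * exp (K * u y)) x ((t * K) *\<^sub>R g) l'"
proof -
  obtain l' where l': "operator_at (\<lambda>y. \<eta> * exp (K * u y)) x ((t * K) *\<^sub>R g) l'"
    "l' \<ge> t * K * (K * m * (norm g)\<^sup>2 - M * (norm g)\<^sup>2)"
    using operator_exp_ge[OF assms(1,2) \<open>\<eta> > 0\<close>, of K "M * (norm g)\<^sup>2"] K(1) assms(3)
    unfolding t_def power2_norm_eq_inner by auto
  have "K * m / 2 * (norm g)\<^sup>2 \<le> K * m * (norm g)\<^sup>2 - M * (norm g)\<^sup>2"
    using mult_right_mono[OF K(2), of "(norm g)\<^sup>2"] by simp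
  then have "t * K * (K * m / 2 * (norm g)\<^sup>2) \<le> t * K * (K * m * (norm g)\<^sup>2 - M * (norm g)\<^sup>2)"
    using \<open>\<eta> > 0\<close> K by (intro mult_left_mono) (auto simp: t_def)
  moreover have "t * K * (K * m / 2 * (norm g)\<^sup>2) = m / 2 * (t * K\<^sup>2 * (norm g)\<^sup>2)" by (simp add: power2_eq_square)
  ultimately have "m / 2 * (t * K\<^sup>2 * (norm g)\<^sup>2) \<le> l'" using l'(2) by linarith
  then show ?thesis using l'(1) by blast
qed

text \<open>The summand \<open>\<eta> exp (K u)\<close> makes the differential inequality for \<open>ln v\<close> strict.\<close>
lemma cutoff_max_estimate:
  assumes x: "x \<in> S" and v: "operator_at v x Gv lv" "lv \<ge> 0" "v x > 0"
    and R: "norm (x - a) < R" and r: "r \<ge> 0"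
    and u: "operator_at u x g lu" "lu \<ge> - M * (norm g)\<^sup>2" "u x \<ge> 0" and b: "norm (b x) \<le> N * norm g"
    and K: "K \<ge> 1" "K * m \<ge> 2 * M" and \<eta>: "\<eta> > 0" "\<eta> * exp (K * u x) \<le> m / (8 * \<Lambda>)"
    and max: "\<forall>\<^sub>F y in nhds x. ln (v y) + (\<eta> * exp (K * u y) + r * ln (1 - (y - a) \<bullet> (y - a) / R\<^sup>2))
       \<le> ln (v x) + (\<eta> * exp (K * u x) + r * ln (1 - (x - a) \<bullet> (x - a) / R\<^sup>2))"
  defines "D \<equiv> R\<^sup>2 - (norm (x - a))\<^sup>2"
  shows "m / 4 * \<eta> * (norm g)\<^sup>2 \<le> (8 * \<Lambda> * r\<^sup>2 + 6 * r * \<Lambda>) * (R / D)\<^sup>2 + 2 * r * N * (norm g * (R / D))"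
proof -
  have "\<Lambda> > 0" using m_le_Lambda[OF x] m_pos by simp
  define t where "t = \<eta> * exp (K * u x)"
  have t: "t \<ge> \<eta>" "2 * \<Lambda> * t \<le> m / 4" "t > 0"
    using \<eta> K(1) u(3) \<open>\<Lambda> > 0\<close> by (auto simp: t_def field_simps)
  define q where "q = (1 / v x) *\<^sub>R Gv"
  obtain l1 where l1: "operator_at (\<lambda>y. ln (v y)) x q l1" "l1 \<ge> - \<Lambda> * (norm q)\<^sup>2"
    using operator_ln_ge[OF x v] unfolding q_def by blast
  define X where "X = t * K\<^sup>2 * (norm g)\<^sup>2"
  obtain l2 where l2: "operator_at (\<lambda>y. \<eta> * exp (K * u y)) x ((t * K) *\<^sub>R g) l2" "l2 \<ge> m / 2 * X"
    using operator_exp_ge_half[OF x u(1,2) K \<eta>(1)] unfolding t_def X_def by blast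
  obtain G3 l3 where l3: "operator_at (\<lambda>y. r * ln (1 - (y - a) \<bullet> (y - a) / R\<^sup>2)) x G3 l3"
    "norm G3 \<le> 2 * r * (R / D)" "l3 \<ge> - 6 * r * \<Lambda> * (R / D)\<^sup>2 - 2 * r * (N * norm g) * (R / D)"
    using operator_log_cutoff_ge[OF x R r b] unfolding D_def by blast
  note at_max = operator_at_local_max[OF operator_at_add[OF l1(1) operator_at_add[OF l2(1) l3(1)]] max x]
  have "\<Lambda> * (norm q)\<^sup>2 \<le> m / 4 * X + 8 * \<Lambda> * r\<^sup>2 * (R / D)\<^sup>2"
  proof -
    have "q = - ((t * K) *\<^sub>R g + G3)" by (rule eq_neg_iff_add_eq_0[THEN iffD2, OF at_max(1)])
    then have "norm q \<le> t * K * norm g + 2 * r * (R / D)"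
      using norm_triangle_ineq[of "(t * K) *\<^sub>R g" G3] l3(2) t K by (simp only: norm_minus_cancel) simp
    then have "(norm q)\<^sup>2 \<le> (t * K * norm g + 2 * r * (R / D))\<^sup>2" by (intro power_mono) auto
    also have "\<dots> \<le> 2 * (t * K * norm g)\<^sup>2 + 2 * (2 * r * (R / D))\<^sup>2"
      using zero_le_power2[of "t * K * norm g - 2 * r * (R / D)"] by (simp add: power2_sum power2_diff)
    also have "\<dots> = 2 * t * X + 8 * r\<^sup>2 * (R / D)\<^sup>2"
      by (simp add: X_def power2_eq_square)
    finally have "\<Lambda> * (norm q)\<^sup>2 \<le> \<Lambda> * (2 * t * X + 8 * r\<^sup>2 * (R / D)\<^sup>2)"
      using \<open>\<Lambda> > 0\<close> by (intro mult_left_mono) auto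
    also have "\<dots> = 2 * \<Lambda> * t * X + 8 * \<Lambda> * r\<^sup>2 * (R / D)\<^sup>2" by (simp add: algebra_simps)
    also have "2 * \<Lambda> * t * X \<le> m / 4 * X"
      using t by (intro mult_right_mono) (auto simp: X_def)
    finally show ?thesis by simp
  qed
  moreover have "m / 4 * \<eta> * (norm g)\<^sup>2 \<le> m / 4 * X"
  proof -
    have "\<eta> * 1 \<le> t * K\<^sup>2" using t \<eta>(1) K(1) by (intro mult_mono) (auto simp: one_le_power)
    then have "\<eta> * (norm g)\<^sup>2 \<le> X" unfolding X_def by (intro mult_right_mono) auto
    then show ?thesis using m_pos by simp
  qed
  moreover have "(8 * \<Lambda> * r\<^sup>2 + 6 * r * \<Lambda>) * (R / D)\<^sup>2 = 8 * \<Lambda> * r\<^sup>2 * (R / D)\<^sup>2 + 6 * r * \<Lambda> * (R / D)\<^sup>2"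
    by (simp add: distrib_right)
  ultimately show ?thesis
    using at_max(2) l1(2) l2(2) l3(3) by (simp add: mult.assoc)
qed

end

section \<open>The P-function\<close>

text \<open>Here \<open>W = \<bar>\<nabla>u\<bar>\<^sup>2\<close>, \<open>w = \<bar>\<nabla>u\<bar>\<^sup>p\<close>, \<open>\<tau> = \<Delta>u\<close>, \<open>\<sigma> = D\<^sup>2u(\<nabla>u, \<nabla>u)\<close>, \<open>S = \<bar>D\<^sup>2u \<nabla>u\<bar>\<^sup>2\<close>, \<open>N = \<bar>D\<^sup>2u\<bar>\<^sup>2\<close>, \<open>\<tau>3 = \<nabla>u \<bullet> \<nabla>(\<Delta>u)\<close>
  and \<open>\<theta> = D\<^sup>3u(\<nabla>u, \<nabla>u, \<nabla>u)\<close>; the premises are the equation and its derivative in the direction \<open>\<nabla>u\<close>.\<close>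
lemma P_function_identity:
  fixes p w W \<sigma> \<tau> \<tau>3 \<theta> S N f f' :: real
  assumes "W > 0" "w > 0"
    and equation: "w / W * (\<tau> + (p - 2) * \<sigma> / W) + f = 0"
    and differentiated: "w / W * \<tau>3 + (p - 2) * (w / W\<^sup>2) * \<sigma> * \<tau>
      + (p - 2) * ((p - 4) * (w / W ^ 3) * \<sigma>\<^sup>2 + w / W\<^sup>2 * (\<theta> + 2 * S)) + f' * W = 0"
  shows "(p - 1) * (p - 2) * (w / W\<^sup>2) * (S + (p - 2) * \<sigma>\<^sup>2 / W)
      + (p - 1) * (w / W) * (\<tau>3 + (p - 2) * \<theta> / W + (N + (p - 2) * S / W))
      + f' * ((p - 1) * W) + f * (\<tau> + (p - 2) * \<sigma> / W) + p * f / w * ((p - 1) * (w / W) * \<sigma> + f * W)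
    = (p - 1) * (w / W) * (2 * (S / W - \<sigma>\<^sup>2 / W\<^sup>2) + (N - 2 * S / W + \<sigma>\<^sup>2 / W\<^sup>2) + (\<tau> - \<sigma> / W)\<^sup>2)"
proof -
  define q v where "q = 1 / W" and "v = 1 / w"
  have inverses: "q * W = 1" "v * w = 1" using assms(1,2) by (auto simp: q_def v_def)
  have "w * q * (\<tau> + (p - 2) * \<sigma> * q) + f = 0"
    using equation by (simp add: q_def)
  moreover have "w * q * \<tau>3 + (p - 2) * (w * q * q) * \<sigma> * \<tau>
      + (p - 2) * ((p - 4) * (w * q * q * q) * \<sigma> * \<sigma> + w * q * q * (\<theta> + 2 * S)) + f' * W = 0"
    using differentiated by (simp add: q_def power2_eq_square power3_eq_cube mult.assoc)
  ultimately have "(p - 1) * (p - 2) * (w * q * q) * (S + (p - 2) * \<sigma> * \<sigma> * q)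
      + (p - 1) * (w * q) * (\<tau>3 + (p - 2) * \<theta> * q + (N + (p - 2) * S * q))
      + f' * ((p - 1) * W) + f * (\<tau> + (p - 2) * \<sigma> * q) + p * f * v * ((p - 1) * (w * q) * \<sigma> + f * W)
    = (p - 1) * (w * q) * (2 * (S * q - \<sigma> * \<sigma> * q * q) + (N - 2 * S * q + \<sigma> * \<sigma> * q * q) + (\<tau> - \<sigma> * q) * (\<tau> - \<sigma> * q))"
    using inverses by algebra
  then show ?thesis
    by (simp add: q_def v_def power2_eq_square mult.assoc)
qed

locale p_laplace_solution =
  fixes \<Omega> :: "(real^'n) set" and u :: "real^'n \<Rightarrow> real" and f F :: "real \<Rightarrow> real" and p :: real
  assumes open_domain: "open \<Omega>" and p_gt_1: "1 < p" and u_C3: "Ck_on 3 u \<Omega>"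
    and f_differentiable: "\<And>s. f differentiable (at s)"
    and F_derivative: "\<And>s. (F has_real_derivative f s) (at s)"
    and F_nonpos: "\<And>s. F s \<le> 0"
    and p_laplace: "p_laplace_eq p f u \<Omega>"
begin

definition "regular_set = {x\<in>\<Omega>. grad u x \<noteq> 0}"

definition "hess_grad x = hess u x *v grad u x"

definition "P_function x = (p - 1) / p * norm (grad u x) powr p + F (u x)"

definition "P_grad x = ((p - 1) * norm (grad u x) powr (p - 2)) *\<^sub>R hess_grad x + f (u x) *\<^sub>R grad u x"

definition "P_hess x h = ((p - 1) * (p - 2) * norm (grad u x) powr (p - 4)) *\<^sub>R ((hess_grad x \<bullet> h) *\<^sub>R hess_grad x)
   + ((p - 1) * norm (grad u x) powr (p - 2)) *\<^sub>R (third_deriv u x h *v grad u x + hess u x *v (hess u x *v h))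
   + deriv f (u x) *\<^sub>R ((grad u x \<bullet> h) *\<^sub>R grad u x) + f (u x) *\<^sub>R (hess u x *v h)"

definition "drift x = (p * f (u x) / norm (grad u x) powr p) *\<^sub>R grad u x"

lemma f_derivative: "(f has_real_derivative deriv f s) (at s)"
  using f_differentiable[of s] by (metis DERIV_imp_deriv real_differentiable_def)

lemma f_continuous: "continuous_on UNIV f"
  using f_derivative DERIV_isCont by (metis continuous_at_imp_continuous_on)

lemma u_has_derivative: "x \<in> \<Omega> \<Longrightarrow> (u has_derivative (\<lambda>h. grad u x \<bullet> h)) (at x)"
  using Ck_on_has_derivative_grad[OF u_C3 open_domain] by simp

lemma grad_has_derivative: "x \<in> \<Omega> \<Longrightarrow> (grad u has_derivative (\<lambda>h. hess u x *v h)) (at x)"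
  using Ck_on_grad_has_derivative[OF u_C3 open_domain] by simp

lemma hess_has_derivative: "x \<in> \<Omega> \<Longrightarrow> (hess u has_derivative (\<lambda>h. third_deriv u x h)) (at x)"
  using Ck_on_hess_has_derivative[OF u_C3 open_domain] by simp

lemma u_continuous: "continuous_on \<Omega> u"
  using Ck_on_continuous[OF u_C3, of "[]"] by simp

lemma grad_continuous: "continuous_on \<Omega> (grad u)"
  using Ck_on_grad_continuous[OF u_C3] by simp

lemma transpose_hess_u: "x \<in> \<Omega> \<Longrightarrow> transpose (hess u x) = hess u x"
  using transpose_hess[OF u_C3 open_domain] by simp

lemma inner_hess_commute: "x \<in> \<Omega> \<Longrightarrow> v \<bullet> (hess u x *v z) = (hess u x *v v) \<bullet> z"
  by (rule inner_matrix_vector_mult_commute[OF transpose_hess_u])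

lemma open_regular_set: "open regular_set"
  using continuous_open_preimage[OF grad_continuous open_domain, of "- {0}"]
  by (auto simp: regular_set_def vimage_def Int_def)

lemma grad_powr_minus:
  assumes "grad u x \<noteq> 0"
  defines "W \<equiv> grad u x \<bullet> grad u x" and "w \<equiv> norm (grad u x) powr p"
  shows "norm (grad u x) powr (p - 2) = w / W" "norm (grad u x) powr (p - 4) = w / W\<^sup>2"
    "norm (grad u x) powr (p - 6) = w / W ^ 3"
proof -
  have W: "norm (grad u x) powr 2 = W"
    using assms(1) by (simp add: W_def power2_norm_eq_inner)
  show "norm (grad u x) powr (p - 2) = w / W"
    by (simp add: powr_diff W w_def)
  then show "norm (grad u x) powr (p - 4) = w / W\<^sup>2"
    using powr_diff[of "norm (grad u x)" "p - 2" 2] by (simp add: W power2_eq_square)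
  then show "norm (grad u x) powr (p - 6) = w / W ^ 3"
    using powr_diff[of "norm (grad u x)" "p - 4" 2] by (simp add: W power2_eq_square power3_eq_cube)
qed

lemma grad_norm_powr_has_derivative:
  assumes "x \<in> \<Omega>" "grad u x \<noteq> 0"
  shows "((\<lambda>y. norm (grad u y) powr r) has_derivative
    (\<lambda>h. r * norm (grad u x) powr (r - 2) * (hess_grad x \<bullet> h))) (at x)"
  using has_derivative_compose[OF grad_has_derivative[OF assms(1)] has_derivative_norm_powr[OF assms(2), of r]]
  by (simp add: hess_grad_def inner_hess_commute[OF assms(1)])

lemma hess_grad_has_derivative:
  assumes "x \<in> \<Omega>"
  shows "(hess_grad has_derivative (\<lambda>h. third_deriv u x h *v grad u x + hess u x *v (hess u x *v h))) (at x)"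
  unfolding hess_grad_def
  using bounded_bilinear.FDERIV[OF bounded_bilinear_matrix_vector_mult
      hess_has_derivative[OF assms] grad_has_derivative[OF assms]]
  by (simp add: add.commute)

lemma f_u_has_derivative:
  assumes "x \<in> \<Omega>"
  shows "((\<lambda>y. f (u y)) has_derivative (\<lambda>h. deriv f (u x) * (grad u x \<bullet> h))) (at x)"
  using has_derivative_compose[OF u_has_derivative[OF assms], of f "\<lambda>h. deriv f (u x) * h"] f_derivative[of "u x"]
  by (simp add: has_field_derivative_def)

lemma p_laplace_at:
  assumes "x \<in> regular_set"
  shows "norm (grad u x) powr (p - 2) * p_trace p (grad u x) ((*v) (hess u x)) + f (u x) = 0"
  using p_laplace_pointwise[OF open_domain u_C3 _ p_laplace f_continuous] assms by (simp add: regular_set_def)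

lemma p_trace_hess:
  "p_trace p (grad u x) ((*v) (hess u x)) = trace (hess u x) + (p - 2) * (hess_grad x \<bullet> grad u x) / (grad u x \<bullet> grad u x)"
  by (simp add: p_trace_def op_trace_matrix hess_grad_def inner_commute)

lemma p_laplace_expanded:
  assumes "x \<in> regular_set"
  shows "norm (grad u x) powr (p - 2) * trace (hess u x)
    + (p - 2) * norm (grad u x) powr (p - 4) * (hess_grad x \<bullet> grad u x) + f (u x) = 0"
  using p_laplace_at[OF assms] assms
  by (simp add: p_trace_hess grad_powr_minus regular_set_def distrib_left power2_eq_square mult_ac)

lemma p_laplace_differentiated:
  assumes "x \<in> regular_set"
  defines "g \<equiv> grad u x" and "s \<equiv> hess_grad x"
  shows "norm g powr (p - 2) * trace (third_deriv u x g) + (p - 2) * norm g powr (p - 4) * (s \<bullet> g) * trace (hess u x)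
    + (p - 2) * ((p - 4) * norm g powr (p - 6) * (s \<bullet> g)\<^sup>2
        + norm g powr (p - 4) * ((third_deriv u x g *v g) \<bullet> g + 2 * (s \<bullet> s)))
    + deriv f (u x) * (g \<bullet> g) = 0"
proof -
  have x: "x \<in> \<Omega>" "grad u x \<noteq> 0" using assms(1) by (auto simp: regular_set_def)
  let ?E = "\<lambda>y. norm (grad u y) powr (p - 2) * trace (hess u y)
    + (p - 2) * norm (grad u y) powr (p - 4) * (hess_grad y \<bullet> grad u y) + f (u y)"
  define E' where "E' h = norm g powr (p - 2) * trace (third_deriv u x h)
      + (p - 2) * norm g powr (p - 2 - 2) * (s \<bullet> h) * trace (hess u x)
      + ((p - 2) * norm g powr (p - 4) * (s \<bullet> (hess u x *v h) + (third_deriv u x h *v g + hess u x *v (hess u x *v h)) \<bullet> g)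
         + (p - 2) * ((p - 4) * norm g powr (p - 4 - 2) * (s \<bullet> h)) * (s \<bullet> g))
      + deriv f (u x) * (g \<bullet> h)" for h
  have "((\<lambda>y. trace (hess u y)) has_derivative (\<lambda>h. trace (third_deriv u x h))) (at x)"
    unfolding trace_def
    by (intro has_derivative_sum bounded_linear.has_derivative[OF bounded_linear_vec_nth]
        bounded_linear.has_derivative[OF bounded_linear_vec_nth hess_has_derivative[OF x(1)]])
  then have "(?E has_derivative E') (at x)"
    unfolding E'_def g_def s_def
    by (intro has_derivative_add has_derivative_mult has_derivative_mult_right has_derivative_inner
        grad_norm_powr_has_derivative[OF x] hess_grad_has_derivative[OF x(1)] grad_has_derivative[OF x(1)]
        f_u_has_derivative[OF x(1)])
  moreover have "(?E has_derivative (\<lambda>h. 0)) (at x)"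
    by (rule has_derivative_transform_within_open[OF has_derivative_const[of 0] open_regular_set assms(1)])
       (use p_laplace_expanded in auto)
  ultimately have "E' = (\<lambda>h. 0)" by (rule has_derivative_unique)
  then have "E' g = 0" by simp
  moreover have "hess u x *v g = s" "(hess u x *v s) \<bullet> g = s \<bullet> s"
    by (simp_all add: g_def s_def hess_grad_def flip: inner_hess_commute[OF x(1)])
  ultimately show ?thesis
    by (simp add: E'_def inner_add_left power2_eq_square algebra_simps)
qed

sublocale elliptic_operator regular_set "\<lambda>x. p_trace p (grad u x)" drift "min 1 (p - 1)" "CARD('n) + p - 2"
proof
  show "p_trace p (grad u x) H \<le> 0" if "x \<in> regular_set" "linear H" "\<And>v. v \<bullet> H v \<le> 0" for x H
    using p_trace_nonpos[OF that(2) _ p_gt_1 that(3)] that(1) by (simp add: regular_set_def)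
qed (use p_gt_1 in \<open>auto simp: p_trace_add p_trace_scaleR p_trace_rank_one_ge p_trace_ident regular_set_def\<close>)

lemma operator_at_u:
  assumes "x \<in> regular_set"
  shows "operator_at u x (grad u x) ((p - 1) * f (u x) / norm (grad u x) powr (p - 2))"
proof -
  have x: "x \<in> \<Omega>" "grad u x \<noteq> 0" using assms by (auto simp: regular_set_def)
  have "has_gradient_hessian u x (grad u x) ((*v) (hess u x))"
    by (rule has_gradient_hessianI[OF open_domain x(1) u_has_derivative grad_has_derivative[OF x(1)]])
  moreover have "p_trace p (grad u x) ((*v) (hess u x)) = - f (u x) / norm (grad u x) powr (p - 2)"
    using p_laplace_at[OF assms] x(2) by (simp add: field_simps eq_neg_iff_add_eq_0)
  moreover have "drift x \<bullet> grad u x = p * f (u x) / norm (grad u x) powr (p - 2)"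
    using x(2) by (simp add: drift_def grad_powr_minus)
  ultimately show ?thesis
    using operator_atI[of u x "grad u x" "(*v) (hess u x)"]
    by (simp add: left_diff_distrib diff_divide_distrib)
qed

lemma P_function_has_gradient_hessian:
  assumes "x \<in> regular_set"
  shows "has_gradient_hessian P_function x (P_grad x) (P_hess x)"
proof (rule has_gradient_hessianI[OF open_regular_set assms])
  fix y assume "y \<in> regular_set"
  then have y: "y \<in> \<Omega>" "grad u y \<noteq> 0" by (auto simp: regular_set_def)
  have "((\<lambda>y. F (u y)) has_derivative (\<lambda>h. f (u y) * (grad u y \<bullet> h))) (at y)"
    using has_derivative_compose[OF u_has_derivative[OF y(1)], of F "\<lambda>h. f (u y) * h"] F_derivative[of "u y"]
    by (simp add: has_field_derivative_def)
  then have "(P_function has_derivative (\<lambda>h. (p - 1) / p * (p * norm (grad u y) powr (p - 2) * (hess_grad y \<bullet> h))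
      + f (u y) * (grad u y \<bullet> h))) (at y)"
    unfolding P_function_def
    by (intro has_derivative_add has_derivative_mult_right grad_norm_powr_has_derivative[OF y])
  then show "(P_function has_derivative (\<lambda>h. P_grad y \<bullet> h)) (at y)"
    using p_gt_1 by (simp add: P_grad_def inner_add_left mult.assoc)
next
  have x: "x \<in> \<Omega>" "grad u x \<noteq> 0" using assms by (auto simp: regular_set_def)
  have "(P_grad has_derivative
     (\<lambda>h. (((p - 1) * norm (grad u x) powr (p - 2)) *\<^sub>R (third_deriv u x h *v grad u x + hess u x *v (hess u x *v h))
        + ((p - 1) * ((p - 2) * norm (grad u x) powr (p - 2 - 2) * (hess_grad x \<bullet> h))) *\<^sub>R hess_grad x)
      + (f (u x) *\<^sub>R (hess u x *v h) + (deriv f (u x) * (grad u x \<bullet> h)) *\<^sub>R grad u x))) (at x)"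
    unfolding P_grad_def
    by (intro has_derivative_add has_derivative_scaleR has_derivative_mult_right grad_norm_powr_has_derivative[OF x]
        hess_grad_has_derivative[OF x(1)] grad_has_derivative[OF x(1)] f_u_has_derivative[OF x(1)])
  then show "(P_grad has_derivative P_hess x) (at x)"
    by (rule has_derivative_eq_rhs) (simp add: P_hess_def fun_eq_iff algebra_simps)
qed

lemma p_trace_P_hess:
  assumes "x \<in> regular_set"
  defines "g \<equiv> grad u x" and "s \<equiv> hess_grad x" and "A \<equiv> hess u x" and "T \<equiv> third_deriv u x (grad u x)"
  shows "p_trace p g (P_hess x)
    = (p - 1) * (p - 2) * norm g powr (p - 4) * (s \<bullet> s + (p - 2) * (s \<bullet> g)\<^sup>2 / (g \<bullet> g))
    + (p - 1) * norm g powr (p - 2) * (trace T + (p - 2) * ((T *v g) \<bullet> g) / (g \<bullet> g) + (A \<bullet> A + (p - 2) * (s \<bullet> s) / (g \<bullet> g)))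
    + deriv f (u x) * ((p - 1) * (g \<bullet> g)) + f (u x) * (trace A + (p - 2) * (s \<bullet> g) / (g \<bullet> g))"
proof -
  have x: "x \<in> \<Omega>" "g \<noteq> 0" using assms(1) by (auto simp: regular_set_def g_def)
  have "third_deriv u x h *v g = T *v h" for h
    using third_deriv_commute[OF u_C3 open_domain _ x(1), of h g] by (simp add: T_def g_def)
  then have "p_trace p g (\<lambda>h. third_deriv u x h *v g) = trace T + (p - 2) * ((T *v g) \<bullet> g) / (g \<bullet> g)"
    by (simp add: p_trace_def op_trace_matrix inner_commute)
  moreover have "p_trace p g (\<lambda>h. A *v (A *v h)) = A \<bullet> A + (p - 2) * (s \<bullet> s) / (g \<bullet> g)"
  proof -
    have "g \<bullet> (A *v (A *v g)) = s \<bullet> s"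
      by (simp add: A_def g_def s_def hess_grad_def inner_hess_commute[OF x(1)])
    then show ?thesis
      using op_trace_symmetric_square[OF transpose_hess_u[OF x(1)]] by (simp add: p_trace_def A_def)
  qed
  moreover have "p_trace p g (\<lambda>h. (g \<bullet> h) *\<^sub>R g) = (p - 1) * (g \<bullet> g)"
    using x(2) by (simp add: p_trace_rank_one power2_eq_square field_simps)
  moreover have "p_trace p g (\<lambda>h. A *v h) = trace A + (p - 2) * (s \<bullet> g) / (g \<bullet> g)"
    unfolding A_def g_def s_def by (rule p_trace_hess)
  ultimately show ?thesis
    unfolding P_hess_def g_def[symmetric] s_def[symmetric] A_def[symmetric] p_trace_add p_trace_scaleR
    by (simp add: p_trace_rank_one)
qed

lemma operator_at_P:
  assumes "x \<in> regular_set"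
  defines "g \<equiv> grad u x" and "s \<equiv> hess_grad x" and "A \<equiv> hess u x"
  shows "operator_at P_function x (P_grad x) ((p - 1) * norm g powr (p - 2) *
    (2 * ((s \<bullet> s) / (g \<bullet> g) - (s \<bullet> g)\<^sup>2 / (g \<bullet> g)\<^sup>2) + (norm (tangential_matrix g A))\<^sup>2 + (tangential_trace g ((*v) A))\<^sup>2))"
proof -
  have x: "x \<in> \<Omega>" "g \<noteq> 0" using assms(1) by (auto simp: regular_set_def g_def)
  have powr: "norm g powr (p - 2) = norm g powr p / (g \<bullet> g)" "norm g powr (p - 4) = norm g powr p / (g \<bullet> g)\<^sup>2"
    "norm g powr (p - 6) = norm g powr p / (g \<bullet> g) ^ 3"
    using grad_powr_minus[of x] x(2) by (simp_all add: g_def)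
  have "g \<bullet> P_grad x = (p - 1) * (norm g powr p / (g \<bullet> g)) * (s \<bullet> g) + f (u x) * (g \<bullet> g)"
    by (simp add: P_grad_def inner_add_right powr inner_commute[of g s] flip: g_def s_def)
  then have "drift x \<bullet> P_grad x
      = p * f (u x) / norm g powr p * ((p - 1) * (norm g powr p / (g \<bullet> g)) * (s \<bullet> g) + f (u x) * (g \<bullet> g))"
    by (simp only: drift_def inner_scaleR_left flip: g_def)
  moreover have "(norm (tangential_matrix g A))\<^sup>2 = A \<bullet> A - 2 * (s \<bullet> s) / (g \<bullet> g) + (s \<bullet> g)\<^sup>2 / (g \<bullet> g)\<^sup>2"
    unfolding s_def hess_grad_def A_def g_def
    by (rule norm_tangential_matrix[OF transpose_hess_u[OF x(1)]]) (use x(2) in \<open>simp add: g_def\<close>)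
  moreover have "tangential_trace g ((*v) A) = trace A - (s \<bullet> g) / (g \<bullet> g)"
    by (simp add: tangential_trace_def op_trace_matrix A_def g_def s_def hess_grad_def inner_commute)
  ultimately show ?thesis
    using operator_atI[OF P_function_has_gradient_hessian[OF assms(1)]]
      P_function_identity[where W="g \<bullet> g" and w="norm g powr p" and \<tau>="trace A" and \<sigma>="s \<bullet> g" and N="A \<bullet> A", OF _ _ _
        p_laplace_differentiated[OF assms(1), folded g_def s_def A_def, unfolded powr]]
      p_laplace_at[OF assms(1), folded g_def A_def] p_trace_hess[of x, folded g_def s_def A_def] x(2)
    by (simp add: p_trace_P_hess[OF assms(1), folded g_def s_def A_def] powr flip: g_def)
qed

lemma hess_grad_defect_nonneg:
  "(hess_grad x \<bullet> hess_grad x) / (grad u x \<bullet> grad u x) - (hess_grad x \<bullet> grad u x)\<^sup>2 / (grad u x \<bullet> grad u x)\<^sup>2 \<ge> 0"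
proof (cases "grad u x = 0")
  case False
  then show ?thesis
    using Cauchy_Schwarz_ineq[of "hess_grad x" "grad u x"] by (simp add: field_simps power2_eq_square)
qed simp

lemma subsolution_at_P:
  assumes "x \<in> regular_set"
  shows "subsolution_at P_function x"
proof -
  have "0 \<le> (p - 1) * norm (grad u x) powr (p - 2) *
      (2 * ((hess_grad x \<bullet> hess_grad x) / (grad u x \<bullet> grad u x) - (hess_grad x \<bullet> grad u x)\<^sup>2 / (grad u x \<bullet> grad u x)\<^sup>2)
       + (norm (tangential_matrix (grad u x) (hess u x)))\<^sup>2 + (tangential_trace (grad u x) ((*v) (hess u x)))\<^sup>2)"
    using hess_grad_defect_nonneg[of x] p_gt_1 by (intro mult_nonneg_nonneg add_nonneg_nonneg) auto
  then show ?thesis using operator_at_P[OF assms] unfolding subsolution_at_def by blast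
qed

lemma hess_rank_one_at_P_max:
  assumes "x \<in> regular_set" and "\<forall>\<^sub>F y in nhds x. P_function y \<le> P_function x"
  defines "g \<equiv> grad u x"
  shows "\<exists>c. \<forall>h. hess u x *v h = (c * (g \<bullet> h)) *\<^sub>R g"
proof -
  have x: "x \<in> \<Omega>" "g \<noteq> 0" using assms(1) by (auto simp: regular_set_def g_def)
  define s where "s = hess u x *v g"
  define defect where "defect = (s \<bullet> s) / (g \<bullet> g) - (s \<bullet> g)\<^sup>2 / (g \<bullet> g)\<^sup>2"
  define A where "A = tangential_matrix g (hess u x)"
  have "defect \<ge> 0" using hess_grad_defect_nonneg[of x] by (simp add: defect_def s_def g_def hess_grad_def)
  moreover have "(p - 1) * norm g powr (p - 2) * (2 * defect + (norm A)\<^sup>2 + (tangential_trace g ((*v) (hess u x)))\<^sup>2) \<le> 0"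
    using operator_at_local_max(2)[OF operator_at_P[OF assms(1)] assms(2,1)]
    by (simp add: defect_def A_def s_def g_def hess_grad_def)
  moreover have "(p - 1) * norm g powr (p - 2) > 0" using p_gt_1 x(2) by simp
  ultimately have "2 * defect + (norm A)\<^sup>2 + (tangential_trace g ((*v) (hess u x)))\<^sup>2 \<le> 0"
    by (meson mult_pos_pos not_le)
  then have "defect = 0 \<and> (norm A)\<^sup>2 = 0"
    using \<open>defect \<ge> 0\<close> zero_le_power2[of "norm A"] zero_le_power2[of "tangential_trace g ((*v) (hess u x))"] by linarith
  then have zero: "defect = 0" "A = 0" by auto
  define r where "r = (s \<bullet> g) / (g \<bullet> g)"
  have "(s - r *\<^sub>R g) \<bullet> (s - r *\<^sub>R g) = (g \<bullet> g) * defect"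
    using x(2) by (simp add: r_def defect_def inner_diff_left inner_diff_right inner_commute[of g s] field_simps power2_eq_square)
  then have s: "s = r *\<^sub>R g" using zero(1) by simp
  have "hess u x *v h = (r / (g \<bullet> g) * (g \<bullet> h)) *\<^sub>R g" for h
  proof -
    have "A *v h = hess u x *v h - (1 / (g \<bullet> g)) *\<^sub>R ((s \<bullet> h) *\<^sub>R g + (g \<bullet> h) *\<^sub>R s) + ((s \<bullet> g) / (g \<bullet> g)\<^sup>2) *\<^sub>R ((g \<bullet> h) *\<^sub>R g)"
      by (simp add: A_def tangential_matrix_def matrix_vector_mult_add_rdistrib matrix_vector_mult_diff_rdistrib
          outer_vector_mult flip: s_def scaleR_matrix_vector_assoc)
    then have "hess u x *v h = (1 / (g \<bullet> g)) *\<^sub>R ((s \<bullet> h) *\<^sub>R g + (g \<bullet> h) *\<^sub>R s) - ((s \<bullet> g) / (g \<bullet> g)\<^sup>2) *\<^sub>R ((g \<bullet> h) *\<^sub>R g)"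
      by (simp add: zero(2) algebra_simps)
    then show ?thesis
      using x(2) by (simp add: s power2_eq_square flip: scaleR_add_left scaleR_diff_left)
  qed
  then show ?thesis by blast
qed

lemma P_grad_inner_grad:
  assumes "x \<in> regular_set"
  shows "P_grad x \<bullet> grad u x = - (norm (grad u x) powr p) * tangential_trace (grad u x) ((*v) (hess u x))"
proof -
  define W where "W = grad u x \<bullet> grad u x"
  define w where "w = norm (grad u x) powr p"
  define \<sigma> where "\<sigma> = hess_grad x \<bullet> grad u x"
  have "grad u x \<noteq> 0" using assms by (simp add: regular_set_def)
  then have W: "W \<noteq> 0" and powr: "norm (grad u x) powr (p - 2) = w / W"
    using grad_powr_minus(1)[of x] by (simp_all add: W_def w_def)
  have "f (u x) = - (w / W * (trace (hess u x) + (p - 2) * \<sigma> / W))"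
    using p_laplace_at[OF assms] by (simp add: p_trace_hess powr \<sigma>_def W_def)
  moreover have "P_grad x \<bullet> grad u x = (p - 1) * (w / W) * \<sigma> + f (u x) * W"
    by (simp add: P_grad_def inner_add_left powr \<sigma>_def W_def)
  ultimately have "P_grad x \<bullet> grad u x
      = (p - 1) * (w / W) * \<sigma> + - (w / W * (trace (hess u x) + (p - 2) * \<sigma> / W)) * W"
    by (simp only:)
  also have "\<dots> = - w * (trace (hess u x) - \<sigma> / W)"
    using W by (simp add: field_simps power2_eq_square)
  also have "trace (hess u x) - \<sigma> / W = tangential_trace (grad u x) ((*v) (hess u x))"
    by (simp add: tangential_trace_def op_trace_matrix \<sigma>_def W_def hess_grad_def inner_commute)
  finally show ?thesis by (simp add: w_def)
qed

lemma P_le_grad_powr: "P_function x \<le> norm (grad u x) powr p"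
proof -
  have "(p - 1) / p * norm (grad u x) powr p \<le> 1 * norm (grad u x) powr p"
    using p_gt_1 by (intro mult_right_mono) auto
  then show ?thesis using F_nonpos[of "u x"] by (simp add: P_function_def)
qed

end

section \<open>Defining functions and inward rays\<close>

lemma local_defining_mono: "local_defining k \<Omega> q r \<phi> \<Longrightarrow> j \<le> k \<Longrightarrow> local_defining j \<Omega> q r \<phi>"
  unfolding local_defining_def using Ck_on_mono by blast

lemma local_definingD:
  assumes "local_defining k \<Omega> q r \<phi>"
  shows "r > 0" "q \<in> ball q r" "Ck_on k \<phi> (ball q r)" "\<And>x. x \<in> ball q r \<Longrightarrow> grad \<phi> x \<noteq> 0"
    "\<And>x. x \<in> ball q r \<Longrightarrow> x \<in> \<Omega> \<longleftrightarrow> \<phi> x < 0"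
  using assms unfolding local_defining_def by auto

lemma local_defining_grad_nonzero: "local_defining k \<Omega> q r \<phi> \<Longrightarrow> grad \<phi> q \<noteq> 0"
  using local_definingD(2,4) by blast

lemma local_defining_zero:
  assumes defining: "local_defining k \<Omega> q r \<phi>" and "open \<Omega>" and x: "x \<in> frontier \<Omega>" "x \<in> ball q r"
  shows "\<phi> x = 0"
proof (rule antisym)
  note mem = local_definingD(5)[OF defining]
  have "x \<notin> \<Omega>" using x(1) \<open>open \<Omega>\<close> by (simp add: frontier_def interior_open)
  then show "0 \<le> \<phi> x" using mem[OF x(2)] by simp
  show "\<phi> x \<le> 0"
  proof (rule ccontr)
    assume "\<not> \<phi> x \<le> 0"
    define V where "V = ball q r \<inter> \<phi> -` {0<..}"
    have "continuous_on (ball q r) \<phi>"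
      using Ck_on_continuous[OF local_definingD(3)[OF defining], of "[]"] by simp
    then have "open V" unfolding V_def by (intro continuous_open_preimage) auto
    moreover have "V \<inter> closure \<Omega> \<noteq> {}" using x \<open>\<not> \<phi> x \<le> 0\<close> by (auto simp: V_def frontier_def)
    ultimately obtain y where "y \<in> V" "y \<in> \<Omega>" using open_Int_closure_eq_empty[of V \<Omega>] by blast
    then show False using mem[of y] by (auto simp: V_def)
  qed
qed

lemma local_defining_subball:
  assumes defining: "local_defining k \<Omega> q r \<phi>" and x: "x \<in> ball q r"
  obtains r' where "local_defining k \<Omega> x r' \<phi>"
proof -
  obtain r' where r': "r' > 0" "ball x r' \<subseteq> ball q r" using openE[OF open_ball x] by blast
  have "local_defining k \<Omega> x r' \<phi>"
    using defining r' Ck_on_subset[OF local_definingD(3)[OF defining] r'(2)] unfolding local_defining_def by blast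
  then show thesis by (rule that)
qed

lemma local_defining_ray:
  assumes defining: "local_defining k \<Omega> q r \<phi>" "1 \<le> k" and "open \<Omega>" and q: "q \<in> frontier \<Omega>" and d: "grad \<phi> q \<bullet> d < 0"
  shows "\<forall>\<^sub>F t in at_right 0. q + t *\<^sub>R d \<in> \<Omega>"
proof -
  have q_ball: "q \<in> ball q r" by (rule local_definingD(2)[OF defining(1)])
  have "(\<phi> has_derivative (\<lambda>h. grad \<phi> q \<bullet> h)) (at q)"
    by (rule Ck_on_has_derivative_grad[OF local_definingD(3)[OF defining(1)] open_ball defining(2) q_ball])
  from DERIV_neg_dec_right[OF has_derivative_direction[OF this] d]
  have "\<forall>\<^sub>F t in at_right 0. \<phi> (q + t *\<^sub>R d) < \<phi> q"
    unfolding eventually_at_right_field by auto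
  moreover have "\<forall>\<^sub>F t in at_right 0. q + t *\<^sub>R d \<in> ball q r"
    using eventually_line_in_open[OF open_ball q_ball, of d] by (rule filter_leD[OF at_within_le_nhds])
  ultimately show ?thesis
    by eventually_elim
      (use local_definingD(5)[OF defining(1)] local_defining_zero[OF defining(1) \<open>open \<Omega>\<close> q q_ball] in auto)
qed

lemma tendsto_along_ray:
  fixes q d :: "'a::real_normed_vector"
  assumes "\<forall>\<^sub>F t in at_right 0. q + t *\<^sub>R d \<in> \<Omega>" "continuous_on (closure \<Omega>) h" "q \<in> closure \<Omega>"
  shows "((\<lambda>t. h (q + t *\<^sub>R d)) \<longlongrightarrow> h q) (at_right 0)"
proof (rule continuous_on_tendsto_compose[OF assms(2) _ assms(3)])
  show "((\<lambda>t. q + t *\<^sub>R d) \<longlongrightarrow> q) (at_right 0)" by (rule tendsto_eq_intros | simp)+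
  show "\<forall>\<^sub>F t in at_right 0. q + t *\<^sub>R d \<in> closure \<Omega>"
    using assms(1) by eventually_elim (use closure_subset in auto)
qed

lemma ray_difference_quotient_tendsto:
  fixes q d :: "'a::real_inner"
  assumes k: "((\<lambda>t. k (q + t *\<^sub>R d)) \<longlongrightarrow> k q) (at_right 0)" and G: "((\<lambda>t. G (q + t *\<^sub>R d)) \<longlongrightarrow> G q) (at_right 0)"
    and der: "\<forall>\<^sub>F t in at_right 0. (k has_derivative (\<lambda>h. G (q + t *\<^sub>R d) \<bullet> h)) (at (q + t *\<^sub>R d))"
  shows "((\<lambda>t. (k (q + t *\<^sub>R d) - k q) / t) \<longlongrightarrow> G q \<bullet> d) (at_right 0)"
proof (rule lhopital_right_0[where ?g0.0="\<lambda>t. t" and g'="\<lambda>_. 1" and f'="\<lambda>t. G (q + t *\<^sub>R d) \<bullet> d"])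
  show "((\<lambda>t. k (q + t *\<^sub>R d) - k q) \<longlongrightarrow> 0) (at_right 0)" using k by (simp add: LIM_zero)
  show "\<forall>\<^sub>F t in at_right 0. ((\<lambda>t. k (q + t *\<^sub>R d) - k q) has_real_derivative G (q + t *\<^sub>R d) \<bullet> d) (at t)"
    using der
  proof eventually_elim
    case (elim t)
    from has_derivative_along_line[OF elim] show ?case by (auto intro!: derivative_eq_intros)
  qed
  show "((\<lambda>t. G (q + t *\<^sub>R d) \<bullet> d / 1) \<longlongrightarrow> G q \<bullet> d) (at_right 0)"
    using tendsto_inner[OF G tendsto_const] by simp
qed (auto simp: eventually_at_filter)

text \<open>A tangential component of the boundary gradient would make \<open>u\<close> negative on some inward ray.\<close>
lemma boundary_gradient_normal:
  fixes Du :: "real^'n \<Rightarrow> real^'n"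
  assumes "open \<Omega>" and q: "q \<in> frontier \<Omega>" and defining: "local_defining 1 \<Omega> q r \<phi>"
    and cont: "continuous_on (closure \<Omega>) u" "continuous_on (closure \<Omega>) Du"
    and der: "\<And>x. x \<in> \<Omega> \<Longrightarrow> (u has_derivative (\<lambda>h. Du x \<bullet> h)) (at x)"
    and u: "\<And>x. x \<in> \<Omega> \<Longrightarrow> u x \<ge> 0" "u q = 0"
  shows "Du q = (Du q \<bullet> sgn (grad \<phi> q)) *\<^sub>R sgn (grad \<phi> q)"
proof (rule ccontr)
  define \<nu> where "\<nu> = sgn (grad \<phi> q)"
  define s where "s = Du q \<bullet> \<nu>"
  define \<tau> where "\<tau> = Du q - s *\<^sub>R \<nu>"
  assume "Du q \<noteq> (Du q \<bullet> sgn (grad \<phi> q)) *\<^sub>R sgn (grad \<phi> q)"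
  then have "\<tau> \<bullet> \<tau> > 0" by (simp add: \<tau>_def s_def \<nu>_def)
  have "grad \<phi> q \<noteq> 0" by (rule local_defining_grad_nonzero[OF defining])
  then have \<nu>\<nu>: "\<nu> \<bullet> \<nu> = 1" by (simp add: \<nu>_def norm_sgn flip: norm_eq_1)
  then have \<tau>\<nu>: "\<tau> \<bullet> \<nu> = 0" by (simp add: \<tau>_def s_def inner_diff_left)
  define e where "e = (\<tau> \<bullet> \<tau>) / (\<bar>s\<bar> + 1)"
  have e: "e > 0" "- s * e < \<tau> \<bullet> \<tau>"
  proof -
    show "e > 0" using \<open>\<tau> \<bullet> \<tau> > 0\<close> by (simp add: e_def add_nonneg_pos)
    then have "- s * e < (\<bar>s\<bar> + 1) * e" using abs_ge_minus_self[of s] by (intro mult_strict_right_mono) auto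
    then show "- s * e < \<tau> \<bullet> \<tau>" by (simp add: e_def)
  qed
  define d where "d = - e *\<^sub>R \<nu> - \<tau>"
  have "grad \<phi> q = norm (grad \<phi> q) *\<^sub>R \<nu>" using \<open>grad \<phi> q \<noteq> 0\<close> by (simp add: \<nu>_def sgn_div_norm)
  then have "grad \<phi> q \<bullet> d = norm (grad \<phi> q) * (\<nu> \<bullet> d)" by (metis inner_scaleR_left)
  also have "\<nu> \<bullet> d = - e" using \<nu>\<nu> \<tau>\<nu> by (simp add: d_def inner_diff_right inner_commute)
  finally have "grad \<phi> q \<bullet> d < 0" using \<open>grad \<phi> q \<noteq> 0\<close> e by (simp add: mult_pos_neg)
  then have ray: "\<forall>\<^sub>F t in at_right 0. q + t *\<^sub>R d \<in> \<Omega>"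
    using local_defining_ray[OF defining _ \<open>open \<Omega>\<close> q] by simp
  have "q \<in> closure \<Omega>" using q by (simp add: frontier_def)
  from ray_difference_quotient_tendsto[OF tendsto_along_ray[OF ray cont(1) this] tendsto_along_ray[OF ray cont(2) this]
      eventually_mono[OF ray der]]
  have "((\<lambda>t. (u (q + t *\<^sub>R d) - u q) / t) \<longlongrightarrow> Du q \<bullet> d) (at_right 0)" .
  moreover have "\<forall>\<^sub>F t in at_right 0. (u (q + t *\<^sub>R d) - u q) / t \<ge> 0"
    using ray eventually_at_right_less[of 0] by eventually_elim (use u in auto)
  ultimately have "Du q \<bullet> d \<ge> 0" by (rule tendsto_lowerbound) simp
  moreover have "Du q = \<tau> + s *\<^sub>R \<nu>" by (simp add: \<tau>_def)
  then have "Du q \<bullet> d = - s * e - \<tau> \<bullet> \<tau>"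
    using \<nu>\<nu> \<tau>\<nu> by (simp add: d_def inner_add_left inner_add_right inner_diff_right inner_commute)
  ultimately show False using e(2) by linarith
qed

section \<open>The gradient estimate\<close>

locale overdetermined_problem = p_laplace_solution \<Omega> u f F p
  for \<Omega> :: "(real^'n) set" and u :: "real^'n \<Rightarrow> real" and f F :: "real \<Rightarrow> real" and p :: real +
  fixes Du :: "real^'n \<Rightarrow> real^'n" and D2u :: "real^'n \<Rightarrow> real^'n^'n" and \<kappa> :: real
  assumes \<kappa>_pos: "\<kappa> > 0"
    and connected_domain: "connected \<Omega>" and domain_nonempty: "\<Omega> \<noteq> {}"
    and C1_boundary: "\<And>q. q \<in> frontier \<Omega> \<Longrightarrow> \<exists>r \<phi>. local_defining 1 \<Omega> q r \<phi>"
    and u_continuous_closure: "continuous_on (closure \<Omega>) u"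
    and Du_continuous: "continuous_on (closure \<Omega>) Du" and Du_eq: "\<And>x. x \<in> \<Omega> \<Longrightarrow> Du x = grad u x"
    and D2u_continuous: "continuous_on (closure \<Omega>) D2u" and D2u_eq: "\<And>x. x \<in> \<Omega> \<Longrightarrow> D2u x = hess u x"
    and u_bounded: "bounded (u ` \<Omega>)"
    and u_pos: "\<And>x. x \<in> \<Omega> \<Longrightarrow> u x > 0"
    and u_boundary: "\<And>q. q \<in> frontier \<Omega> \<Longrightarrow> u q = 0"
    and neumann: "\<And>q r \<phi>. q \<in> frontier \<Omega> \<Longrightarrow> local_defining 1 \<Omega> q r \<phi> \<Longrightarrow> Du q \<bullet> sgn (grad \<phi> q) = - \<kappa>"
    and F0_ge: "F 0 \<ge> - ((p - 1) / p) * \<kappa> powr p"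
    and F_degenerate: "p > 2 \<Longrightarrow> F u0 = 0 \<Longrightarrow> F \<in> O[at u0](\<lambda>s. \<bar>s - u0\<bar> powr p)"
begin

definition "P_boundary = (p - 1) / p * \<kappa> powr p + F 0"

definition "P_closure x = (p - 1) / p * norm (Du x) powr p + F (u x)"

lemma P_boundary_nonneg: "P_boundary \<ge> 0"
  using F0_ge by (simp add: P_boundary_def)

lemma closure_cases: "x \<in> closure \<Omega> \<longleftrightarrow> x \<in> \<Omega> \<or> x \<in> frontier \<Omega>"
  using open_domain closure_subset[of \<Omega>] by (auto simp: frontier_def interior_open)

lemma u_has_derivative_Du: "x \<in> \<Omega> \<Longrightarrow> (u has_derivative (\<lambda>h. Du x \<bullet> h)) (at x)"
  using u_has_derivative by (simp add: Du_eq)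

lemma Du_has_derivative:
  assumes "x \<in> \<Omega>"
  shows "(Du has_derivative (\<lambda>h. D2u x *v h)) (at x)"
  using has_derivative_transform_within_open[OF grad_has_derivative[OF assms] open_domain assms] Du_eq D2u_eq[OF assms]
  by simp

lemma Du_boundary:
  assumes "q \<in> frontier \<Omega>" "local_defining 1 \<Omega> q r \<phi>"
  shows "Du q = - \<kappa> *\<^sub>R sgn (grad \<phi> q)"
  using boundary_gradient_normal[OF open_domain assms u_continuous_closure Du_continuous u_has_derivative_Du]
    u_pos u_boundary[OF assms(1)] neumann[OF assms] by (simp add: less_imp_le)

lemma norm_Du_boundary:
  assumes "q \<in> frontier \<Omega>"
  shows "norm (Du q) = \<kappa>"
proof -
  obtain r \<phi> where defining: "local_defining 1 \<Omega> q r \<phi>" using C1_boundary[OF assms] by blast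
  then have "grad \<phi> q \<noteq> 0" by (rule local_defining_grad_nonzero)
  then show ?thesis using Du_boundary[OF assms defining] \<kappa>_pos by (simp add: norm_sgn)
qed

lemma F_continuous: "continuous_on S F"
  using F_derivative DERIV_isCont by (metis continuous_at_imp_continuous_on)

lemma P_closure_continuous: "continuous_on (closure \<Omega>) P_closure"
  unfolding P_closure_def using p_gt_1
  by (intro continuous_intros Du_continuous continuous_on_powr'
      continuous_on_compose2[OF F_continuous u_continuous_closure]) auto

lemma P_closure_eq: "x \<in> \<Omega> \<Longrightarrow> P_closure x = P_function x"
  by (simp add: P_closure_def P_function_def Du_eq)

lemma P_closure_frontier: "q \<in> frontier \<Omega> \<Longrightarrow> P_closure q = P_boundary"
  by (simp add: P_closure_def P_boundary_def norm_Du_boundary u_boundary)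

lemma P_function_continuous: "continuous_on \<Omega> P_function"
  by (rule continuous_on_eq[OF continuous_on_subset[OF P_closure_continuous closure_subset]]) (rule P_closure_eq)

lemma regular_if_P_pos: "x \<in> \<Omega> \<Longrightarrow> P_function x > 0 \<Longrightarrow> x \<in> regular_set"
  using P_le_grad_powr[of x] by (auto simp: regular_set_def)

lemma f_u_bounded:
  obtains M where "M \<ge> 0" "\<And>x. x \<in> \<Omega> \<Longrightarrow> \<bar>f (u x)\<bar> \<le> M"
proof -
  have "compact (closure (u ` \<Omega>))" using u_bounded by simp
  then obtain M where "M \<ge> 0" "\<And>s. s \<in> closure (u ` \<Omega>) \<Longrightarrow> norm (f s) \<le> M"
    using continuous_on_compact_bound[OF _ continuous_on_subset[OF f_continuous]] by blast
  then show thesis using that[of M] closure_subset[of "u ` \<Omega>"] by auto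
qed

lemma drift_le:
  assumes "\<bar>f (u x)\<bar> \<le> M" "0 < w" "w \<le> norm (grad u x) powr p"
  shows "norm (drift x) \<le> p * M / w * norm (grad u x)"
proof -
  have "\<bar>f (u x)\<bar> / norm (grad u x) powr p \<le> M / w" using assms by (intro frac_le) auto
  then have "p * (\<bar>f (u x)\<bar> / norm (grad u x) powr p) * norm (grad u x) \<le> p * (M / w) * norm (grad u x)"
    using p_gt_1 by (intro mult_left_mono mult_right_mono) auto
  then show ?thesis using p_gt_1 by (simp add: drift_def abs_mult)
qed

lemma operator_at_u_ge:
  assumes "x \<in> regular_set" "\<bar>f (u x)\<bar> \<le> M" "0 < w" "w \<le> norm (grad u x) powr p"
  shows "\<exists>l\<ge>- ((p - 1) * M / w) * (norm (grad u x))\<^sup>2. operator_at u x (grad u x) l"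
proof (intro exI conjI)
  show "operator_at u x (grad u x) ((p - 1) * f (u x) / norm (grad u x) powr (p - 2))"
    by (rule operator_at_u[OF assms(1)])
  have "\<bar>f (u x)\<bar> / norm (grad u x) powr p \<le> M / w" using assms by (intro frac_le) auto
  then have "- (M / w) \<le> f (u x) / norm (grad u x) powr p"
    using abs_ge_minus_self[of "f (u x) / norm (grad u x) powr p"] by (simp add: abs_divide)
  then have "(p - 1) * (- (M / w)) * (norm (grad u x))\<^sup>2 \<le> (p - 1) * (f (u x) / norm (grad u x) powr p) * (norm (grad u x))\<^sup>2"
    using p_gt_1 by (intro mult_left_mono mult_right_mono) auto
  then show "- ((p - 1) * M / w) * (norm (grad u x))\<^sup>2 \<le> (p - 1) * f (u x) / norm (grad u x) powr (p - 2)"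
    using assms(1) by (simp add: regular_set_def grad_powr_minus power2_norm_eq_inner)
qed

definition paraboloid :: "real^'n \<Rightarrow> real \<Rightarrow> real^'n \<Rightarrow> real" where
  "paraboloid a R x = 1 - (x - a) \<bullet> (x - a) / R\<^sup>2"

lemma paraboloid_bounds: "R > 0 \<Longrightarrow> norm (x - a) \<le> R \<Longrightarrow> 0 \<le> paraboloid a R x \<and> paraboloid a R x \<le> 1"
  using power_mono[of "norm (x - a)" R 2] by (simp add: paraboloid_def power2_norm_eq_inner)

lemma paraboloid_pos_iff: "R > 0 \<Longrightarrow> 0 < paraboloid a R x \<longleftrightarrow> norm (x - a) < R"
  using power_strict_mono[of "norm (x - a)" R 2] power2_less_imp_less[of "norm (x - a)" R]
  by (cases "norm (x - a) < R") (auto simp: paraboloid_def simp flip: power2_norm_eq_inner)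

definition "weighted_P k a R x = P_closure x * paraboloid a R x powr p * exp (k (u x))"

lemma weighted_P_continuous:
  assumes "R > 0" "continuous_on UNIV k"
  shows "continuous_on (closure \<Omega> \<inter> cball a R) (weighted_P k a R)"
proof -
  have "continuous_on (closure \<Omega> \<inter> cball a R) P_closure" "continuous_on (closure \<Omega> \<inter> cball a R) u"
    using P_closure_continuous u_continuous_closure by (auto intro: continuous_on_subset)
  moreover have "continuous_on (closure \<Omega> \<inter> cball a R) (paraboloid a R)"
    unfolding paraboloid_def using assms(1) by (intro continuous_intros) auto
  moreover have "0 \<le> paraboloid a R x" if "x \<in> cball a R" for x
    using that paraboloid_bounds[OF assms(1), of x a] by (simp add: dist_norm norm_minus_commute)
  ultimately show ?thesis
    unfolding weighted_P_def using p_gt_1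
    by (intro continuous_intros continuous_on_powr' continuous_on_compose2[OF assms(2)]) auto
qed

lemma ln_weighted_P:
  assumes "R > 0" "x \<in> \<Omega>" "P_function x > 0" "norm (x - a) < R"
  shows "weighted_P k a R x > 0" "ln (weighted_P k a R x) = ln (P_function x) + (k (u x) + p * ln (paraboloid a R x))"
proof -
  have "paraboloid a R x > 0" using assms(4) paraboloid_pos_iff[OF assms(1)] by blast
  then show "weighted_P k a R x > 0" "ln (weighted_P k a R x) = ln (P_function x) + (k (u x) + p * ln (paraboloid a R x))"
    using assms(2,3) by (simp_all add: weighted_P_def P_closure_eq ln_mult ln_powr)
qed

lemma weighted_P_large_interior:
  assumes "R > 0" and x: "x \<in> closure \<Omega>" "norm (x - a) \<le> R"
    and large: "P_boundary * exp (k 0) < weighted_P k a R x"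
  shows "x \<in> \<Omega>" "norm (x - a) < R" "P_function x > 0"
proof -
  note \<rho> = paraboloid_bounds[OF \<open>R > 0\<close> x(2)]
  have pos: "weighted_P k a R x > 0"
    using large mult_nonneg_nonneg[OF P_boundary_nonneg exp_ge_zero[of "k 0"]] by linarith
  show "x \<in> \<Omega>"
  proof (rule ccontr)
    assume "x \<notin> \<Omega>"
    then have "x \<in> frontier \<Omega>" using x(1) by (simp add: closure_cases)
    then have "weighted_P k a R x = P_boundary * exp (k 0) * paraboloid a R x powr p"
      by (simp add: weighted_P_def P_closure_frontier u_boundary)
    also have "\<dots> \<le> P_boundary * exp (k 0) * 1"
      using P_boundary_nonneg \<rho> p_gt_1 by (intro mult_left_mono powr_le1) auto
    finally show False using large by simp
  qed
  then show "P_function x > 0"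
    using pos by (simp add: weighted_P_def P_closure_eq zero_less_mult_iff powr_ge_zero not_less[symmetric])
  have "paraboloid a R x \<noteq> 0" using pos by (auto simp: weighted_P_def)
  then show "norm (x - a) < R" using \<rho> paraboloid_pos_iff[OF \<open>R > 0\<close>, of a x] by linarith
qed

lemma weighted_P_max_interior:
  assumes x0: "x0 \<in> \<Omega>" and "R > 0" and k: "continuous_on UNIV k" "k (u x0) \<ge> 0"
    and large: "P_boundary * exp (k 0) < P_function x0"
  obtains x where "x \<in> \<Omega>" "norm (x - x0) < R" "P_function x > 0"
    "P_function x0 \<le> P_function x * paraboloid x0 R x powr p * exp (k (u x))"
    "\<forall>\<^sub>F y in nhds x. ln (P_function y) + (k (u y) + p * ln (paraboloid x0 R y))
      \<le> ln (P_function x) + (k (u x) + p * ln (paraboloid x0 R x))"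
proof -
  define \<Phi> where "\<Phi> = weighted_P k x0 R"
  define D where "D = closure \<Omega> \<inter> cball x0 R"
  have "compact D" "x0 \<in> D" using x0 \<open>R > 0\<close> closure_subset by (auto simp: D_def closed_Int_compact)
  moreover have "continuous_on D \<Phi>" unfolding D_def \<Phi>_def by (rule weighted_P_continuous[OF \<open>R > 0\<close> k(1)])
  ultimately obtain x where x: "x \<in> D" "\<And>y. y \<in> D \<Longrightarrow> \<Phi> y \<le> \<Phi> x"
    using continuous_attains_sup[of D \<Phi>] by blast
  have "P_function x0 > 0"
    using large mult_nonneg_nonneg[OF P_boundary_nonneg exp_ge_zero[of "k 0"]] by linarith
  then have "P_function x0 * 1 \<le> P_function x0 * exp (k (u x0))"
    using k(2) by (intro mult_left_mono) auto
  also have "\<dots> = \<Phi> x0" using x0 by (simp add: \<Phi>_def weighted_P_def paraboloid_def P_closure_eq)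
  also have "\<dots> \<le> \<Phi> x" by (rule x(2)[OF \<open>x0 \<in> D\<close>])
  finally have \<Phi>x: "P_function x0 \<le> \<Phi> x" by simp
  have interior: "x \<in> \<Omega>" "norm (x - x0) < R" "P_function x > 0"
    using weighted_P_large_interior[OF \<open>R > 0\<close>, of x x0 k] x(1) large \<Phi>x
    by (auto simp: D_def \<Phi>_def dist_norm norm_minus_commute)
  have "open (\<Omega> \<inter> P_function -` {0<..} \<inter> ball x0 R)"
    by (intro open_Int continuous_open_preimage[OF P_function_continuous open_domain]) auto
  moreover have "x \<in> \<Omega> \<inter> P_function -` {0<..} \<inter> ball x0 R"
    using interior by (simp add: dist_norm norm_minus_commute)
  ultimately have "\<forall>\<^sub>F y in nhds x. y \<in> \<Omega> \<inter> P_function -` {0<..} \<inter> ball x0 R"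
    by (rule eventually_nhds_in_open)
  then have "\<forall>\<^sub>F y in nhds x. ln (P_function y) + (k (u y) + p * ln (paraboloid x0 R y))
      \<le> ln (P_function x) + (k (u x) + p * ln (paraboloid x0 R x))"
  proof eventually_elim
    case (elim y)
    then have y: "y \<in> \<Omega>" "P_function y > 0" "norm (y - x0) < R" by (auto simp: dist_norm norm_minus_commute)
    have "\<Phi> y \<le> \<Phi> x" using elim closure_subset[of \<Omega>] by (intro x(2)) (auto simp: D_def)
    then have "ln (\<Phi> y) \<le> ln (\<Phi> x)" using ln_weighted_P(1)[OF \<open>R > 0\<close> y] ln_weighted_P(1)[OF \<open>R > 0\<close> interior(1,3,2)]
      by (simp add: \<Phi>_def)
    then show ?case
      unfolding \<Phi>_def ln_weighted_P(2)[OF \<open>R > 0\<close> y] ln_weighted_P(2)[OF \<open>R > 0\<close> interior(1,3,2)] .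
  qed
  then show thesis
    using that[OF interior] \<Phi>x by (simp add: \<Phi>_def weighted_P_def P_closure_eq[OF interior(1)])
qed

end

lemma le_if_quadratic_le_linear:
  fixes X :: real
  assumes "\<theta> > 0" "C0 \<ge> 0" "C1 \<ge> 0" "\<theta> * X\<^sup>2 \<le> C0 + C1 * X"
  shows "X \<le> 1 + (C0 + C1) / \<theta>"
proof (cases "X \<le> 1")
  case True
  moreover have "(C0 + C1) / \<theta> \<ge> 0" using assms by simp
  ultimately show ?thesis by linarith
next
  case False
  then have "C0 * 1 \<le> C0 * X" using assms by (intro mult_left_mono) auto
  then have "(\<theta> * X) * X \<le> (C0 + C1) * X" using assms(4) by (simp add: power2_eq_square algebra_simps)
  then have "\<theta> * X \<le> C0 + C1" using False by simp
  then show ?thesis using assms(1) by (simp add: field_simps)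
qed

lemma ex_exp_factor_less:
  fixes a b \<delta> :: real
  assumes "a < b" "\<delta> > 0"
  obtains \<epsilon> where "\<epsilon> > 0" "\<epsilon> < \<delta>" "a * exp \<epsilon> < b"
proof -
  have "((\<lambda>\<epsilon>. a * exp \<epsilon>) \<longlongrightarrow> a * exp 0) (at_right 0)" by (intro tendsto_intros)
  then have "\<forall>\<^sub>F \<epsilon> in at_right 0. a * exp \<epsilon> < b"
    by (rule order_tendstoD(2)) (use assms in simp)
  moreover have "\<forall>\<^sub>F \<epsilon> in at_right 0. \<epsilon> \<in> {0<..<\<delta>}" by (rule eventually_at_right_real[OF assms(2)])
  ultimately have "\<forall>\<^sub>F \<epsilon> in at_right 0. 0 < \<epsilon> \<and> \<epsilon> < \<delta> \<and> a * exp \<epsilon> < b" by eventually_elim auto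
  then show thesis using that eventually_happens'[OF trivial_limit_at_right_real] by blast
qed

lemma ex_cutoff_parameters:
  fixes a b c m \<Lambda> B :: real
  assumes "m > 0" "\<Lambda> > 0" "c \<ge> 0" "B > 0" "0 \<le> a" "a < b"
  obtains K \<eta> where "K \<ge> 1" "K * m \<ge> 2 * c" "\<eta> > 0" "a * exp (\<eta> * exp (K * 0)) < b"
    "\<And>s. s \<le> B \<Longrightarrow> \<eta> * exp (K * s) \<le> m / (8 * \<Lambda>)" "\<And>s. s \<le> B \<Longrightarrow> exp (\<eta> * exp (K * s)) \<le> 2"
proof -
  obtain \<epsilon> where \<epsilon>: "\<epsilon> > 0" "\<epsilon> < ln 2" "\<epsilon> < m / (8 * \<Lambda>)" "a * exp \<epsilon> < b"
    using ex_exp_factor_less[OF assms(6), of "min (ln 2) (m / (8 * \<Lambda>))"] assms by auto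
  define K where "K = 1 + 2 * c / m"
  have K: "K \<ge> 1" "K * m \<ge> 2 * c" using assms by (simp_all add: K_def distrib_right)
  define \<eta> where "\<eta> = \<epsilon> * exp (- K * B)"
  have \<eta>_le: "\<eta> * exp (K * s) \<le> \<epsilon>" if "s \<le> B" for s
  proof -
    have "\<eta> * exp (K * s) = \<epsilon> * exp (K * (s - B))" by (simp add: \<eta>_def mult_exp_exp algebra_simps)
    also have "\<dots> \<le> \<epsilon> * 1" using \<epsilon> K that by (intro mult_left_mono) (auto simp: mult_nonneg_nonpos)
    finally show ?thesis by simp
  qed
  show thesis
  proof (rule that[OF K])
    show "\<eta> > 0" using \<epsilon> by (simp add: \<eta>_def)
    have "a * exp (\<eta> * exp (K * 0)) \<le> a * exp \<epsilon>"
      using \<eta>_le[of 0] assms by (intro mult_left_mono) auto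
    then show "a * exp (\<eta> * exp (K * 0)) < b" using \<epsilon>(4) by linarith
    fix s assume "s \<le> B"
    note at_s = \<eta>_le[OF this]
    show "\<eta> * exp (K * s) \<le> m / (8 * \<Lambda>)" using at_s \<epsilon>(3) by linarith
    have "exp (\<eta> * exp (K * s)) \<le> exp (ln 2)" using at_s \<epsilon>(2) by (subst exp_le_cancel_iff) linarith
    then show "exp (\<eta> * exp (K * s)) \<le> 2" by simp
  qed
qed

context overdetermined_problem
begin

text \<open>The cutoff radius is bounded, because the estimate at the maximum point is quadratic in \<open>R\<close> on the
  left and linear on the right.\<close>
lemma cutoff_radius_le:
  assumes "R > 0" and x: "x \<in> \<Omega>" "norm (x - x0) < R" "P_function x > 0" "\<bar>f (u x)\<bar> \<le> M"
    and w: "w > 0" "w \<le> norm (grad u x) powr p * paraboloid x0 R x powr p"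
    and K: "K \<ge> 1" "K * min 1 (p - 1) \<ge> 2 * ((p - 1) * M / w)"
    and \<eta>: "\<eta> > 0" "\<eta> * exp (K * u x) \<le> min 1 (p - 1) / (8 * (CARD('n) + p - 2))"
    and max: "\<forall>\<^sub>F y in nhds x. ln (P_function y) + (\<eta> * exp (K * u y) + p * ln (paraboloid x0 R y))
      \<le> ln (P_function x) + (\<eta> * exp (K * u x) + p * ln (paraboloid x0 R x))"
  defines "\<Lambda> \<equiv> CARD('n) + p - 2"
  shows "R * w powr (1 / p) \<le> 1 + (8 * \<Lambda> * p\<^sup>2 + 6 * p * \<Lambda> + 2 * p * (p * M / w)) / (min 1 (p - 1) / 4 * \<eta>)"
proof -
  have reg: "x \<in> regular_set" by (rule regular_if_P_pos[OF x(1,3)])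
  have "\<Lambda> > 0" using m_le_Lambda[OF reg] m_pos by (simp add: \<Lambda>_def)
  have "M \<ge> 0" using x(4) by linarith
  define \<rho> where "\<rho> = paraboloid x0 R x"
  have \<rho>: "0 < \<rho>" "\<rho> \<le> 1"
    using paraboloid_bounds[OF \<open>R > 0\<close>, of x x0] paraboloid_pos_iff[OF \<open>R > 0\<close>, of x0 x] x(2) by (auto simp: \<rho>_def)
  have "norm (grad u x) powr p * \<rho> powr p \<le> norm (grad u x) powr p * 1"
    using \<rho> p_gt_1 by (intro mult_left_mono powr_le1) auto
  then have w_le: "w \<le> norm (grad u x) powr p" using w(2) by (simp add: \<rho>_def)
  obtain l where l: "operator_at u x (grad u x) l" "l \<ge> - ((p - 1) * M / w) * (norm (grad u x))\<^sup>2"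
    using operator_at_u_ge[OF reg x(4) w(1) w_le] by blast
  obtain GP lP where lP: "operator_at P_function x GP lP" "lP \<ge> 0"
    using subsolution_at_P[OF reg] unfolding subsolution_at_def by blast
  define D where "D = R\<^sup>2 - (norm (x - x0))\<^sup>2"
  have D: "D = \<rho> * R\<^sup>2" "D > 0"
    using \<open>R > 0\<close> \<rho>(1) by (simp_all add: D_def \<rho>_def paraboloid_def power2_norm_eq_inner field_simps)
  define X where "X = norm (grad u x) * (D / R)"
  have X: "X = R * (\<rho> * norm (grad u x))" using \<open>R > 0\<close> by (simp add: X_def D(1) power2_eq_square)
  have "min 1 (p - 1) / 4 * \<eta> * (norm (grad u x))\<^sup>2 \<le> (8 * \<Lambda> * p\<^sup>2 + 6 * p * \<Lambda>) * (R / D)\<^sup>2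
      + 2 * p * (p * M / w) * (norm (grad u x) * (R / D))"
    unfolding \<Lambda>_def D_def
    by (rule cutoff_max_estimate[OF reg lP x(3,2) _ l _ drift_le[OF x(4) w(1) w_le] K \<eta> max[unfolded paraboloid_def]])
       (use p_gt_1 u_pos[OF x(1)] in auto)
  then have "min 1 (p - 1) / 4 * \<eta> * (norm (grad u x))\<^sup>2 * (D / R)\<^sup>2 \<le> ((8 * \<Lambda> * p\<^sup>2 + 6 * p * \<Lambda>) * (R / D)\<^sup>2
      + 2 * p * (p * M / w) * (norm (grad u x) * (R / D))) * (D / R)\<^sup>2"
    by (intro mult_right_mono) auto
  also have "\<dots> = 8 * \<Lambda> * p\<^sup>2 + 6 * p * \<Lambda> + 2 * p * (p * M / w) * X"
    using D(2) \<open>R > 0\<close> by (simp add: X_def field_simps power2_eq_square)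
  finally have "min 1 (p - 1) / 4 * \<eta> * X\<^sup>2 \<le> 8 * \<Lambda> * p\<^sup>2 + 6 * p * \<Lambda> + 2 * p * (p * M / w) * X"
    by (simp add: X_def power_mult_distrib power_divide mult.assoc)
  then have "X \<le> 1 + (8 * \<Lambda> * p\<^sup>2 + 6 * p * \<Lambda> + 2 * p * (p * M / w)) / (min 1 (p - 1) / 4 * \<eta>)"
    using m_pos \<eta>(1) p_gt_1 \<open>\<Lambda> > 0\<close> \<open>M \<ge> 0\<close> w(1) by (intro le_if_quadratic_le_linear) auto
  moreover have "w powr (1 / p) \<le> \<rho> * norm (grad u x)"
  proof -
    have "w \<le> (\<rho> * norm (grad u x)) powr p" using w(2) \<rho> by (simp add: powr_mult \<rho>_def mult.commute)
    then have "w powr (1 / p) \<le> ((\<rho> * norm (grad u x)) powr p) powr (1 / p)"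
      using w(1) p_gt_1 by (intro powr_mono2) auto
    then show ?thesis using \<rho> p_gt_1 by (simp add: powr_powr)
  qed
  then have "R * w powr (1 / p) \<le> X" unfolding X using \<open>R > 0\<close> by (intro mult_left_mono) auto
  ultimately show ?thesis by linarith
qed

theorem P_le_boundary:
  assumes "x0 \<in> \<Omega>"
  shows "P_function x0 \<le> P_boundary"
proof (rule ccontr)
  assume "\<not> P_function x0 \<le> P_boundary"
  then have large_at_x0: "P_function x0 > P_boundary" "P_function x0 > 0" using P_boundary_nonneg by auto
  then have "x0 \<in> regular_set" using regular_if_P_pos[OF assms] by blast
  define \<Lambda> where "\<Lambda> = CARD('n) + p - 2"
  define m where "m = min 1 (p - 1)"
  have m: "m > 0" "\<Lambda> > 0" using m_pos m_le_Lambda[OF \<open>x0 \<in> regular_set\<close>] by (auto simp: m_def \<Lambda>_def)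
  obtain M where M: "M \<ge> 0" "\<And>x. x \<in> \<Omega> \<Longrightarrow> \<bar>f (u x)\<bar> \<le> M" by (rule f_u_bounded) blast
  obtain B where B: "B > 0" "\<And>x. x \<in> \<Omega> \<Longrightarrow> u x \<le> B"
    using u_bounded unfolding bounded_pos by (metis abs_le_D1 imageI real_norm_def)
  define w where "w = P_function x0 / 2"
  have "w > 0" using large_at_x0 by (simp add: w_def)
  have "0 \<le> (p - 1) * M / w" using M p_gt_1 \<open>w > 0\<close> by simp
  from ex_cutoff_parameters[OF m this B(1) P_boundary_nonneg large_at_x0(1)]
  obtain K \<eta> where K: "K \<ge> 1" "K * m \<ge> 2 * ((p - 1) * M / w)" and "\<eta> > 0"
    and large: "P_boundary * exp (\<eta> * exp (K * 0)) < P_function x0"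
    and \<eta>: "\<And>s. s \<le> B \<Longrightarrow> \<eta> * exp (K * s) \<le> m / (8 * \<Lambda>)" "\<And>s. s \<le> B \<Longrightarrow> exp (\<eta> * exp (K * s)) \<le> 2"
    by metis
  define C where "C = 1 + (8 * \<Lambda> * p\<^sup>2 + 6 * p * \<Lambda> + 2 * p * (p * M / w)) / (m / 4 * \<eta>)"
  have "C > 0"
    unfolding C_def using m M p_gt_1 \<open>w > 0\<close> \<open>\<eta> > 0\<close> by (intro add_pos_nonneg divide_nonneg_nonneg add_nonneg_nonneg) auto
  define R where "R = C / w powr (1 / p) + 1"
  have "R > 0" using \<open>C > 0\<close> by (simp add: R_def add_nonneg_pos)
  obtain x where x: "x \<in> \<Omega>" "norm (x - x0) < R" "P_function x > 0"
    "P_function x0 \<le> P_function x * paraboloid x0 R x powr p * exp (\<eta> * exp (K * u x))"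
    "\<forall>\<^sub>F y in nhds x. ln (P_function y) + (\<eta> * exp (K * u y) + p * ln (paraboloid x0 R y))
      \<le> ln (P_function x) + (\<eta> * exp (K * u x) + p * ln (paraboloid x0 R x))"
  proof (rule weighted_P_max_interior[where k="\<lambda>s. \<eta> * exp (K * s)", OF assms \<open>R > 0\<close> _ _ large])
    show "continuous_on UNIV (\<lambda>s. \<eta> * exp (K * s))" by (intro continuous_intros)
    show "0 \<le> \<eta> * exp (K * u x0)" using \<open>\<eta> > 0\<close> by simp
  qed
  have "w \<le> norm (grad u x) powr p * paraboloid x0 R x powr p"
  proof -
    have "exp (\<eta> * exp (K * u x)) \<le> 2" by (rule \<eta>(2)[OF B(2)[OF x(1)]])
    then have "P_function x * paraboloid x0 R x powr p * exp (\<eta> * exp (K * u x))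
        \<le> norm (grad u x) powr p * paraboloid x0 R x powr p * 2"
      using P_le_grad_powr[of x] x(3) by (intro mult_mono) auto
    then show ?thesis using x(4) by (simp add: w_def)
  qed
  from cutoff_radius_le[OF \<open>R > 0\<close> x(1-3) M(2)[OF x(1)] \<open>w > 0\<close> this K[unfolded m_def] \<open>\<eta> > 0\<close> _ x(5)]
  have "R * w powr (1 / p) \<le> C"
    using \<eta>(1)[OF B(2)[OF x(1)]] by (simp add: C_def m_def \<Lambda>_def)
  moreover have "R * w powr (1 / p) = C + w powr (1 / p)" using \<open>w > 0\<close> by (simp add: R_def distrib_right)
  ultimately show False using \<open>w > 0\<close> by simp
qed

end

section \<open>Rigidity\<close>

lemma frontier_at_segment_end:
  fixes x v :: "'a::real_normed_vector"
  assumes "open \<Omega>" "a < t" and inside: "\<And>s. a < s \<Longrightarrow> s < t \<Longrightarrow> x + s *\<^sub>R v \<in> \<Omega>" and "x + t *\<^sub>R v \<notin> \<Omega>"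
  shows "x + t *\<^sub>R v \<in> frontier \<Omega>"
proof -
  have "x + t *\<^sub>R v \<in> closure \<Omega>"
  proof (rule Lim_in_closed_set[OF closed_closure])
    show "((\<lambda>s. x + s *\<^sub>R v) \<longlongrightarrow> x + t *\<^sub>R v) (at_left t)" by (intro tendsto_intros)
    show "\<forall>\<^sub>F s in at_left t. x + s *\<^sub>R v \<in> closure \<Omega>"
      using eventually_at_left_real[OF \<open>a < t\<close>] by eventually_elim (simp add: inside subsetD[OF closure_subset])
  qed simp
  then show ?thesis using assms(1,4) by (simp add: frontier_def interior_open)
qed

lemma segment_exit_point:
  fixes \<Omega> :: "'a::real_normed_vector set"
  assumes "open \<Omega>" "x \<in> \<Omega>" "x + v \<notin> \<Omega>"
  obtains t where "t > 0" "x + t *\<^sub>R v \<in> frontier \<Omega>" "\<And>s. 0 \<le> s \<Longrightarrow> s < t \<Longrightarrow> x + s *\<^sub>R v \<in> \<Omega>"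
proof -
  define N where "N = {0..1} \<inter> (\<lambda>t. x + t *\<^sub>R v) -` (- \<Omega>)"
  have "closed N" unfolding N_def
    by (intro continuous_closed_preimage continuous_intros) (use assms(1) in auto)
  moreover have "bounded N" unfolding N_def by (rule bounded_subset[of "{0..1}"]) auto
  ultimately have "compact N" by (simp add: compact_eq_bounded_closed)
  moreover have "1 \<in> N" using assms(3) by (simp add: N_def)
  ultimately obtain t where t: "t \<in> N" "\<And>s. s \<in> N \<Longrightarrow> t \<le> s"
    using compact_attains_inf[of N] by blast
  have "t \<noteq> 0" using t(1) assms(2) by (auto simp: N_def)
  then have "t > 0" using t(1) by (simp add: N_def)
  have inside: "x + s *\<^sub>R v \<in> \<Omega>" if "0 \<le> s" "s < t" for s
    using t that by (force simp: N_def)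
  have "x + t *\<^sub>R v \<in> frontier \<Omega>"
    using frontier_at_segment_end[OF assms(1) \<open>t > 0\<close>] inside t(1) by (simp add: N_def)
  with \<open>t > 0\<close> inside show thesis using that by blast
qed

lemma increasing_along_nonneg_directions:
  fixes a :: "'a::real_inner"
  assumes der: "\<And>x. x \<in> \<Omega> \<Longrightarrow> (u has_derivative (\<lambda>h. r x * (a \<bullet> h))) (at x)" and r: "\<And>x. x \<in> \<Omega> \<Longrightarrow> r x \<ge> 0"
    and v: "a \<bullet> v \<ge> 0" and segment: "\<And>s. 0 \<le> s \<Longrightarrow> s \<le> t \<Longrightarrow> x + s *\<^sub>R v \<in> \<Omega>" and "t > 0"
  shows "u x \<le> u (x + t *\<^sub>R v)"
proof -
  obtain s where s: "0 < s" "s < t" "u (x + t *\<^sub>R v) - u x = t * (r (x + s *\<^sub>R v) * (a \<bullet> v))"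
  proof (rule mvt_along_line[OF \<open>t > 0\<close>, of u x v "\<lambda>y. r y * (a \<bullet> v)"])
    fix s assume "0 \<le> s" "s \<le> t"
    then show "((\<lambda>k. u (x + s *\<^sub>R v + k *\<^sub>R v)) has_real_derivative r (x + s *\<^sub>R v) * (a \<bullet> v)) (at 0)"
      by (rule has_derivative_direction[OF der[OF segment]])
  qed
  moreover have "t * (r (x + s *\<^sub>R v) * (a \<bullet> v)) \<ge> 0"
    using v \<open>t > 0\<close> r[OF segment[of s]] s(1,2) by simp
  ultimately show ?thesis by linarith
qed

lemma invariant_under_nonneg_translations:
  fixes a :: "'a::real_inner"
  assumes "open \<Omega>"
    and der: "\<And>x. x \<in> \<Omega> \<Longrightarrow> (u has_derivative (\<lambda>h. r x * (a \<bullet> h))) (at x)" "\<And>x. x \<in> \<Omega> \<Longrightarrow> r x \<ge> 0"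
    and cont: "continuous_on (closure \<Omega>) u" and pos: "\<And>x. x \<in> \<Omega> \<Longrightarrow> u x > 0"
    and zero: "\<And>q. q \<in> frontier \<Omega> \<Longrightarrow> u q = 0" and x: "x \<in> \<Omega>" and v: "a \<bullet> v \<ge> 0"
  shows "x + v \<in> \<Omega>"
proof (rule ccontr)
  assume "x + v \<notin> \<Omega>"
  then obtain t where t: "t > 0" "x + t *\<^sub>R v \<in> frontier \<Omega>" "\<And>s. 0 \<le> s \<Longrightarrow> s < t \<Longrightarrow> x + s *\<^sub>R v \<in> \<Omega>"
    using segment_exit_point[OF \<open>open \<Omega>\<close> x] by blast
  have left: "\<forall>\<^sub>F s in at_left t. s \<in> {0<..<t}" by (rule eventually_at_left_real[OF t(1)])
  have "((\<lambda>s. u (x + s *\<^sub>R v)) \<longlongrightarrow> u (x + t *\<^sub>R v)) (at_left t)"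
  proof (rule continuous_on_tendsto_compose[OF cont])
    show "((\<lambda>s. x + s *\<^sub>R v) \<longlongrightarrow> x + t *\<^sub>R v) (at_left t)" by (intro tendsto_intros)
    show "\<forall>\<^sub>F s in at_left t. x + s *\<^sub>R v \<in> closure \<Omega>"
      using left by eventually_elim (simp add: t(3) subsetD[OF closure_subset])
    show "x + t *\<^sub>R v \<in> closure \<Omega>" using t(2) by (simp add: frontier_def)
  qed
  moreover have "\<forall>\<^sub>F s in at_left t. u x \<le> u (x + s *\<^sub>R v)"
    using left
  proof eventually_elim
    case (elim s)
    then show ?case by (intro increasing_along_nonneg_directions[OF der v]) (auto intro: t(3))
  qed
  ultimately have "u x \<le> u (x + t *\<^sub>R v)" by (rule tendsto_lowerbound) simp
  then show False using zero[OF t(2)] pos[OF x] by simp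
qed

lemma half_space_if_translation_invariant:
  fixes a q :: "'a::real_inner"
  assumes "open \<Omega>" and invariant: "\<And>x v. x \<in> \<Omega> \<Longrightarrow> a \<bullet> v \<ge> 0 \<Longrightarrow> x + v \<in> \<Omega>" and q: "q \<in> frontier \<Omega>"
  shows "\<Omega> = {x. a \<bullet> (x - q) > 0}"
proof (intro set_eqI iffI; clarsimp)
  fix x assume x: "x \<in> \<Omega>"
  show "a \<bullet> (x - q) > 0"
  proof (rule ccontr)
    assume "\<not> a \<bullet> (x - q) > 0"
    then have "a \<bullet> (q - x) \<ge> 0" by (simp add: inner_diff_right)
    from invariant[OF x this] q \<open>open \<Omega>\<close> show False by (simp add: frontier_def interior_open)
  qed
next
  fix x assume x: "a \<bullet> (x - q) > 0"
  have "open {y. a \<bullet> (x - y) > 0}"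
    by (intro open_Collect_less continuous_intros)
  moreover have "{y. a \<bullet> (x - y) > 0} \<inter> closure \<Omega> \<noteq> {}" using q x by (auto simp: frontier_def)
  ultimately obtain y where "y \<in> \<Omega>" "a \<bullet> (x - y) > 0" using open_Int_closure_eq_empty by blast
  then show "x \<in> \<Omega>" using invariant[of y "x - y"] by simp
qed

lemma parallel_solI:
  fixes \<Omega> :: "(real^'n) set"
  assumes "open \<Omega>" and a: "norm a = 1"
    and der: "\<And>x. x \<in> \<Omega> \<Longrightarrow> (u has_derivative (\<lambda>h. r x * (a \<bullet> h))) (at x)" "\<And>x. x \<in> \<Omega> \<Longrightarrow> r x \<ge> 0"
    and "continuous_on (closure \<Omega>) u" and "\<And>x. x \<in> \<Omega> \<Longrightarrow> u x > 0"
    and "\<And>q. q \<in> frontier \<Omega> \<Longrightarrow> u q = 0" and q: "q \<in> frontier \<Omega>"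
  shows "parallel_sol \<Omega> u"
proof -
  have invariant: "x + v \<in> \<Omega>" if "x \<in> \<Omega>" "a \<bullet> v \<ge> 0" for x v
    using invariant_under_nonneg_translations[OF \<open>open \<Omega>\<close> der assms(5-7)] that by blast
  have incr: "u x \<le> u (x + v)" if "x \<in> \<Omega>" "a \<bullet> v \<ge> 0" for x v
    using increasing_along_nonneg_directions[OF der that(2), where t=1 and x=x] invariant[OF that(1)] that(2) by simp
  have orth: "u (x + v) = u x" if "x \<in> \<Omega>" "a \<bullet> v = 0" for x v
    using incr[of x v] incr[of "x + v" "- v"] invariant[of x v] that by simp
  have "u x = u (q + (a \<bullet> (x - q)) *\<^sub>R a)" if x: "x \<in> \<Omega>" for x
  proof -
    have "a \<bullet> (q + (a \<bullet> (x - q)) *\<^sub>R a - x) = 0"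
      using a by (simp add: inner_diff_right inner_add_right norm_eq_1)
    from orth[OF x this] show ?thesis by simp
  qed
  then show ?thesis unfolding parallel_sol_def
    using half_space_if_translation_invariant[OF \<open>open \<Omega>\<close> invariant q]
    by (intro exI[of _ q] exI[of _ a] exI[of _ "\<lambda>s. u (q + s *\<^sub>R a)"]) auto
qed

lemma quadratic_bound_if_derivative_vanishes:
  fixes F f :: "real \<Rightarrow> real"
  assumes F: "\<And>s. (F has_real_derivative f s) (at s)" and "f differentiable (at a)" "F a = 0" "f a = 0"
  obtains C \<delta> where "C > 0" "\<delta> > 0" "\<And>s. \<bar>s - a\<bar> < \<delta> \<Longrightarrow> \<bar>F s\<bar> \<le> C * (s - a)\<^sup>2"
proof -
  obtain \<psi> where \<psi>: "isCont \<psi> a" "\<And>s. f s = \<psi> s * (s - a)"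
    using assms(2,4) by (auto simp: real_differentiable_def CARAT_DERIV)
  define C where "C = \<bar>\<psi> a\<bar> + 1"
  have "C > 0" by (simp add: C_def add_nonneg_pos)
  obtain \<delta> where \<delta>: "\<delta> > 0" "\<And>s. \<bar>s - a\<bar> < \<delta> \<Longrightarrow> \<bar>\<psi> s - \<psi> a\<bar> < 1"
    using \<psi>(1) unfolding continuous_at_eps_delta dist_real_def by (metis zero_less_one)
  have f_le: "\<bar>f s\<bar> \<le> C * \<bar>s - a\<bar>" if "\<bar>s - a\<bar> < \<delta>" for s
  proof -
    have "\<bar>\<psi> s\<bar> \<le> C" using \<delta>(2)[OF that] by (simp add: C_def)
    then show ?thesis unfolding \<psi>(2)[of s] abs_mult by (intro mult_right_mono) auto
  qed
  have "\<bar>F s\<bar> \<le> C * (s - a)\<^sup>2" if s: "\<bar>s - a\<bar> < \<delta>" for s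
  proof -
    have "norm (F s - F a) \<le> C * \<bar>s - a\<bar> * norm (s - a)"
    proof (rule field_differentiable_bound[where S="closed_segment a s" and f'=f])
      fix t assume "t \<in> closed_segment a s"
      then have t: "\<bar>t - a\<bar> \<le> \<bar>s - a\<bar>" by (auto simp: closed_segment_eq_real_ivl split: if_splits)
      have "\<bar>f t\<bar> \<le> C * \<bar>t - a\<bar>" using t s by (intro f_le) auto
      also have "\<dots> \<le> C * \<bar>s - a\<bar>" using t \<open>C > 0\<close> by (intro mult_left_mono) auto
      finally show "norm (f t) \<le> C * \<bar>s - a\<bar>" by simp
    qed (auto intro!: has_field_derivative_at_within[OF F])
    then show ?thesis by (simp add: \<open>F a = 0\<close> power2_eq_square mult.assoc flip: abs_mult)
  qed
  then show thesis using that[OF \<open>C > 0\<close> \<delta>(1)] by blast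
qed

text \<open>Where \<open>\<bar>\<nabla>u\<bar> \<le> C \<bar>u - c\<bar>\<close>, the mean value theorem on a ball of radius \<open>1 / (2 C)\<close> forces \<open>u = c\<close>.\<close>
lemma open_level_set_if_gradient_le:
  fixes u :: "'a::euclidean_space \<Rightarrow> real"
  assumes "open \<Omega>" and der: "\<And>x. x \<in> \<Omega> \<Longrightarrow> (u has_derivative (\<lambda>h. g x \<bullet> h)) (at x)"
    and "C > 0" "\<delta> > 0" and grad_le: "\<And>x. x \<in> \<Omega> \<Longrightarrow> \<bar>u x - c\<bar> < \<delta> \<Longrightarrow> norm (g x) \<le> C * \<bar>u x - c\<bar>"
  shows "open {x\<in>\<Omega>. u x = c}"
proof (subst open_contains_cball, intro ballI)
  fix z assume z: "z \<in> {x\<in>\<Omega>. u x = c}"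
  have u: "continuous_on \<Omega> u"
    using der by (intro continuous_at_imp_continuous_on) (blast intro: has_derivative_continuous)
  have "open (\<Omega> \<inter> (\<lambda>x. \<bar>u x - c\<bar>) -` {..<\<delta>})"
    using \<open>open \<Omega>\<close> u by (intro continuous_open_preimage continuous_intros) auto
  moreover have "z \<in> \<Omega> \<inter> (\<lambda>x. \<bar>u x - c\<bar>) -` {..<\<delta>}" using z \<open>\<delta> > 0\<close> by auto
  ultimately obtain r0 where r0: "r0 > 0" "cball z r0 \<subseteq> \<Omega> \<inter> (\<lambda>x. \<bar>u x - c\<bar>) -` {..<\<delta>}"
    using open_contains_cball by blast
  define r where "r = min r0 (1 / (2 * C))"
  have r: "r > 0" "C * r \<le> 1 / 2"
    using r0(1) \<open>C > 0\<close> mult_left_mono[of r "1 / (2 * C)" C] by (auto simp: r_def)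
  have ball: "x \<in> \<Omega>" "\<bar>u x - c\<bar> < \<delta>" if "x \<in> cball z r" for x
    using r0(2) that by (auto simp: r_def)
  have "continuous_on (cball z r) (\<lambda>x. \<bar>u x - c\<bar>)"
    using ball by (intro continuous_intros continuous_on_subset[OF u]) auto
  then obtain y where y: "y \<in> cball z r" "\<And>x. x \<in> cball z r \<Longrightarrow> \<bar>u x - c\<bar> \<le> \<bar>u y - c\<bar>"
    using continuous_attains_sup[of "cball z r" "\<lambda>x. \<bar>u x - c\<bar>"] r(1) by auto
  have "norm (u y - u z) \<le> C * \<bar>u y - c\<bar> * norm (y - z)"
  proof (rule differentiable_bound[of "cball z r" u "\<lambda>x h. g x \<bullet> h"])
    fix x assume x: "x \<in> cball z r"
    show "(u has_derivative (\<lambda>h. g x \<bullet> h)) (at x within cball z r)"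
      by (rule has_derivative_at_withinI[OF der[OF ball(1)[OF x]]])
    have "onorm (\<lambda>h. g x \<bullet> h) \<le> norm (g x)"
      by (rule onorm_le) (simp add: Cauchy_Schwarz_ineq2)
    also have "\<dots> \<le> C * \<bar>u x - c\<bar>" by (rule grad_le[OF ball[OF x]])
    also have "\<dots> \<le> C * \<bar>u y - c\<bar>" using y(2)[OF x] \<open>C > 0\<close> by (intro mult_left_mono) auto
    finally show "onorm (\<lambda>h. g x \<bullet> h) \<le> C * \<bar>u y - c\<bar>" .
  qed (use y r in auto)
  also have "\<dots> \<le> C * \<bar>u y - c\<bar> * r"
    using y(1) \<open>C > 0\<close> by (intro mult_left_mono) (auto simp: dist_norm norm_minus_commute)
  also have "\<dots> \<le> 1 / 2 * \<bar>u y - c\<bar>"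
    using mult_right_mono[OF r(2), of "\<bar>u y - c\<bar>"] by (simp add: mult_ac)
  finally have "\<bar>u y - c\<bar> = 0" using z by simp
  then have "cball z r \<subseteq> {x\<in>\<Omega>. u x = c}" using y(2) ball(1) by force
  then show "\<exists>e>0. cball z e \<subseteq> {x\<in>\<Omega>. u x = c}" using r(1) by blast
qed

context overdetermined_problem
begin

lemma F_growth_at_zero:
  assumes "F s0 = 0"
  obtains C \<delta> where "C > 0" "\<delta> > 0" "\<And>s. \<bar>s - s0\<bar> < \<delta> \<Longrightarrow> \<bar>F s\<bar> \<le> C * \<bar>s - s0\<bar> powr p"
proof (cases "p > 2")
  case True
  obtain C where C: "C > 0" "\<forall>\<^sub>F s in at s0. norm (F s) \<le> C * norm (\<bar>s - s0\<bar> powr p)"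
    using F_degenerate[OF True assms] by (rule landau_o.bigE)
  then obtain \<delta> where \<delta>: "\<delta> > 0" "\<And>s. s \<noteq> s0 \<Longrightarrow> \<bar>s - s0\<bar> < \<delta> \<Longrightarrow> \<bar>F s\<bar> \<le> C * \<bar>s - s0\<bar> powr p"
    unfolding eventually_at by (auto simp: dist_real_def)
  have "\<bar>F s\<bar> \<le> C * \<bar>s - s0\<bar> powr p" if "\<bar>s - s0\<bar> < \<delta>" for s
    using \<delta>(2)[of s] that assms by (cases "s = s0") auto
  then show thesis using that[OF C(1) \<delta>(1)] by blast
next
  case False
  have "f s0 = 0" using DERIV_local_max[OF F_derivative[of s0], of 1] F_nonpos assms by simp
  then obtain C \<delta> where C: "C > 0" "\<delta> > 0" "\<And>s. \<bar>s - s0\<bar> < \<delta> \<Longrightarrow> \<bar>F s\<bar> \<le> C * (s - s0)\<^sup>2"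
    using quadratic_bound_if_derivative_vanishes[OF F_derivative f_differentiable assms] by blast
  have "\<bar>F s\<bar> \<le> C * \<bar>s - s0\<bar> powr p" if s: "\<bar>s - s0\<bar> < min \<delta> 1" for s
  proof -
    have "\<bar>F s\<bar> \<le> C * \<bar>s - s0\<bar> powr 2" using C(3)[of s] s by (cases "s = s0") simp_all
    also have "\<dots> \<le> C * \<bar>s - s0\<bar> powr p"
      using False s C(1) by (intro mult_left_mono powr_mono') auto
    finally show ?thesis .
  qed
  then show thesis using that[of C "min \<delta> 1"] C by simp
qed

lemma grad_le_if_P_boundary_zero:
  assumes "P_boundary = 0" "F s0 = 0"
  obtains C \<delta> where "C > 0" "\<delta> > 0"
    "\<And>x. x \<in> \<Omega> \<Longrightarrow> \<bar>u x - s0\<bar> < \<delta> \<Longrightarrow> norm (grad u x) \<le> C * \<bar>u x - s0\<bar>"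
proof -
  obtain C \<delta> where C: "C > 0" "\<delta> > 0" "\<And>s. \<bar>s - s0\<bar> < \<delta> \<Longrightarrow> \<bar>F s\<bar> \<le> C * \<bar>s - s0\<bar> powr p"
    using F_growth_at_zero[OF assms(2)] by blast
  define C' where "C' = (p / (p - 1) * C) powr (1 / p)"
  have "norm (grad u x) \<le> C' * \<bar>u x - s0\<bar>" if x: "x \<in> \<Omega>" "\<bar>u x - s0\<bar> < \<delta>" for x
  proof -
    have "(p - 1) / p * norm (grad u x) powr p \<le> \<bar>F (u x)\<bar>"
      using P_le_boundary[OF x(1)] assms(1) F_nonpos[of "u x"] by (simp add: P_function_def)
    also have "\<dots> \<le> C * \<bar>u x - s0\<bar> powr p" by (rule C(3)[OF x(2)])
    finally have "norm (grad u x) powr p \<le> p / (p - 1) * C * \<bar>u x - s0\<bar> powr p"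
      using p_gt_1 by (simp add: field_simps)
    then have "(norm (grad u x) powr p) powr (1 / p) \<le> (p / (p - 1) * C * \<bar>u x - s0\<bar> powr p) powr (1 / p)"
      using p_gt_1 by (intro powr_mono2) auto
    also have "\<dots> = C' * (\<bar>u x - s0\<bar> powr p) powr (1 / p)"
      unfolding C'_def by (rule powr_mult)
    finally show ?thesis using p_gt_1 by (simp add: powr_powr)
  qed
  moreover have "C' > 0" using C(1) p_gt_1 by (simp add: C'_def)
  ultimately show thesis using that C(2) by blast
qed

lemma regular_if_P_eq_boundary:
  assumes q: "q \<in> frontier \<Omega>" and x: "x \<in> \<Omega>" "P_function x = P_boundary"
  shows "x \<in> regular_set"
proof (rule ccontr)
  assume "x \<notin> regular_set"
  then have "F (u x) = P_boundary" using x by (simp add: regular_set_def P_function_def)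
  then have zero: "P_boundary = 0" "F (u x) = 0" using P_boundary_nonneg F_nonpos[of "u x"] by auto
  obtain C \<delta> where C: "C > 0" "\<delta> > 0"
    "\<And>y. y \<in> \<Omega> \<Longrightarrow> \<bar>u y - u x\<bar> < \<delta> \<Longrightarrow> norm (grad u y) \<le> C * \<bar>u y - u x\<bar>"
    using grad_le_if_P_boundary_zero[OF zero] by blast
  define Z where "Z = {y\<in>\<Omega>. u y = u x}"
  have "open Z" unfolding Z_def
    by (rule open_level_set_if_gradient_le[OF open_domain u_has_derivative C])
  then have "openin (top_of_set \<Omega>) Z" by (auto simp: Z_def intro: open_openin_trans open_domain)
  moreover have "closedin (top_of_set \<Omega>) Z"
    unfolding Z_def by (rule continuous_closedin_preimage_constant[OF u_continuous])
  ultimately have "Z = \<Omega>"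
    using connected_domain x(1) unfolding connected_clopen by (auto simp: Z_def)
  have "Du y = 0" if "y \<in> \<Omega>" for y
  proof -
    have "u y = u x" using that \<open>Z = \<Omega>\<close> by (auto simp: Z_def)
    then show ?thesis using C(2) C(3)[OF that] Du_eq[OF that] by simp
  qed
  moreover have "q \<in> closure \<Omega>" using q by (simp add: frontier_def)
  ultimately have "Du q = 0" by (rule continuous_constant_on_closure[OF Du_continuous])
  then show False using norm_Du_boundary[OF q] \<kappa>_pos by simp
qed

lemma drift_continuous: "continuous_on regular_set drift"
proof -
  have subset: "regular_set \<subseteq> \<Omega>" by (auto simp: regular_set_def)
  note cont = continuous_on_subset[OF grad_continuous subset] continuous_on_subset[OF u_continuous subset]
  show ?thesis
    unfolding drift_def
    by (intro continuous_intros cont continuous_on_compose2[OF f_continuous cont(2)]) (auto simp: regular_set_def)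
qed

lemma P_eq_boundary_everywhere:
  assumes "q \<in> frontier \<Omega>" and x0: "x0 \<in> \<Omega>" "P_function x0 = P_boundary" and x: "x \<in> \<Omega>"
  shows "P_function x = P_boundary"
proof -
  define C where "C = {y\<in>\<Omega>. P_function y = P_boundary}"
  have "open {y\<in>regular_set. P_function y = P_boundary}"
    by (rule open_contact_set[OF open_regular_set drift_continuous subsolution_at_P P_le_boundary])
       (auto simp: regular_set_def)
  moreover have "{y\<in>regular_set. P_function y = P_boundary} = C"
    using regular_if_P_eq_boundary[OF assms(1)] by (auto simp: C_def regular_set_def)
  ultimately have "openin (top_of_set \<Omega>) C" by (auto simp: C_def intro: open_openin_trans open_domain)
  moreover have "closedin (top_of_set \<Omega>) C"
    unfolding C_def by (rule continuous_closedin_preimage_constant[OF P_function_continuous])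
  ultimately have "C = \<Omega>"
    using connected_domain x0 unfolding connected_clopen by (auto simp: C_def)
  then show ?thesis using x by (auto simp: C_def)
qed

text \<open>The Hessian is a multiple of \<open>\<nabla>u \<otimes> \<nabla>u\<close>, so the direction of \<open>\<nabla>u\<close> has zero derivative.\<close>
lemma parallel_if_P_eq_boundary:
  assumes q: "q \<in> frontier \<Omega>" and P: "\<And>x. x \<in> \<Omega> \<Longrightarrow> P_function x = P_boundary"
  shows "parallel_sol \<Omega> u"
proof -
  have reg: "x \<in> regular_set" if "x \<in> \<Omega>" for x
    by (rule regular_if_P_eq_boundary[OF q that P[OF that]])
  have "((\<lambda>y. sgn (grad u y)) has_derivative (\<lambda>h. 0)) (at x)" if x: "x \<in> \<Omega>" for x
  proof -
    have g: "grad u x \<noteq> 0" using reg[OF x] by (simp add: regular_set_def)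
    have "\<forall>\<^sub>F y in nhds x. y \<in> \<Omega>" using open_domain x by (rule eventually_nhds_in_open)
    then have "\<forall>\<^sub>F y in nhds x. P_function y \<le> P_function x" by eventually_elim (simp add: P x)
    then obtain c where rank_one: "hess u x *v h = (c * (grad u x \<bullet> h)) *\<^sub>R grad u x" for h
      using hess_rank_one_at_P_max[OF reg[OF x]] by blast
    have "((\<lambda>y. sgn (grad u y)) has_derivative (\<lambda>h. (1 / norm (grad u x)) *\<^sub>R
        (hess u x *v h - ((grad u x \<bullet> (hess u x *v h)) / (grad u x \<bullet> grad u x)) *\<^sub>R grad u x))) (at x)"
      by (rule has_derivative_compose[OF grad_has_derivative[OF x] has_derivative_sgn[OF g]])
    then show ?thesis using g by (simp add: rank_one)
  qed
  then have const: "sgn (grad u x) = sgn (grad u y)" if "x \<in> \<Omega>" "y \<in> \<Omega>" for x y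
    using has_derivative_zero_unique_connected[OF open_domain connected_domain] that by blast
  obtain x0 where x0: "x0 \<in> \<Omega>" using domain_nonempty by blast
  define a where "a = sgn (grad u x0)"
  show ?thesis
  proof (rule parallel_solI[OF open_domain _ _ _ u_continuous_closure u_pos u_boundary q])
    show "norm a = 1" using reg[OF x0] by (simp add: a_def norm_sgn regular_set_def)
    show "(u has_derivative (\<lambda>h. norm (grad u x) * (a \<bullet> h))) (at x)" if x: "x \<in> \<Omega>" for x
    proof -
      have "a = sgn (grad u x)" unfolding a_def by (rule const[OF x0 x])
      then have "norm (grad u x) * (a \<bullet> h) = grad u x \<bullet> h" for h
        using reg[OF x] by (simp add: sgn_div_norm regular_set_def)
      then show ?thesis using u_has_derivative[OF x] by simp
    qed
  qed auto
qed

end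

section \<open>The boundary point lemma\<close>

context overdetermined_problem
begin

definition "P_grad_closure x = ((p - 1) * norm (Du x) powr (p - 2)) *\<^sub>R (D2u x *v Du x) + f (u x) *\<^sub>R Du x"

lemma P_grad_closure_eq: "x \<in> \<Omega> \<Longrightarrow> P_grad_closure x = P_grad x"
  by (simp add: P_grad_closure_def P_grad_def hess_grad_def Du_eq D2u_eq)

lemma grad_bounds_near_boundary:
  assumes q: "q \<in> frontier \<Omega>"
  obtains \<rho> where "\<rho> > 0" "\<And>x. x \<in> \<Omega> \<Longrightarrow> norm (x - q) \<le> \<rho> \<Longrightarrow> \<kappa> / 2 \<le> norm (grad u x)"
    "\<And>x. x \<in> \<Omega> \<Longrightarrow> norm (x - q) \<le> \<rho> \<Longrightarrow> norm (grad u x) \<le> 2 * \<kappa>"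
proof -
  have "q \<in> closure \<Omega>" using q by (simp add: frontier_def)
  then have "continuous (at q within closure \<Omega>) (\<lambda>x. norm (Du x))"
    using Du_continuous by (intro continuous_intros) (simp add: continuous_on_eq_continuous_within)
  moreover have "\<kappa> / 2 > 0" using \<kappa>_pos by simp
  ultimately obtain \<rho> where \<rho>: "\<rho> > 0" "\<And>x. x \<in> closure \<Omega> \<Longrightarrow> dist x q < \<rho> \<Longrightarrow> \<bar>norm (Du x) - \<kappa>\<bar> < \<kappa> / 2"
    using norm_Du_boundary[OF q] unfolding continuous_within_eps_delta dist_real_def by metis
  have "\<kappa> / 2 \<le> norm (grad u x)" "norm (grad u x) \<le> 2 * \<kappa>" if x: "x \<in> \<Omega>" "norm (x - q) \<le> \<rho> / 2" for x
  proof -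
    have "\<bar>norm (Du x) - \<kappa>\<bar> < \<kappa> / 2"
      using x \<rho> closure_subset by (intro \<rho>(2)) (auto simp: dist_norm)
    then show "\<kappa> / 2 \<le> norm (grad u x)" "norm (grad u x) \<le> 2 * \<kappa>"
      using \<kappa>_pos unfolding Du_eq[OF x(1)] abs_less_iff by linarith+
  qed
  then show thesis using that[of "\<rho> / 2"] \<rho>(1) by simp
qed

lemma P_closure_barrier:
  assumes q: "q \<in> frontier \<Omega>" and less: "\<And>x. x \<in> \<Omega> \<Longrightarrow> P_function x < P_boundary"
  obtains \<rho> \<epsilon> K \<beta> where "\<rho> > 0" "\<epsilon> > 0" "K > 0"
    "\<And>x. x \<in> \<Omega> \<Longrightarrow> norm (x - q) \<le> \<rho> \<Longrightarrow>
      P_closure x + \<epsilon> * (exp (K * u x) - 1 - \<beta> * ((x - q) \<bullet> (x - q))) \<le> P_boundary"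
proof -
  obtain \<rho> where "\<rho> > 0" and grad: "\<And>x. x \<in> \<Omega> \<Longrightarrow> norm (x - q) \<le> \<rho> \<Longrightarrow> \<kappa> / 2 \<le> norm (grad u x)"
    "\<And>x. x \<in> \<Omega> \<Longrightarrow> norm (x - q) \<le> \<rho> \<Longrightarrow> norm (grad u x) \<le> 2 * \<kappa>"
    using grad_bounds_near_boundary[OF q] by blast
  have reg: "x \<in> regular_set" if "x \<in> \<Omega>" "norm (x - q) \<le> \<rho>" for x
    using grad(1)[OF that] that \<kappa>_pos by (fastforce simp: regular_set_def)
  obtain M where M: "M \<ge> 0" "\<And>x. x \<in> \<Omega> \<Longrightarrow> \<bar>f (u x)\<bar> \<le> M" by (rule f_u_bounded) blast
  define w where "w = (\<kappa> / 2) powr p"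
  have "w > 0" using \<kappa>_pos by (simp add: w_def)
  have w_le: "w \<le> norm (grad u x) powr p" if "x \<in> \<Omega>" "norm (x - q) \<le> \<rho>" for x
    unfolding w_def using grad[OF that] \<kappa>_pos p_gt_1 by (intro powr_mono2) auto
  obtain \<epsilon> K \<beta> where "\<epsilon> > 0" "K > 0"
    "\<And>x. x \<in> \<Omega> \<Longrightarrow> norm (x - q) \<le> \<rho> \<Longrightarrow>
      P_closure x + \<epsilon> * (exp (K * u x) - 1 - \<beta> * ((x - q) \<bullet> (x - q))) \<le> P_boundary"
  proof (rule hopf_barrier[OF open_domain \<open>\<rho> > 0\<close> reg u_continuous_closure P_closure_continuous u_pos u_boundary])
    show "P_closure x < P_boundary" if "x \<in> \<Omega>" for x using less[OF that] by (simp add: P_closure_eq[OF that])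
    show "P_closure x \<le> P_boundary" if "x \<in> frontier \<Omega>" for x by (simp add: P_closure_frontier[OF that])
    show "subsolution_at P_closure x" if x: "x \<in> \<Omega>" "norm (x - q) \<le> \<rho>" for x
      using subsolution_at_P[OF reg[OF x]] has_gradient_hessian_transform_open[OF _ open_domain x(1)] P_closure_eq
      unfolding subsolution_at_def operator_at_def by metis
    show "\<exists>l\<ge>- ((p - 1) * M / w * (2 * \<kappa>)\<^sup>2). operator_at u x (grad u x) l" if x: "x \<in> \<Omega>" "norm (x - q) \<le> \<rho>" for x
    proof -
      have "(norm (grad u x))\<^sup>2 \<le> (2 * \<kappa>)\<^sup>2" using grad[OF x] by (intro power_mono) auto
      then have "(p - 1) * M / w * (norm (grad u x))\<^sup>2 \<le> (p - 1) * M / w * (2 * \<kappa>)\<^sup>2"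
        using M(1) p_gt_1 \<open>w > 0\<close> by (intro mult_left_mono) auto
      moreover obtain l where "operator_at u x (grad u x) l" "l \<ge> - ((p - 1) * M / w) * (norm (grad u x))\<^sup>2"
        using operator_at_u_ge[OF reg[OF x] M(2)[OF x(1)] \<open>w > 0\<close> w_le[OF x]] by blast
      ultimately show ?thesis by (intro exI[of _ l]) auto
    qed
    show "(\<kappa> / 2)\<^sup>2 \<le> grad u x \<bullet> grad u x" if "x \<in> \<Omega>" "norm (x - q) \<le> \<rho>" for x
      using power_mono[OF grad(1)[OF that], of 2] \<kappa>_pos by (simp add: power2_norm_eq_inner)
    show "norm (drift x) \<le> p * M / w * (2 * \<kappa>)" if x: "x \<in> \<Omega>" "norm (x - q) \<le> \<rho>" for x
    proof -
      have "p * M / w * norm (grad u x) \<le> p * M / w * (2 * \<kappa>)"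
        using grad[OF x] M(1) p_gt_1 \<open>w > 0\<close> by (intro mult_left_mono) auto
      then show ?thesis using drift_le[OF M(2)[OF x(1)] \<open>w > 0\<close> w_le[OF x]] by linarith
    qed
  qed (use \<kappa>_pos in auto)
  then show thesis using that[OF \<open>\<rho> > 0\<close>] by blast
qed

lemma inward_ray_Du:
  assumes "q \<in> frontier \<Omega>"
  shows "\<forall>\<^sub>F t in at_right 0. q + t *\<^sub>R Du q \<in> \<Omega>"
proof -
  obtain r \<phi> where defining: "local_defining 1 \<Omega> q r \<phi>" using C1_boundary[OF assms] by blast
  have "grad \<phi> q \<noteq> 0" by (rule local_defining_grad_nonzero[OF defining])
  then have "grad \<phi> q \<bullet> sgn (grad \<phi> q) > 0" by (simp add: sgn_div_norm)
  then have "grad \<phi> q \<bullet> Du q < 0"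
    unfolding Du_boundary[OF assms defining] using \<kappa>_pos by simp
  then show ?thesis using local_defining_ray[OF defining _ open_domain assms] by simp
qed

lemma P_grad_closure_tendsto:
  assumes q: "q \<in> frontier \<Omega>"
  shows "((\<lambda>t. P_grad_closure (q + t *\<^sub>R Du q)) \<longlongrightarrow> P_grad_closure q) (at_right 0)"
proof -
  have q_closure: "q \<in> closure \<Omega>" using q by (simp add: frontier_def)
  note along_ray = tendsto_along_ray[OF inward_ray_Du[OF q] _ q_closure]
  have "isCont f (u q)" using f_continuous by (simp add: continuous_on_eq_continuous_at)
  then have "((\<lambda>t. f (u (q + t *\<^sub>R Du q))) \<longlongrightarrow> f (u q)) (at_right 0)"
    by (rule isCont_tendsto_compose[OF _ along_ray[OF u_continuous_closure]])
  moreover have "norm (Du q) \<noteq> 0" using norm_Du_boundary[OF q] \<kappa>_pos by simp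
  ultimately show ?thesis
    unfolding P_grad_closure_def
    by (intro tendsto_intros along_ray[OF Du_continuous] along_ray[OF D2u_continuous]
        bounded_bilinear.tendsto[OF bounded_bilinear_matrix_vector_mult]) auto
qed

lemma P_closure_ray_quotient_tendsto:
  assumes q: "q \<in> frontier \<Omega>"
  shows "((\<lambda>t. (P_closure (q + t *\<^sub>R Du q) - P_boundary) / t) \<longlongrightarrow> P_grad_closure q \<bullet> Du q) (at_right 0)"
proof -
  have q_closure: "q \<in> closure \<Omega>" using q by (simp add: frontier_def)
  note ray = inward_ray_Du[OF q]
  have "\<forall>\<^sub>F t in at_right 0. Du (q + t *\<^sub>R Du q) \<noteq> 0"
    by (rule tendsto_imp_eventually_ne[OF tendsto_along_ray[OF ray Du_continuous q_closure]])
       (use norm_Du_boundary[OF q] \<kappa>_pos in auto)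
  then have "\<forall>\<^sub>F t in at_right 0. (P_closure has_derivative (\<lambda>h. P_grad_closure (q + t *\<^sub>R Du q) \<bullet> h)) (at (q + t *\<^sub>R Du q))"
    using ray
  proof eventually_elim
    case (elim t)
    then have "q + t *\<^sub>R Du q \<in> regular_set" by (simp add: regular_set_def Du_eq)
    then have "(P_function has_derivative (\<lambda>h. P_grad (q + t *\<^sub>R Du q) \<bullet> h)) (at (q + t *\<^sub>R Du q))"
      by (rule has_gradient_hessian_has_derivative[OF P_function_has_gradient_hessian])
    then show ?case
      unfolding P_grad_closure_eq[OF elim(2)]
      by (rule has_derivative_transform_within_open[OF _ open_domain elim(2)]) (simp add: P_closure_eq)
  qed
  from ray_difference_quotient_tendsto[OF tendsto_along_ray[OF ray P_closure_continuous q_closure]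
      P_grad_closure_tendsto[OF q] this]
  show ?thesis by (simp add: P_closure_frontier[OF q])
qed

lemma P_normal_derivative_neg:
  assumes q: "q \<in> frontier \<Omega>" and less: "\<And>x. x \<in> \<Omega> \<Longrightarrow> P_function x < P_boundary"
  shows "P_grad_closure q \<bullet> Du q < 0"
proof -
  obtain \<rho> \<epsilon> K \<beta> where barrier: "\<rho> > 0" "\<epsilon> > 0" "K > 0"
    "\<And>x. x \<in> \<Omega> \<Longrightarrow> norm (x - q) \<le> \<rho> \<Longrightarrow>
      P_closure x + \<epsilon> * (exp (K * u x) - 1 - \<beta> * ((x - q) \<bullet> (x - q))) \<le> P_boundary"
    using P_closure_barrier[OF q less] by blast
  define X where "X t = q + t *\<^sub>R Du q" for t
  have ray: "\<forall>\<^sub>F t in at_right 0. X t \<in> \<Omega>" using inward_ray_Du[OF q] by (simp add: X_def)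
  have q_closure: "q \<in> closure \<Omega>" using q by (simp add: frontier_def)
  have "((\<lambda>t. u (X t) / t) \<longlongrightarrow> Du q \<bullet> Du q) (at_right 0)"
    using ray_difference_quotient_tendsto[OF tendsto_along_ray[OF ray[unfolded X_def] u_continuous_closure q_closure]
        tendsto_along_ray[OF ray[unfolded X_def] Du_continuous q_closure]
        eventually_mono[OF ray[unfolded X_def] u_has_derivative_Du]]
    by (simp add: X_def u_boundary[OF q])
  then have "((\<lambda>t. - (\<epsilon> * (K * (u (X t) / t) - \<beta> * (Du q \<bullet> Du q) * t))) \<longlongrightarrow>
      - (\<epsilon> * (K * (Du q \<bullet> Du q) - \<beta> * (Du q \<bullet> Du q) * 0))) (at_right 0)"
    by (intro tendsto_intros)
  moreover have "\<forall>\<^sub>F t in at_right 0.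
      (P_closure (X t) - P_boundary) / t \<le> - (\<epsilon> * (K * (u (X t) / t) - \<beta> * (Du q \<bullet> Du q) * t))"
  proof -
    have "\<forall>\<^sub>F t in nhds 0. q + t *\<^sub>R Du q \<in> ball q \<rho>" using barrier(1) by (intro eventually_line_in_open) auto
    then have "\<forall>\<^sub>F t in at_right 0. X t \<in> ball q \<rho>"
      unfolding X_def by (rule filter_leD[OF at_within_le_nhds])
    then show ?thesis using ray eventually_at_right_less[of 0]
    proof eventually_elim
      case (elim t)
      have "\<epsilon> * (K * u (X t) - \<beta> * (t\<^sup>2 * (Du q \<bullet> Du q))) \<le> \<epsilon> * (exp (K * u (X t)) - 1 - \<beta> * (t\<^sup>2 * (Du q \<bullet> Du q)))"
        using barrier(2) exp_ge_add_one_self[of "K * u (X t)"] by (intro mult_left_mono) linarith+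
      also have "(t\<^sup>2 * (Du q \<bullet> Du q)) = (X t - q) \<bullet> (X t - q)" by (simp add: X_def power2_eq_square)
      finally have "P_closure (X t) - P_boundary \<le> - (\<epsilon> * (K * u (X t) - \<beta> * ((X t - q) \<bullet> (X t - q))))"
        using barrier(4)[OF elim(2)] elim(1) by (simp add: dist_norm norm_minus_commute)
      also have "\<dots> = - (\<epsilon> * (K * (u (X t) / t) - \<beta> * (Du q \<bullet> Du q) * t)) * t"
        using elim(3) by (simp add: X_def algebra_simps)
      finally show ?case using elim(3) by (simp add: pos_divide_le_eq)
    qed
  qed
  ultimately have "P_grad_closure q \<bullet> Du q \<le> - (\<epsilon> * (K * (Du q \<bullet> Du q) - \<beta> * (Du q \<bullet> Du q) * 0))"
    using tendsto_le[OF trivial_limit_at_right_real _ P_closure_ray_quotient_tendsto[OF q]] unfolding X_def by blast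
  moreover have "\<epsilon> * (K * (Du q \<bullet> Du q)) > 0"
    using barrier(2,3) norm_Du_boundary[OF q] \<kappa>_pos by auto
  ultimately show ?thesis by simp
qed

theorem boundary_tangential_trace_pos:
  assumes q: "q \<in> frontier \<Omega>" and less: "\<And>x. x \<in> \<Omega> \<Longrightarrow> P_function x < P_boundary"
  shows "tangential_trace (Du q) ((*v) (D2u q)) > 0"
proof -
  define X where "X t = q + t *\<^sub>R Du q" for t
  define \<tau> where "\<tau> x = trace (D2u x) - (Du x \<bullet> (D2u x *v Du x)) / (Du x \<bullet> Du x)" for x
  have \<tau>: "tangential_trace (Du x) ((*v) (D2u x)) = \<tau> x" for x
    by (simp add: \<tau>_def tangential_trace_def op_trace_matrix)
  have q_closure: "q \<in> closure \<Omega>" using q by (simp add: frontier_def)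
  have "Du q \<noteq> 0" using norm_Du_boundary[OF q] \<kappa>_pos by auto
  note ray = inward_ray_Du[OF q]
  note Du_lim = tendsto_along_ray[OF ray Du_continuous q_closure]
    and D2u_lim = tendsto_along_ray[OF ray D2u_continuous q_closure]
  have "((\<lambda>t. \<tau> (X t)) \<longlongrightarrow> \<tau> q) (at_right 0)"
    unfolding \<tau>_def trace_def X_def using \<open>Du q \<noteq> 0\<close>
    by (intro tendsto_intros Du_lim D2u_lim bounded_bilinear.tendsto[OF bounded_bilinear_matrix_vector_mult]) auto
  then have "((\<lambda>t. - (norm (Du (X t)) powr p) * \<tau> (X t)) \<longlongrightarrow> - (norm (Du q) powr p) * \<tau> q) (at_right 0)"
    unfolding X_def using \<open>Du q \<noteq> 0\<close> by (intro tendsto_intros Du_lim) auto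
  moreover have "\<forall>\<^sub>F t in at_right 0. P_grad_closure (X t) \<bullet> Du (X t) = - (norm (Du (X t)) powr p) * \<tau> (X t)"
    using ray tendsto_imp_eventually_ne[OF Du_lim \<open>Du q \<noteq> 0\<close>]
  proof eventually_elim
    case (elim t)
    then have "X t \<in> regular_set" by (simp add: X_def regular_set_def Du_eq)
    from P_grad_inner_grad[OF this] elim(1) show ?case
      unfolding \<tau>[symmetric] by (simp add: X_def P_grad_closure_eq Du_eq D2u_eq)
  qed
  moreover have "((\<lambda>t. P_grad_closure (X t) \<bullet> Du (X t)) \<longlongrightarrow> P_grad_closure q \<bullet> Du q) (at_right 0)"
    unfolding X_def by (intro tendsto_intros P_grad_closure_tendsto[OF q] Du_lim)
  ultimately have "((\<lambda>t. P_grad_closure (X t) \<bullet> Du (X t)) \<longlongrightarrow> - (norm (Du q) powr p) * \<tau> q) (at_right 0)"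
    and lim: "((\<lambda>t. P_grad_closure (X t) \<bullet> Du (X t)) \<longlongrightarrow> P_grad_closure q \<bullet> Du q) (at_right 0)"
    by (simp_all only: tendsto_cong)
  then have "P_grad_closure q \<bullet> Du q = - (norm (Du q) powr p) * \<tau> q"
    using tendsto_unique[OF trivial_limit_at_right_real lim] by simp
  then have "norm (Du q) powr p * \<tau> q > 0" using P_normal_derivative_neg[OF q less] by simp
  then show ?thesis unfolding \<tau> by (simp add: zero_less_mult_iff)
qed

end

section \<open>The boundary as a graph\<close>

lemma continuous_on_sign_change:
  fixes h :: "'a::topological_space \<Rightarrow> real \<Rightarrow> real"
  assumes cont: "\<And>t. t \<in> {-b..b} \<Longrightarrow> continuous_on S (\<lambda>x. h x t)"
    and \<tau>: "\<And>x. x \<in> S \<Longrightarrow> \<tau> x \<in> {-b<..<b}"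
    and neg: "\<And>x t. x \<in> S \<Longrightarrow> t \<in> {-b..b} \<Longrightarrow> h x t < 0 \<longleftrightarrow> t < \<tau> x"
    and pos: "\<And>x t. x \<in> S \<Longrightarrow> t \<in> {-b..b} \<Longrightarrow> h x t > 0 \<longleftrightarrow> \<tau> x < t"
  shows "continuous_on S \<tau>"
  unfolding continuous_on_def
proof (intro ballI order_tendstoI)
  fix x assume x: "x \<in> S"
  have in_S: "\<forall>\<^sub>F y in at x within S. y \<in> S" by (simp add: eventually_at_filter)
  have lim: "((\<lambda>y. h y t) \<longlongrightarrow> h x t) (at x within S)" if "t \<in> {-b..b}" for t
    using cont[OF that] x by (simp add: continuous_on_def)
  show "\<forall>\<^sub>F y in at x within S. a < \<tau> y" if "a < \<tau> x" for a
  proof -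
    define t where "t = max a (-b)"
    have t: "t \<in> {-b..b}" "a \<le> t" "t < \<tau> x" using that \<tau>[OF x] by (auto simp: t_def)
    have "\<forall>\<^sub>F y in at x within S. h y t < 0"
      using lim[OF t(1)] neg[OF x t(1)] t(3) by (intro order_tendstoD) auto
    then show ?thesis using in_S by eventually_elim (use neg[OF _ t(1)] t(2) in force)
  qed
  show "\<forall>\<^sub>F y in at x within S. \<tau> y < a" if "\<tau> x < a" for a
  proof -
    define t where "t = min a b"
    have t: "t \<in> {-b..b}" "t \<le> a" "\<tau> x < t" using that \<tau>[OF x] by (auto simp: t_def)
    have "\<forall>\<^sub>F y in at x within S. h y t > 0"
      using lim[OF t(1)] pos[OF x t(1)] t(3) by (intro order_tendstoD) auto
    then show ?thesis using in_S by eventually_elim (use pos[OF _ t(1)] t(2) in force)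
  qed
qed

lemma strict_mono_implicit_function:
  fixes h :: "'a::topological_space \<Rightarrow> real \<Rightarrow> real"
  assumes "open U" "x0 \<in> U" "b > 0" and mono: "\<And>x. x \<in> U \<Longrightarrow> strict_mono_on {-b..b} (h x)"
    and cont: "\<And>x. x \<in> U \<Longrightarrow> continuous_on {-b..b} (h x)" "\<And>t. t \<in> {-b..b} \<Longrightarrow> continuous_on U (\<lambda>x. h x t)"
    and "h x0 0 = 0"
  obtains S \<tau> where "open S" "x0 \<in> S" "S \<subseteq> U" "continuous_on S \<tau>" "\<tau> x0 = 0"
    "\<And>x. x \<in> S \<Longrightarrow> \<tau> x \<in> {-b<..<b}" "\<And>x t. x \<in> S \<Longrightarrow> t \<in> {-b..b} \<Longrightarrow> h x t < 0 \<longleftrightarrow> t < \<tau> x"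
    "\<And>x t. x \<in> S \<Longrightarrow> t \<in> {-b..b} \<Longrightarrow> h x t > 0 \<longleftrightarrow> \<tau> x < t"
proof -
  define S where "S = U \<inter> (\<lambda>x. h x (-b)) -` {..<0} \<inter> (U \<inter> (\<lambda>x. h x b) -` {0<..})"
  have "open S" unfolding S_def
    using \<open>b > 0\<close> by (intro open_Int continuous_open_preimage[OF cont(2) \<open>open U\<close>]) auto
  have S: "x \<in> U" "h x (-b) < 0" "h x b > 0" if "x \<in> S" for x using that by (auto simp: S_def)
  have "\<exists>t\<in>{-b..b}. h x t = 0" if "x \<in> S" for x
    using IVT'[of "h x" "-b" 0 b] S[OF that] cont(1)[OF S(1)[OF that]] \<open>b > 0\<close> by force
  then obtain \<tau> where \<tau>: "\<And>x. x \<in> S \<Longrightarrow> \<tau> x \<in> {-b..b}" "\<And>x. x \<in> S \<Longrightarrow> h x (\<tau> x) = 0" by metis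
  have sign: "h x t < 0 \<longleftrightarrow> t < \<tau> x" "h x t > 0 \<longleftrightarrow> \<tau> x < t" if "x \<in> S" "t \<in> {-b..b}" for x t
    using strict_mono_on_less[OF mono[OF S(1)[OF that(1)]]] \<tau>[OF that(1)] that(2) by metis+
  have inside: "\<tau> x \<in> {-b<..<b}" if "x \<in> S" for x
    using S(2,3)[OF that] sign[OF that, of "-b"] sign[OF that, of b] \<open>b > 0\<close> by auto
  have "continuous_on S \<tau>"
    using continuous_on_sign_change[OF continuous_on_subset[OF cont(2)] inside sign] S(1) by blast
  have "strict_mono_on {-b..b} (h x0)" by (rule mono[OF assms(2)])
  then have "h x0 (-b) < h x0 0" "h x0 0 < h x0 b"
    using \<open>b > 0\<close> by (auto intro: strict_mono_onD)
  then have "x0 \<in> S" using assms(2,7) by (simp add: S_def)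
  moreover from this have "\<tau> x0 = 0"
    using sign[of x0 0] assms(3,7) by (auto intro: antisym simp: not_less[symmetric])
  ultimately show thesis
    using that \<open>open S\<close> S(1) \<open>continuous_on S \<tau>\<close> inside sign by blast
qed

lemma implicit_function_has_derivative:
  fixes \<phi> :: "'a::real_inner \<Rightarrow> real"
  assumes \<phi>: "(\<phi> has_derivative (\<lambda>h. n \<bullet> h)) (at (x + \<tau> x *\<^sub>R d))" and "n \<bullet> d \<noteq> 0"
    and "isCont \<tau> x" and zero: "\<forall>\<^sub>F y in nhds x. \<phi> (y + \<tau> y *\<^sub>R d) = 0"
  shows "(\<tau> has_derivative (\<lambda>h. - (n \<bullet> h) / (n \<bullet> d))) (at x)"
proof -
  define z where "z y = y + \<tau> y *\<^sub>R d" for y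
  have z: "isCont z x" unfolding z_def using \<open>isCont \<tau> x\<close> by (intro continuous_intros)
  obtain \<psi> where \<psi>: "isCont \<psi> (z x)" "\<psi> (z x) = n" "\<And>y. \<phi> y - \<phi> (z x) = \<psi> y \<bullet> (y - z x)"
    using \<phi> unfolding has_derivative_inner_iff_caratheodory z_def by blast
  have \<psi>z: "isCont (\<lambda>y. \<psi> (z y)) x" by (rule isCont_o2[OF z \<psi>(1)])
  define \<theta> where "\<theta> y = - (1 / (\<psi> (z y) \<bullet> d)) *\<^sub>R \<psi> (z y)" for y
  have "isCont \<theta> x" unfolding \<theta>_def using \<psi>(2) \<open>n \<bullet> d \<noteq> 0\<close> by (intro continuous_intros \<psi>z) auto
  then have \<theta>_der: "((\<lambda>y. \<tau> x + \<theta> y \<bullet> (y - x)) has_derivative (\<lambda>h. \<theta> x \<bullet> h)) (at x)"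
    unfolding has_derivative_inner_iff_caratheodory by (intro exI[of _ \<theta>]) simp
  have near: "\<forall>\<^sub>F y in nhds x. \<tau> x + \<theta> y \<bullet> (y - x) = \<tau> y"
  proof -
    have "((\<lambda>y. \<psi> (z y) \<bullet> d) \<longlongrightarrow> \<psi> (z x) \<bullet> d) (nhds x)"
      using continuous_inner[OF \<psi>z continuous_const, of d] tendsto_at_iff_tendsto_nhds[of "\<lambda>y. \<psi> (z y) \<bullet> d" x]
      by (simp add: isCont_def)
    then have "\<forall>\<^sub>F y in nhds x. \<psi> (z y) \<bullet> d \<noteq> 0"
      by (rule tendsto_imp_eventually_ne) (simp add: \<psi>(2) \<open>n \<bullet> d \<noteq> 0\<close>)
    then show ?thesis using zero
    proof eventually_elim
      case (elim y)
      have "0 = \<psi> (z y) \<bullet> (z y - z x)"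
        using \<psi>(3)[of "z y"] elim(2) eventually_nhds_x_imp_x[OF zero] by (simp add: z_def)
      also have "\<dots> = \<psi> (z y) \<bullet> (y - x) + (\<tau> y - \<tau> x) * (\<psi> (z y) \<bullet> d)"
        by (simp add: z_def inner_diff_right inner_add_right algebra_simps)
      finally show ?case using elim(1) by (simp add: \<theta>_def field_simps)
    qed
  qed
  have "\<forall>\<^sub>F y in at x. \<tau> x + \<theta> y \<bullet> (y - x) = \<tau> y"
    using near by (rule filter_leD[OF at_within_le_nhds])
  then have "(\<tau> has_derivative (\<lambda>h. \<theta> x \<bullet> h)) (at x)"
    by (rule has_derivative_transform_eventually[OF \<theta>_der]) auto
  then show ?thesis by (simp add: \<theta>_def \<psi>(2))
qed

lemma ex_segments_in_open:
  fixes q d :: "'a::real_normed_vector"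
  assumes "open U" "q \<in> U"
  obtains \<rho> c :: real where "\<rho> > 0" "c > 0" "\<And>x t. x \<in> ball q \<rho> \<Longrightarrow> \<bar>t\<bar> \<le> c \<Longrightarrow> x + t *\<^sub>R d \<in> U"
proof -
  obtain e where e: "e > 0" "ball q e \<subseteq> U" using assms open_contains_ball by blast
  define c where "c = e / (2 * (norm d + 1))"
  have "x + t *\<^sub>R d \<in> U" if "x \<in> ball q (e / 2)" "\<bar>t\<bar> \<le> c" for x t
  proof -
    have "\<bar>t\<bar> * norm d \<le> c * (norm d + 1)" using that(2) by (intro mult_mono) auto
    also have "\<dots> = e / 2" using norm_ge_zero[of d] by (simp add: c_def field_simps add_nonneg_eq_0_iff)
    finally have "norm (x - q) + norm (t *\<^sub>R d) < e" using that(1) by (simp add: dist_norm norm_minus_commute)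
    then have "norm ((x - q) + t *\<^sub>R d) < e" by (rule norm_triangle_lt)
    then have "dist (x + t *\<^sub>R d) q < e" by (simp add: dist_norm algebra_simps)
    then show ?thesis using e(2) by (auto simp: dist_commute)
  qed
  moreover have "c > 0" using e(1) by (simp add: c_def add_nonneg_pos)
  ultimately show thesis using that[of "e / 2" c] e(1) by simp
qed

lemma local_defining_exit_time:
  assumes defining: "local_defining 1 \<Omega> q r0 \<phi>" and "open \<Omega>" and q: "q \<in> frontier \<Omega>"
  defines "d \<equiv> grad \<phi> q"
  obtains S b \<tau> where "open S" "q \<in> S" "b > 0" "continuous_on S \<tau>" "\<tau> q = 0"
    "\<And>x. x \<in> S \<Longrightarrow> \<tau> x \<in> {-b<..<b}"
    "\<And>x t. x \<in> S \<Longrightarrow> t \<in> {-b..b} \<Longrightarrow> x + t *\<^sub>R d \<in> ball q r0 \<and> grad \<phi> (x + t *\<^sub>R d) \<bullet> d > 0"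
    "\<And>x t. x \<in> S \<Longrightarrow> t \<in> {-b..b} \<Longrightarrow> \<phi> (x + t *\<^sub>R d) < 0 \<longleftrightarrow> t < \<tau> x"
    "\<And>x t. x \<in> S \<Longrightarrow> t \<in> {-b..b} \<Longrightarrow> \<phi> (x + t *\<^sub>R d) > 0 \<longleftrightarrow> \<tau> x < t"
proof -
  note Ck = local_definingD(3)[OF defining] and q_ball = local_definingD(2)[OF defining]
  have der: "(\<phi> has_derivative (\<lambda>h. grad \<phi> x \<bullet> h)) (at x)" if "x \<in> ball q r0" for x
    by (rule Ck_on_has_derivative_grad[OF Ck open_ball _ that]) simp
  have \<phi>_cont: "continuous_on (ball q r0) \<phi>" using Ck_on_continuous[OF Ck, of "[]"] by simp
  have "open (ball q r0 \<inter> (\<lambda>x. grad \<phi> x \<bullet> d) -` {0<..})"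
    by (intro continuous_open_preimage continuous_intros Ck_on_grad_continuous[OF Ck]) auto
  moreover have "q \<in> ball q r0 \<inter> (\<lambda>x. grad \<phi> x \<bullet> d) -` {0<..}"
    using q_ball local_defining_grad_nonzero[OF defining] by (simp add: d_def)
  ultimately obtain \<rho> b where \<rho>: "\<rho> > 0" "b > 0"
    "\<And>x t. x \<in> ball q \<rho> \<Longrightarrow> \<bar>t\<bar> \<le> b \<Longrightarrow> x + t *\<^sub>R d \<in> ball q r0 \<inter> (\<lambda>x. grad \<phi> x \<bullet> d) -` {0<..}"
    by (rule ex_segments_in_open) blast
  have along: "((\<lambda>t. \<phi> (x + t *\<^sub>R d)) has_real_derivative grad \<phi> (x + t *\<^sub>R d) \<bullet> d) (at t)"
    if "x \<in> ball q \<rho>" "t \<in> {-b..b}" for x t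
    using \<rho>(3)[OF that(1), of t] that(2) by (intro has_derivative_along_line[OF der]) auto
  obtain S \<tau> where S: "open S" "q \<in> S" "S \<subseteq> ball q \<rho>" "continuous_on S \<tau>" "\<tau> q = 0"
    "\<And>x. x \<in> S \<Longrightarrow> \<tau> x \<in> {-b<..<b}" "\<And>x t. x \<in> S \<Longrightarrow> t \<in> {-b..b} \<Longrightarrow> \<phi> (x + t *\<^sub>R d) < 0 \<longleftrightarrow> t < \<tau> x"
    "\<And>x t. x \<in> S \<Longrightarrow> t \<in> {-b..b} \<Longrightarrow> \<phi> (x + t *\<^sub>R d) > 0 \<longleftrightarrow> \<tau> x < t"
  proof (rule strict_mono_implicit_function[of "ball q \<rho>" q b "\<lambda>x t. \<phi> (x + t *\<^sub>R d)"])
    fix x assume x: "x \<in> ball q \<rho>"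
    show "strict_mono_on {-b..b} (\<lambda>t. \<phi> (x + t *\<^sub>R d))"
    proof (rule strict_mono_onI)
      fix s t assume st: "s \<in> {-b..b}" "t \<in> {-b..b}" "s < t"
      show "\<phi> (x + s *\<^sub>R d) < \<phi> (x + t *\<^sub>R d)"
      proof (rule DERIV_pos_imp_increasing[OF st(3)])
        fix y assume "s \<le> y" "y \<le> t"
        then have y: "y \<in> {-b..b}" using st by auto
        then show "\<exists>D. ((\<lambda>t. \<phi> (x + t *\<^sub>R d)) has_real_derivative D) (at y) \<and> D > 0"
          using along[OF x y] \<rho>(3)[OF x, of y] by auto
      qed
    qed
    show "continuous_on {-b..b} (\<lambda>t. \<phi> (x + t *\<^sub>R d))"
      by (rule DERIV_continuous_on[OF has_field_derivative_at_within[OF along[OF x]]])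
  next
    show "continuous_on (ball q \<rho>) (\<lambda>x. \<phi> (x + t *\<^sub>R d))" if "t \<in> {-b..b}" for t
      using \<rho>(3)[of _ t] that by (intro continuous_on_compose2[OF \<phi>_cont] continuous_intros) auto
    show "\<phi> (q + 0 *\<^sub>R d) = 0" using local_defining_zero[OF defining \<open>open \<Omega>\<close> q q_ball] by simp
  qed (use \<rho> in auto)
  show thesis
    by (rule that[OF S(1,2) \<rho>(2) S(4-6) _ S(7,8)]) (use \<rho>(3) S(3) in \<open>auto simp: abs_le_iff\<close>)
qed

lemma local_defining_chart:
  assumes defining: "local_defining 1 \<Omega> q r0 \<phi>" and "open \<Omega>" and q: "q \<in> frontier \<Omega>"
  defines "d \<equiv> grad \<phi> q"
  obtains r b \<tau> where "r > 0" "b > 0" "\<tau> q = 0" "\<And>x. x \<in> ball q r \<Longrightarrow> x \<in> \<Omega> \<longleftrightarrow> \<tau> x > 0"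
    "\<And>x t. x \<in> ball q r \<Longrightarrow> \<tau> x - b < t \<Longrightarrow> t < \<tau> x \<Longrightarrow> x + t *\<^sub>R d \<in> \<Omega>"
    "\<And>x. x \<in> ball q r \<Longrightarrow> x + \<tau> x *\<^sub>R d \<in> frontier \<Omega> \<inter> ball q r0"
    "\<And>x. x \<in> ball q r \<Longrightarrow> grad \<phi> (x + \<tau> x *\<^sub>R d) \<bullet> d > 0"
    "\<And>x. x \<in> ball q r \<Longrightarrow>
       (\<tau> has_derivative (\<lambda>h. - (grad \<phi> (x + \<tau> x *\<^sub>R d) \<bullet> h) / (grad \<phi> (x + \<tau> x *\<^sub>R d) \<bullet> d))) (at x)"
proof -
  obtain S b \<tau> where S: "open S" "q \<in> S" "b > 0" "continuous_on S \<tau>" "\<tau> q = 0"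
    "\<And>x. x \<in> S \<Longrightarrow> \<tau> x \<in> {-b<..<b}"
    "\<And>x t. x \<in> S \<Longrightarrow> t \<in> {-b..b} \<Longrightarrow> x + t *\<^sub>R d \<in> ball q r0 \<and> grad \<phi> (x + t *\<^sub>R d) \<bullet> d > 0"
    "\<And>x t. x \<in> S \<Longrightarrow> t \<in> {-b..b} \<Longrightarrow> \<phi> (x + t *\<^sub>R d) < 0 \<longleftrightarrow> t < \<tau> x"
    "\<And>x t. x \<in> S \<Longrightarrow> t \<in> {-b..b} \<Longrightarrow> \<phi> (x + t *\<^sub>R d) > 0 \<longleftrightarrow> \<tau> x < t"
    using local_defining_exit_time[OF defining \<open>open \<Omega>\<close> q] unfolding d_def by blast
  note mem = local_definingD(5)[OF defining]
  have \<tau>S: "\<tau> x \<in> {-b..b}" if "x \<in> S" for x using S(6)[OF that] by auto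
  have zero: "\<phi> (x + \<tau> x *\<^sub>R d) = 0" if "x \<in> S" for x
    using S(8,9)[OF that \<tau>S[OF that]] by (simp add: not_less_iff_gr_or_eq)
  have inside: "x + t *\<^sub>R d \<in> \<Omega> \<longleftrightarrow> t < \<tau> x" if "x \<in> S" "t \<in> {-b..b}" for x t
    using mem S(7,8)[OF that] by blast
  have "open (S \<inter> \<tau> -` {-b/2<..<b/2})" using S by (intro continuous_open_preimage) auto
  moreover have "q \<in> S \<inter> \<tau> -` {-b/2<..<b/2}" using S(2,3,5) by simp
  ultimately obtain r where r: "r > 0" "ball q r \<subseteq> S \<inter> \<tau> -` {-b/2<..<b/2}"
    using open_contains_ball by blast
  then have in_S: "x \<in> S" "-b/2 < \<tau> x" "\<tau> x < b/2" if "x \<in> ball q r" for x using that by auto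
  have below: "x + t *\<^sub>R d \<in> \<Omega>" if "x \<in> ball q r" "\<tau> x - b / 2 < t" "t < \<tau> x" for x t
    using inside[OF in_S(1)[OF that(1)], of t] in_S[OF that(1)] that(2,3) by auto
  have "x + \<tau> x *\<^sub>R d \<in> frontier \<Omega>" if x: "x \<in> ball q r" for x
  proof (rule frontier_at_segment_end[OF \<open>open \<Omega>\<close>])
    show "\<tau> x - b / 2 < \<tau> x" using S(3) by simp
    show "x + \<tau> x *\<^sub>R d \<notin> \<Omega>" using inside[OF in_S(1)[OF x] \<tau>S[OF in_S(1)[OF x]]] by simp
  qed (rule below[OF x])
  moreover have "x \<in> \<Omega> \<longleftrightarrow> \<tau> x > 0" if "x \<in> ball q r" for x
    using inside[OF in_S(1)[OF that], of 0] S(3) by simp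
  moreover have "(\<tau> has_derivative (\<lambda>h. - (grad \<phi> (x + \<tau> x *\<^sub>R d) \<bullet> h) / (grad \<phi> (x + \<tau> x *\<^sub>R d) \<bullet> d))) (at x)"
    if x: "x \<in> ball q r" for x
  proof (rule implicit_function_has_derivative[where \<phi>=\<phi>])
    note x_in_S = in_S(1)[OF x]
    show "(\<phi> has_derivative (\<lambda>h. grad \<phi> (x + \<tau> x *\<^sub>R d) \<bullet> h)) (at (x + \<tau> x *\<^sub>R d))"
      by (rule Ck_on_has_derivative_grad[OF local_definingD(3)[OF defining] open_ball])
       (use S(7)[OF x_in_S \<tau>S[OF x_in_S]] in auto)
    show "isCont \<tau> x" using S(1,4) x_in_S by (simp add: continuous_on_eq_continuous_at)
    show "\<forall>\<^sub>F y in nhds x. \<phi> (y + \<tau> y *\<^sub>R d) = 0"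
      using eventually_nhds_in_open[OF S(1) x_in_S] by eventually_elim (rule zero)
    show "grad \<phi> (x + \<tau> x *\<^sub>R d) \<bullet> d \<noteq> 0" using S(7)[OF x_in_S \<tau>S[OF x_in_S]] by auto
  qed
  ultimately show thesis
    using that[of r "b / 2" \<tau>] r(1) S(3,5) below S(7) in_S(1) \<tau>S by auto
qed

section \<open>Second-order regularity of the boundary\<close>

lemma uniformly_close_to_boundary_value:
  fixes D :: "'a::metric_space \<Rightarrow> real \<Rightarrow> 'b::metric_space"
  assumes "compact K" and D: "continuous_on (K \<times> {0..b}) (\<lambda>(y, s). D y s)" and "b \<ge> 0" "e > 0"
  obtains d where "d > 0" "\<And>y s. y \<in> K \<Longrightarrow> s \<in> {0..b} \<Longrightarrow> s < d \<Longrightarrow> dist (D y s) (D y 0) < e"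
proof -
  have "uniformly_continuous_on (K \<times> {0..b}) (\<lambda>(y, s). D y s)"
    by (rule compact_uniformly_continuous[OF D compact_Times[OF assms(1) compact_Icc]])
  then obtain d where d: "d > 0" "\<And>z z'. z \<in> K \<times> {0..b} \<Longrightarrow> z' \<in> K \<times> {0..b} \<Longrightarrow> dist z' z < d \<Longrightarrow>
      dist (case z' of (y, s) \<Rightarrow> D y s) (case z of (y, s) \<Rightarrow> D y s) < e"
    using \<open>e > 0\<close> unfolding uniformly_continuous_on_def by metis
  have "dist (D y s) (D y 0) < e" if "y \<in> K" "s \<in> {0..b}" "s < d" for y s
    using d(2)[of "(y, 0)" "(y, s)"] that \<open>b \<ge> 0\<close> by (simp add: dist_Pair_Pair)
  then show thesis using that[OF d(1)] by blast
qed

lemma ex_positive_null_sequence: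
  assumes "b > 0"
  obtains \<delta> :: "nat \<Rightarrow> real" where "\<And>n. \<delta> n \<in> {0<..b}" "filterlim \<delta> (at_right 0) sequentially"
proof
  define \<delta> where "\<delta> n = b * inverse (real (Suc n))" for n
  show \<delta>: "\<delta> n \<in> {0<..b}" for n
    using assms mult_left_mono[of "inverse (real (Suc n))" 1 b] by (simp add: \<delta>_def field_simps)
  have "\<delta> \<longlonglongrightarrow> 0"
    unfolding \<delta>_def by (rule tendsto_mult_right_zero[OF LIMSEQ_inverse_real_of_nat])
  then show "filterlim \<delta> (at_right 0) sequentially"
    by (rule tendsto_imp_filterlim_at_right) (use \<delta> in simp)
qed

lemma has_derivative_boundary_limit:
  fixes f :: "'a::euclidean_space \<Rightarrow> real \<Rightarrow> 'b::banach" and D :: "'a \<Rightarrow> real \<Rightarrow> 'a \<Rightarrow>\<^sub>L 'b"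
  assumes "open U" "x \<in> U" "b > 0"
    and D: "continuous_on (U \<times> {0..<b}) (\<lambda>(y, \<delta>). D y \<delta>)"
    and der: "\<And>y \<delta>. y \<in> U \<Longrightarrow> \<delta> \<in> {0<..<b} \<Longrightarrow> ((\<lambda>y. f y \<delta>) has_derivative D y \<delta>) (at y)"
    and lim: "\<And>y. y \<in> U \<Longrightarrow> (f y \<longlongrightarrow> f y 0) (at_right 0)"
  shows "((\<lambda>y. f y 0) has_derivative D x 0) (at x)"
proof -
  obtain \<rho> where \<rho>: "\<rho> > 0" "cball x \<rho> \<subseteq> U" using assms(1,2) open_contains_cball by blast
  obtain \<delta> :: "nat \<Rightarrow> real" where \<delta>: "\<And>n. \<delta> n \<in> {0<..b / 2}" and \<delta>_lim: "filterlim \<delta> (at_right 0) sequentially"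
    using ex_positive_null_sequence[of "b / 2"] \<open>b > 0\<close> by auto
  have D_compact: "continuous_on (cball x \<rho> \<times> {0..b / 2}) (\<lambda>(y, s). D y s)"
    by (rule continuous_on_subset[OF D]) (use \<rho>(2) \<open>b > 0\<close> in auto)
  have "\<exists>g. \<forall>y\<in>cball x \<rho>. (\<lambda>n. f y (\<delta> n)) \<longlonglongrightarrow> g y \<and> (g has_derivative D y 0) (at y within cball x \<rho>)"
  proof (rule has_derivative_sequence[where f="\<lambda>n y. f y (\<delta> n)" and f'="\<lambda>n y. blinfun_apply (D y (\<delta> n))"
        and ?x0.0=x and l="f x 0"])
    show "((\<lambda>y. f y (\<delta> n)) has_derivative D y (\<delta> n)) (at y within cball x \<rho>)" if "y \<in> cball x \<rho>" for n y
    proof (rule has_derivative_at_withinI[OF der])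
      show "y \<in> U" using that \<rho>(2) by blast
      show "\<delta> n \<in> {0<..<b}" using \<delta>[of n] \<open>b > 0\<close> by auto
    qed
    show "(\<lambda>n. f x (\<delta> n)) \<longlonglongrightarrow> f x 0" by (rule filterlim_compose[OF lim[OF \<open>x \<in> U\<close>] \<delta>_lim])
    fix e :: real assume "e > 0"
    then obtain d where d: "d > 0" "\<And>y s. y \<in> cball x \<rho> \<Longrightarrow> s \<in> {0..b / 2} \<Longrightarrow> s < d \<Longrightarrow> dist (D y s) (D y 0) < e"
      using uniformly_close_to_boundary_value[OF compact_cball D_compact] \<open>b > 0\<close> by auto
    have "\<forall>\<^sub>F n in sequentially. \<delta> n < d"
      using order_tendstoD(2)[OF filterlim_mono[OF \<delta>_lim at_within_le_nhds order_refl] d(1)] .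
    then show "\<forall>\<^sub>F n in sequentially. \<forall>y\<in>cball x \<rho>. \<forall>h. norm (D y (\<delta> n) h - D y 0 h) \<le> e * norm h"
    proof eventually_elim
      case (elim n)
      show ?case
      proof (intro ballI allI)
        fix y h :: 'a assume "y \<in> cball x \<rho>"
        then have "dist (D y (\<delta> n)) (D y 0) < e"
          using d(2)[of y "\<delta> n"] \<delta>[of n] elim by simp
        then have "norm (D y (\<delta> n) - D y 0) * norm h \<le> e * norm h"
          by (intro mult_right_mono) (auto simp: dist_norm)
        then show "norm (D y (\<delta> n) h - D y 0 h) \<le> e * norm h"
          using norm_blinfun[of "D y (\<delta> n) - D y 0" h] by (simp add: blinfun.diff_left)
      qed
    qed
  qed (use \<rho> in auto)
  then obtain g where g: "\<And>y. y \<in> cball x \<rho> \<Longrightarrow> (\<lambda>n. f y (\<delta> n)) \<longlonglongrightarrow> g y"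
    "(g has_derivative D x 0) (at x within cball x \<rho>)"
    using \<rho>(1) by fastforce
  have "f y 0 = g y" if "y \<in> cball x \<rho>" for y
    using LIMSEQ_unique[OF filterlim_compose[OF lim \<delta>_lim] g(1)[OF that]] that \<rho>(2) by blast
  then have "((\<lambda>y. f y 0) has_derivative D x 0) (at x within cball x \<rho>)"
    using \<rho>(1) by (intro has_derivative_transform[OF _ _ g(2)]) auto
  then show ?thesis using \<rho>(1) at_within_interior[of x "cball x \<rho>"] by simp
qed

text \<open>Near \<open>q\<close>, the line through \<open>x\<close> in the direction \<open>d\<close> leaves \<open>\<Omega>\<close> at the time \<open>\<tau> x\<close>; there \<open>V\<close> is normal to
  the boundary.\<close>
locale boundary_chart =
  fixes \<Omega> :: "(real^'n) set" and V :: "real^'n \<Rightarrow> real^'n" and A :: "real^'n \<Rightarrow> real^'n^'n"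
    and q d :: "real^'n" and r b :: real and \<tau> :: "real^'n \<Rightarrow> real"
  assumes radius_pos: "r > 0" and depth_pos: "b > 0" and exit_time_base: "\<tau> q = 0"
    and mem_iff: "\<And>x. x \<in> ball q r \<Longrightarrow> x \<in> \<Omega> \<longleftrightarrow> \<tau> x > 0"
    and inside: "\<And>x t. x \<in> ball q r \<Longrightarrow> \<tau> x - b < t \<Longrightarrow> t < \<tau> x \<Longrightarrow> x + t *\<^sub>R d \<in> \<Omega>"
    and exit_frontier: "\<And>x. x \<in> ball q r \<Longrightarrow> x + \<tau> x *\<^sub>R d \<in> frontier \<Omega>"
    and transversal: "\<And>x. x \<in> ball q r \<Longrightarrow> V (x + \<tau> x *\<^sub>R d) \<bullet> d \<noteq> 0"
    and exit_time_has_derivative: "\<And>x. x \<in> ball q r \<Longrightarrow>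
      (\<tau> has_derivative (\<lambda>h. - (V (x + \<tau> x *\<^sub>R d) \<bullet> h) / (V (x + \<tau> x *\<^sub>R d) \<bullet> d))) (at x)"
    and V_continuous: "continuous_on (closure \<Omega>) V" and A_continuous: "continuous_on (closure \<Omega>) A"
    and V_has_derivative: "\<And>x. x \<in> \<Omega> \<Longrightarrow> (V has_derivative (\<lambda>h. A x *v h)) (at x)"
begin

definition "exit_point x = x + \<tau> x *\<^sub>R d"

definition "exit_derivative x h = h - ((V (exit_point x) \<bullet> h) / (V (exit_point x) \<bullet> d)) *\<^sub>R d"

lemma base_in_ball: "q \<in> ball q r"
  using radius_pos by simp

lemma exit_point_base: "exit_point q = q"
  by (simp add: exit_point_def exit_time_base)

lemma exit_point_closure: "x \<in> ball q r \<Longrightarrow> exit_point x \<in> closure \<Omega>"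
  using exit_frontier by (auto simp: exit_point_def frontier_def)

lemma before_exit:
  assumes "x \<in> ball q r" "\<delta> \<in> {0<..<b}"
  shows "exit_point x - \<delta> *\<^sub>R d \<in> \<Omega>"
  using inside[OF assms(1), of "\<tau> x - \<delta>"] assms(2) by (simp add: exit_point_def algebra_simps)

lemma exit_point_has_derivative:
  assumes "x \<in> ball q r"
  shows "(exit_point has_derivative exit_derivative x) (at x)"
proof -
  have "(exit_point has_derivative (\<lambda>h. h + (- (V (exit_point x) \<bullet> h) / (V (exit_point x) \<bullet> d)) *\<^sub>R d)) (at x)"
    unfolding exit_point_def
    by (intro has_derivative_add has_derivative_ident has_derivative_scaleR_left exit_time_has_derivative[OF assms])
  then show ?thesis by (rule has_derivative_eq_rhs) (simp add: exit_derivative_def fun_eq_iff)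
qed

lemma exit_point_continuous: "continuous_on (ball q r) exit_point"
  using exit_point_has_derivative has_derivative_continuous by (blast intro: continuous_at_imp_continuous_on)

lemma V_exit_continuous: "continuous_on (ball q r) (\<lambda>x. V (exit_point x))"
  by (rule continuous_on_compose2[OF V_continuous exit_point_continuous]) (use exit_point_closure in auto)

lemma A_exit_continuous: "continuous_on (ball q r) (\<lambda>x. A (exit_point x))"
  by (rule continuous_on_compose2[OF A_continuous exit_point_continuous]) (use exit_point_closure in auto)

lemma exit_derivative_continuous: "continuous_on (ball q r) (\<lambda>x. exit_derivative x h)"
  unfolding exit_derivative_def
  using transversal by (intro continuous_intros V_exit_continuous) (auto simp: exit_point_def)

lemma bounded_linear_exit_derivative: "bounded_linear (exit_derivative x)"
  unfolding exit_derivative_def [abs_def]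
  by (intro bounded_linear_sub bounded_linear_ident bounded_linear_scaleR_const
      bounded_linear_compose[OF bounded_linear_divide bounded_linear_inner_right])

text \<open>The curves \<open>t \<mapsto> exit_point (x + t v)\<close> lie in the boundary; their translates by \<open>- \<delta> d\<close> lie in \<open>\<Omega>\<close>.\<close>
lemma V_exit_has_derivative:
  assumes x: "x \<in> ball q r"
  shows "((\<lambda>y. V (exit_point y)) has_derivative (\<lambda>h. A (exit_point x) *v exit_derivative x h)) (at x)"
proof -
  define D where "D y \<delta> = Blinfun (\<lambda>h. A (exit_point y - \<delta> *\<^sub>R d) *v exit_derivative y h)" for y \<delta>
  have D: "blinfun_apply (D y \<delta>) = (\<lambda>h. A (exit_point y - \<delta> *\<^sub>R d) *v exit_derivative y h)" for y \<delta>
    unfolding D_def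
    by (intro bounded_linear_Blinfun_apply
        bounded_linear_compose[OF matrix_vector_mul_bounded_linear bounded_linear_exit_derivative])
  have "((\<lambda>y. V (exit_point y - 0 *\<^sub>R d)) has_derivative D x 0) (at x)"
  proof (rule has_derivative_boundary_limit[where f="\<lambda>y \<delta>. V (exit_point y - \<delta> *\<^sub>R d)", OF open_ball x depth_pos])
    have cont: "continuous_on (ball q r \<times> {0..<b}) (\<lambda>z. exit_point (fst z) - snd z *\<^sub>R d)"
      by (intro continuous_intros continuous_on_compose2[OF exit_point_continuous]) auto
    have range: "exit_point y - \<delta> *\<^sub>R d \<in> closure \<Omega>" if "y \<in> ball q r" "\<delta> \<in> {0..<b}" for y \<delta>
      using before_exit[OF that(1), of \<delta>] exit_point_closure[OF that(1)] that(2) subsetD[OF closure_subset]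
      by (cases "\<delta> = 0") auto
    show "continuous_on (ball q r \<times> {0..<b}) (\<lambda>(y, \<delta>). D y \<delta>)"
      unfolding case_prod_beta
    proof (intro continuous_on_blinfun_componentwise, unfold D)
      fix i
      show "continuous_on (ball q r \<times> {0..<b})
          (\<lambda>z. A (exit_point (fst z) - snd z *\<^sub>R d) *v exit_derivative (fst z) i)"
        by (intro bounded_bilinear.continuous_on[OF bounded_bilinear_matrix_vector_mult]
            continuous_on_compose2[OF A_continuous cont] continuous_on_compose2[OF exit_derivative_continuous]
            continuous_intros) (use range in auto)
    qed
    fix y assume y: "y \<in> ball q r"
    show "((\<lambda>y. V (exit_point y - \<delta> *\<^sub>R d)) has_derivative D y \<delta>) (at y)" if "\<delta> \<in> {0<..<b}" for \<delta>
    proof -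
      have "((\<lambda>y. exit_point y - \<delta> *\<^sub>R d) has_derivative (\<lambda>h. exit_derivative y h - 0)) (at y)"
        by (intro has_derivative_diff exit_point_has_derivative[OF y] has_derivative_const)
      from has_derivative_compose[OF this V_has_derivative[OF before_exit[OF y that]]] show ?thesis by (simp add: D)
    qed
    have "\<forall>\<^sub>F \<delta> in at_right 0. \<delta> \<in> {0<..<b}" by (rule eventually_at_right_real[OF depth_pos])
    then have "\<forall>\<^sub>F \<delta> in at_right 0. exit_point y - \<delta> *\<^sub>R d \<in> closure \<Omega>" by eventually_elim (rule range[OF y], simp)
    moreover have "((\<lambda>\<delta>. exit_point y - \<delta> *\<^sub>R d) \<longlongrightarrow> exit_point y - 0 *\<^sub>R d) (at_right 0)"
      by (intro tendsto_intros)
    ultimately show "((\<lambda>\<delta>. V (exit_point y - \<delta> *\<^sub>R d)) \<longlongrightarrow> V (exit_point y - 0 *\<^sub>R d)) (at_right 0)"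
      using continuous_on_tendsto_compose[OF V_continuous] exit_point_closure[OF y] by simp
  qed
  then show ?thesis by (simp add: D)
qed

lemma neg_exit_time_has_gradient:
  assumes "x \<in> ball q r"
  shows "((\<lambda>x. - \<tau> x) has_derivative (\<lambda>h. ((1 / (V (exit_point x) \<bullet> d)) *\<^sub>R V (exit_point x)) \<bullet> h)) (at x)"
  using has_derivative_minus[OF exit_time_has_derivative[OF assms]] by (simp add: exit_point_def)

lemma C2_defining_function: "local_defining 2 \<Omega> q r (\<lambda>x. - \<tau> x)"
proof -
  define W where "W x = V (exit_point x)" for x
  define W' where "W' x h = A (exit_point x) *v exit_derivative x h" for x h
  have trans: "W x \<bullet> d \<noteq> 0" if "x \<in> ball q r" for x using transversal[OF that] by (simp add: W_def exit_point_def)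
  have "Ck_on 2 (\<lambda>x. - \<tau> x) (ball q r)"
  proof (rule Ck_on_2I[OF open_ball])
    fix x assume x: "x \<in> ball q r"
    show "((\<lambda>x. - \<tau> x) has_derivative (\<lambda>h. (inverse (W x \<bullet> d) *\<^sub>R W x) \<bullet> h)) (at x)"
      using neg_exit_time_has_gradient[OF x] by (simp add: W_def inverse_eq_divide)
    have W: "(W has_derivative W' x) (at x)" unfolding W_def W'_def by (rule V_exit_has_derivative[OF x])
    show "((\<lambda>x. inverse (W x \<bullet> d) *\<^sub>R W x) has_derivative
        (\<lambda>h. inverse (W x \<bullet> d) *\<^sub>R W' x h + (- (inverse (W x \<bullet> d) * (W' x h \<bullet> d) * inverse (W x \<bullet> d))) *\<^sub>R W x)) (at x)"
      using has_derivative_scaleR[OF Deriv.has_derivative_inverse[where f="\<lambda>x. W x \<bullet> d",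
            OF trans[OF x] has_derivative_inner_left[OF W]] W] .
  next
    fix h
    have "continuous_on (ball q r) (\<lambda>x. W' x h)"
      unfolding W'_def
      by (intro bounded_bilinear.continuous_on[OF bounded_bilinear_matrix_vector_mult]
          A_exit_continuous exit_derivative_continuous)
    moreover have "continuous_on (ball q r) W" unfolding W_def by (rule V_exit_continuous)
    ultimately show "continuous_on (ball q r) (\<lambda>x. inverse (W x \<bullet> d) *\<^sub>R W' x h
        + (- (inverse (W x \<bullet> d) * (W' x h \<bullet> d) * inverse (W x \<bullet> d))) *\<^sub>R W x)"
      using trans by (intro continuous_intros) auto
  qed
  moreover have "grad (\<lambda>x. - \<tau> x) x \<noteq> 0" if x: "x \<in> ball q r" for x
    using grad_eqI[OF neg_exit_time_has_gradient[OF x]] trans[OF x] by (auto simp: W_def)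
  ultimately show ?thesis
    using mem_iff radius_pos unfolding local_defining_def by auto
qed

end

section \<open>Mean curvature\<close>

lemma unit_normal_has_derivative:
  fixes \<phi> :: "real^'n \<Rightarrow> real"
  assumes defining: "local_defining 2 \<Omega> q r \<phi>"
  obtains N where "((\<lambda>x. sgn (grad \<phi> x)) has_derivative N) (at q)" "\<And>h. grad \<phi> q \<bullet> N h = 0"
proof -
  define g where "g = grad \<phi> q"
  define N where "N h = (1 / norm g) *\<^sub>R (hess \<phi> q *v h - ((g \<bullet> (hess \<phi> q *v h)) / (g \<bullet> g)) *\<^sub>R g)" for h
  have "g \<noteq> 0" unfolding g_def by (rule local_defining_grad_nonzero[OF defining])
  have "(grad \<phi> has_derivative (\<lambda>h. hess \<phi> q *v h)) (at q)"
    using Ck_on_grad_has_derivative[OF local_definingD(3)[OF defining] open_ball _ local_definingD(2)[OF defining]] by simp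
  from has_derivative_compose[OF this has_derivative_sgn[OF \<open>g \<noteq> 0\<close>[unfolded g_def]]]
  have "((\<lambda>x. sgn (grad \<phi> x)) has_derivative N) (at q)" unfolding N_def [abs_def] g_def .
  moreover have "g \<bullet> N h = 0" for h using \<open>g \<noteq> 0\<close> by (simp add: N_def inner_diff_right)
  ultimately show thesis using that by (simp add: g_def)
qed

lemma divg_eq_op_trace:
  assumes "(X has_derivative X') (at x)"
  shows "divg X x = op_trace X'"
  unfolding divg_def op_trace_cart
  by (intro sum.cong refl partial_eqI bounded_linear.has_derivative[OF bounded_linear_vec_nth assms])

context boundary_chart
begin

lemma A_tangential:
  assumes \<nu>: "(\<nu> has_derivative N) (at q)" and "open T" "q \<in> T"
    and V: "\<And>x. x \<in> frontier \<Omega> \<Longrightarrow> x \<in> T \<Longrightarrow> V x = c *\<^sub>R \<nu> x" and h: "V q \<bullet> h = 0"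
  shows "A q *v h = c *\<^sub>R N h"
proof -
  have "(\<nu> has_derivative N) (at (exit_point q))" using \<nu> by (simp add: exit_point_base)
  from has_derivative_scaleR_right[OF has_derivative_compose[OF exit_point_has_derivative[OF base_in_ball] this], of c]
  have \<nu>_exit: "((\<lambda>x. c *\<^sub>R \<nu> (exit_point x)) has_derivative (\<lambda>h. c *\<^sub>R N (exit_derivative q h))) (at q)" .
  have "open (ball q r \<inter> exit_point -` T)"
    by (intro continuous_open_preimage[OF exit_point_continuous] open_ball \<open>open T\<close>)
  moreover have "q \<in> ball q r \<inter> exit_point -` T" using base_in_ball \<open>q \<in> T\<close> by (simp add: exit_point_base)
  moreover have "c *\<^sub>R \<nu> (exit_point x) = V (exit_point x)" if "x \<in> ball q r \<inter> exit_point -` T" for x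
    using V[of "exit_point x"] exit_frontier[of x] that by (simp add: exit_point_def)
  ultimately have "((\<lambda>x. V (exit_point x)) has_derivative (\<lambda>h. c *\<^sub>R N (exit_derivative q h))) (at q)"
    by (rule has_derivative_transform_within_open[OF \<nu>_exit])
  from has_derivative_unique[OF V_exit_has_derivative[OF base_in_ball] this]
  have "A q *v exit_derivative q h = c *\<^sub>R N (exit_derivative q h)"
    by (simp add: exit_point_base fun_eq_iff)
  then show ?thesis using h by (simp add: exit_derivative_def exit_point_base)
qed

lemma divg_unit_normal_neg:
  assumes defining: "local_defining 2 \<Omega> q r' \<phi>" and "\<kappa> > 0"
    and V: "\<And>x. x \<in> frontier \<Omega> \<Longrightarrow> x \<in> ball q r' \<Longrightarrow> V x = - \<kappa> *\<^sub>R sgn (grad \<phi> x)"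
    and pos: "tangential_trace (V q) ((*v) (A q)) > 0"
  shows "divg (\<lambda>x. sgn (grad \<phi> x)) q < 0"
proof -
  obtain N where N: "((\<lambda>x. sgn (grad \<phi> x)) has_derivative N) (at q)" "\<And>h. grad \<phi> q \<bullet> N h = 0"
    using unit_normal_has_derivative[OF defining] by blast
  note q_ball = local_definingD(2)[OF defining]
  have "q \<in> frontier \<Omega>" using exit_frontier[OF base_in_ball] by (simp add: exit_time_base)
  then have V_q: "V q = - \<kappa> *\<^sub>R sgn (grad \<phi> q)" using V q_ball by blast
  then have "V q \<noteq> 0" using local_defining_grad_nonzero[OF defining] \<open>\<kappa> > 0\<close> by (simp add: sgn_zero_iff)
  define e where "e b = b - ((b \<bullet> V q) / (V q \<bullet> V q)) *\<^sub>R V q" for b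
  have "V q \<bullet> e b = 0" for b
    using \<open>V q \<noteq> 0\<close> by (simp add: e_def inner_diff_right inner_commute[of b])
  have "A q *v e b = - \<kappa> *\<^sub>R N (e b)" for b
    by (rule A_tangential[OF N(1) open_ball q_ball V \<open>V q \<bullet> e b = 0\<close>])
  then have "tangential_trace (V q) ((*v) (A q)) = (\<Sum>b\<in>Basis. e b \<bullet> (- \<kappa> *\<^sub>R N (e b)))"
    using tangential_trace_eq_sum[OF matrix_vector_mul_linear \<open>V q \<noteq> 0\<close>] by (simp add: e_def)
  also have "\<dots> = - \<kappa> * tangential_trace (V q) N"
    using tangential_trace_eq_sum[OF has_derivative_linear[OF N(1)] \<open>V q \<noteq> 0\<close>]
    by (simp add: e_def sum_distrib_left)
  also have "tangential_trace (V q) N = divg (\<lambda>x. sgn (grad \<phi> x)) q"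
  proof -
    have "V q \<bullet> N (V q) = 0" using N(2) by (simp add: V_q sgn_div_norm)
    then show ?thesis by (simp add: tangential_trace_def divg_eq_op_trace[OF N(1)])
  qed
  finally show ?thesis using pos \<open>\<kappa> > 0\<close> by (simp add: mult_less_0_iff)
qed

end

context overdetermined_problem
begin

lemma boundary_chart_exists:
  assumes q: "q \<in> frontier \<Omega>"
  obtains d r b \<tau> where "boundary_chart \<Omega> Du D2u q d r b \<tau>"
proof -
  obtain r0 \<phi> where defining: "local_defining 1 \<Omega> q r0 \<phi>" using C1_boundary[OF q] by blast
  define d where "d = grad \<phi> q"
  obtain r b \<tau> where chart: "r > 0" "b > 0" "\<tau> q = 0" "\<And>x. x \<in> ball q r \<Longrightarrow> x \<in> \<Omega> \<longleftrightarrow> \<tau> x > 0"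
    "\<And>x t. x \<in> ball q r \<Longrightarrow> \<tau> x - b < t \<Longrightarrow> t < \<tau> x \<Longrightarrow> x + t *\<^sub>R d \<in> \<Omega>"
    "\<And>x. x \<in> ball q r \<Longrightarrow> x + \<tau> x *\<^sub>R d \<in> frontier \<Omega> \<inter> ball q r0"
    "\<And>x. x \<in> ball q r \<Longrightarrow> grad \<phi> (x + \<tau> x *\<^sub>R d) \<bullet> d > 0"
    "\<And>x. x \<in> ball q r \<Longrightarrow>
       (\<tau> has_derivative (\<lambda>h. - (grad \<phi> (x + \<tau> x *\<^sub>R d) \<bullet> h) / (grad \<phi> (x + \<tau> x *\<^sub>R d) \<bullet> d))) (at x)"
    using local_defining_chart[OF defining open_domain q] unfolding d_def by blast
  have Du: "Du x = (- \<kappa> / norm (grad \<phi> x)) *\<^sub>R grad \<phi> x" "grad \<phi> x \<noteq> 0" if x: "x \<in> frontier \<Omega> \<inter> ball q r0" for x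
  proof -
    obtain r' where defining': "local_defining 1 \<Omega> x r' \<phi>" using local_defining_subball[OF defining] x by blast
    show "Du x = (- \<kappa> / norm (grad \<phi> x)) *\<^sub>R grad \<phi> x"
      using Du_boundary[OF _ defining'] x by (simp add: sgn_div_norm divide_inverse)
    show "grad \<phi> x \<noteq> 0" by (rule local_defining_grad_nonzero[OF defining'])
  qed
  have "boundary_chart \<Omega> Du D2u q d r b \<tau>"
  proof
    fix x assume x: "x \<in> ball q r"
    show "Du (x + \<tau> x *\<^sub>R d) \<bullet> d \<noteq> 0"
      using Du[OF chart(6)[OF x]] chart(7)[OF x] \<kappa>_pos by simp
    show "(\<tau> has_derivative (\<lambda>h. - (Du (x + \<tau> x *\<^sub>R d) \<bullet> h) / (Du (x + \<tau> x *\<^sub>R d) \<bullet> d))) (at x)"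
      using chart(8)[OF x] Du[OF chart(6)[OF x]] \<kappa>_pos by simp
  qed (use chart Du_continuous D2u_continuous Du_has_derivative in auto)
  then show thesis by (rule that)
qed

theorem mean_curv_exists:
  assumes "q \<in> frontier \<Omega>"
  shows "\<exists>H. mean_curv \<Omega> q H"
proof -
  obtain d r b \<tau> where "boundary_chart \<Omega> Du D2u q d r b \<tau>" using boundary_chart_exists[OF assms] by blast
  then show ?thesis unfolding mean_curv_def using boundary_chart.C2_defining_function by blast
qed

theorem mean_curv_neg:
  assumes "CARD('n) \<ge> 2" and q: "q \<in> frontier \<Omega>" and less: "\<And>x. x \<in> \<Omega> \<Longrightarrow> P_function x < P_boundary"
    and H: "mean_curv \<Omega> q H"
  shows "H < 0"
proof -
  obtain r \<phi> where defining: "local_defining 2 \<Omega> q r \<phi>"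
    and H_eq: "H = divg (\<lambda>x. (1 / norm (grad \<phi> x)) *\<^sub>R grad \<phi> x) q / (real CARD('n) - 1)"
    using H unfolding mean_curv_def by blast
  obtain d r' b \<tau> where chart: "boundary_chart \<Omega> Du D2u q d r' b \<tau>"
    using boundary_chart_exists[OF q] by blast
  have "divg (\<lambda>x. sgn (grad \<phi> x)) q < 0"
  proof (rule boundary_chart.divg_unit_normal_neg[OF chart defining \<kappa>_pos _ boundary_tangential_trace_pos[OF q less]])
    fix x assume x: "x \<in> frontier \<Omega>" "x \<in> ball q r"
    obtain r'' where "local_defining 2 \<Omega> x r'' \<phi>" using local_defining_subball[OF defining x(2)] by blast
    from local_defining_mono[OF this, of 1] have "local_defining 1 \<Omega> x r'' \<phi>" by simp
    then show "Du x = - \<kappa> *\<^sub>R sgn (grad \<phi> x)" by (rule Du_boundary[OF x(1)])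
  qed
  then show ?thesis
    unfolding H_eq using assms(1) by (intro divide_neg_pos) (auto simp: sgn_div_norm divide_inverse)
qed

theorem parallel_or_mean_curv_neg:
  assumes "CARD('n) \<ge> 2"
  shows "parallel_sol \<Omega> u \<or> (\<forall>q\<in>frontier \<Omega>. (\<exists>H. mean_curv \<Omega> q H) \<and> (\<forall>H. mean_curv \<Omega> q H \<longrightarrow> H < 0))"
proof (cases "\<exists>x\<in>\<Omega>. P_function x = P_boundary")
  case True
  then show ?thesis using P_eq_boundary_everywhere parallel_if_P_eq_boundary by blast
next
  case False
  then have "P_function x < P_boundary" if "x \<in> \<Omega>" for x using P_le_boundary[OF that] that by force
  then show ?thesis using mean_curv_exists mean_curv_neg[OF assms] by blast
qed

end

lemma Ck_closureE:
  fixes f :: "real^'n \<Rightarrow> real"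
  assumes "Ck_closure k f \<Omega>" "2 \<le> k"
  obtains G H where "continuous_on (closure \<Omega>) G" "\<And>x. x \<in> \<Omega> \<Longrightarrow> G x = grad f x"
    "continuous_on (closure \<Omega>) H" "\<And>x. x \<in> \<Omega> \<Longrightarrow> H x = hess f x"
proof -
  have "\<exists>g. \<forall>is::'n list. length is \<le> k \<longrightarrow> continuous_on (closure \<Omega>) (g is) \<and> (\<forall>x\<in>\<Omega>. g is x = Dp is f x)"
    using assms(1) unfolding Ck_closure_def by metis
  then obtain g where g: "\<And>is::'n list. length is \<le> k \<Longrightarrow> continuous_on (closure \<Omega>) (g is)"
    "\<And>is x. length is \<le> k \<Longrightarrow> x \<in> \<Omega> \<Longrightarrow> g is x = Dp is f x" by blast
  show thesis
  proof (rule that[of "\<lambda>x. \<chi> i. g [i] x" "\<lambda>x. \<chi> i j. g [j, i] x"])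
    show "continuous_on (closure \<Omega>) (\<lambda>x. \<chi> i. g [i] x)" "continuous_on (closure \<Omega>) (\<lambda>x. \<chi> i j. g [j, i] x)"
      using assms(2) by (auto intro!: continuous_on_vec_lambda g(1))
    show "(\<chi> i. g [i] x) = grad f x" "(\<chi> i j. g [j, i] x) = hess f x" if "x \<in> \<Omega>" for x
      using that assms(2) by (simp_all add: grad_def hess_def g(2))
  qed
qed

lemma bgrad_eq:
  assumes G: "continuous_on (closure \<Omega>) G" "\<And>x. x \<in> \<Omega> \<Longrightarrow> G x = grad u x" and "open \<Omega>" and q: "q \<in> frontier \<Omega>"
  shows "bgrad u \<Omega> q = G q"
proof -
  have q_closure: "q \<in> closure \<Omega>" "q \<notin> \<Omega>" using q \<open>open \<Omega>\<close> by (auto simp: frontier_def interior_open)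
  then have nontrivial: "at q within \<Omega> \<noteq> bot" by (simp add: trivial_limit_within closure_def)
  have "(G \<longlongrightarrow> G q) (at q within closure \<Omega>)" using G(1) q_closure(1) by (simp add: continuous_on_def)
  then have "(G \<longlongrightarrow> G q) (at q within \<Omega>)" by (rule tendsto_within_subset) (rule closure_subset)
  moreover have "\<forall>\<^sub>F x in at q within \<Omega>. G x = grad u x" by (simp add: eventually_at_filter G(2))
  ultimately have "(grad u \<longlongrightarrow> G q) (at q within \<Omega>)" by (rule Lim_transform_eventually)
  from tendsto_vec_nth[OF this] have "(partial i u \<longlongrightarrow> G q $ i) (at q within \<Omega>)" for i
    by (simp add: grad_def)
  then show ?thesis by (simp add: bgrad_def vec_eq_iff tendsto_Lim[OF nontrivial])
qed

theorem theorem1p1: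
  fixes \<Omega> :: "(real^'n) set" and u :: "real^'n \<Rightarrow> real"
    and f F :: "real \<Rightarrow> real" and p \<kappa> :: real
  assumes n2: "CARD('n) \<ge> 2"
    and p: "1 < p"
    and dom: "C1_domain \<Omega>"
    and f_C1: "\<forall>s. f differentiable (at s)" "continuous_on UNIV (deriv f)"
    and kappa: "\<kappa> > 0"
    and u_C3: "Ck_closure 3 u \<Omega>"
    and u_bdd: "bounded (u ` \<Omega>)"
    and eq: "p_laplace_eq p f u \<Omega>"
    and pos: "\<forall>x\<in>\<Omega>. u x > 0"
    and dir: "\<forall>q\<in>frontier \<Omega>. u q = 0"
    and neu: "\<forall>q\<in>frontier \<Omega>. \<forall>\<nu>. ext_normal \<Omega> q \<nu> \<longrightarrow> bgrad u \<Omega> q \<bullet> \<nu> = - \<kappa>"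
    and F_prim: "\<forall>s. (F has_real_derivative f s) (at s)"
    and F_C2: "\<forall>s. deriv F differentiable (at s)" "continuous_on UNIV (deriv (deriv F))"
    and F_nonpos: "\<forall>s. F s \<le> 0"
    and F0: "F 0 \<ge> - ((p - 1) / p) * \<kappa> powr p"
    and F_deg: "p > 2 \<Longrightarrow> \<forall>u0. F u0 = 0 \<longrightarrow> F \<in> O[at u0](\<lambda>s. \<bar>s - u0\<bar> powr p)"
  shows "parallel_sol \<Omega> u \<or>
         (\<forall>q\<in>frontier \<Omega>. (\<exists>H. mean_curv \<Omega> q H) \<and> (\<forall>H. mean_curv \<Omega> q H \<longrightarrow> H < 0))"
proof -
  have \<Omega>: "open \<Omega>" "connected \<Omega>" "\<Omega> \<noteq> {}" "\<And>q. q \<in> frontier \<Omega> \<Longrightarrow> \<exists>r \<phi>. local_defining 1 \<Omega> q r \<phi>"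
    using dom by (auto simp: C1_domain_def)
  obtain Du D2u where ext: "continuous_on (closure \<Omega>) Du" "\<And>x. x \<in> \<Omega> \<Longrightarrow> Du x = grad u x"
    "continuous_on (closure \<Omega>) D2u" "\<And>x. x \<in> \<Omega> \<Longrightarrow> D2u x = hess u x"
    using Ck_closureE[OF u_C3] by auto
  interpret overdetermined_problem \<Omega> u f F p Du D2u \<kappa>
  proof
    fix q r \<phi> assume q: "q \<in> frontier \<Omega>" and "local_defining 1 \<Omega> q r \<phi>"
    then have "ext_normal \<Omega> q (sgn (grad \<phi> q))"
      unfolding ext_normal_def by (auto simp: sgn_div_norm divide_inverse)
    then show "Du q \<bullet> sgn (grad \<phi> q) = - \<kappa>"
      using neu q bgrad_eq[OF ext(1,2) \<Omega>(1) q] by auto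
  qed (use \<Omega> ext p f_C1(1) kappa u_C3 u_bdd eq pos dir F_prim F_nonpos F0 F_deg in \<open>auto simp: Ck_closure_def\<close>)
  show ?thesis by (rule parallel_or_mean_curv_neg[OF n2])
qed

end
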